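(* For each integer $n\ge 1$ let $\mu_n$ be the Borel probability measure on $(X,d)$ that is uniform on the finite set $\mathcal{A}_n\subset X$ of fair Peano paths. Let $\lambda=\{\lambda_t\}_{t\in[0,1]}\in X$ be the growing family of triangles $\lambda_t=\{x+iy\in\overline{Q} : x+y\le 2t\}$. Then $\mu_n$ converges weakly, as $n\to\infty$, to the Dirac measure $\delta_\lambda$.
   Context: Identify $\mathbb{C}$ with $\mathbb{R}^2$. Let $Q=(0,1]\times[0,1)$ be the unit square including its bottom and right sides, so that $\overline{Q}=[0,1]^2$. **Fair trees.** For a finite connected graph $G=(V,E)$ (multi-edges allowed, no self-loops), let $\Gamma_G$ be the set of its spanning trees and $\mathcal{P}(\Gamma_G)$ the set of probability mass functions (pmfs) on $\Gamma_G$. For $\mu\in\mathcal{P}(\Gamma_G)$ put $\eta_\mu(e)=\mathbb{P}_\mu(e\in\underline{\gamma})$, the probability that a $\mu$-random tree $\underline\gamma$ contains $e\in E$. The pmf $\mu$ is called fair if it minimizes the variance $\operatorname{Var}(\eta_\mu)$ (the variance of $e\mapsto\eta_\mu(e)$ with respect to the uniform distribution on $E$) over $\mathcal{P}(\Gamma_G)$. A spanning tree is fair if it lies in the support of some fair pmf. **The set $\Gamma_n$.** Consider the nearest-neighbor graph on $\mathcal{L}_n=\left[\frac1n\mathbb{Z}\times\frac1n\mathbb{Z}\right]\cap Q$. $\Gamma_n$ is the set of spanning trees of $\mathcal{L}_n$ that contain all edges along the bottom and right sides of $Q$ and that become fair trees after the bottom and right sides are contracted to a single vertex (self-loops removed,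 multi-edges kept). Equivalently (as identified in the paper), $\Gamma_n$ consists of those subgraphs obtained by taking all edges along the bottom and right sides and, for every vertex of $\mathcal{L}_n$ not on the bottom or right side of $Q$, choosing exactly one of the two edges joining it to its right neighbor or to the neighbor below it. **Fair Peano paths.** For $\gamma\in\Gamma_n$ (regarded as a union of closed edges, together with the segments from $0$ to $1/n$ and from $1+i(n-1)/n$ to $1+i$), there is a unique spanning tree $\hat\gamma$ of the nearest-neighbor dual grid $\left[(\frac1{2n}+\frac1n\mathbb{Z})\times(\frac1{2n}+\frac1n\mathbb{Z})\right]\cap Q$ with $\gamma\cap\hat\gamma=\emptyset$. The Peano path $\zeta_\gamma$ is the path from $0$ to $1+i$ that winds between $\gamma$ and $\hat\gamma$. Explicitly, it starts with the segments from $0$ to $\frac1{4n}+\frac{i}{4n}$ and then to $\frac{3}{4n}+\frac{i}{4n}$. It then runs along the simple path from $\frac3{4n}+\frac{i}{4n}$ to $(1-\frac1{4n})+i(1-\frac3{4n})$ that consists of all nearest-neighbor edges (of length $\frac1{2n}$) of the lattice points of $(\frac1{4n}+\frac1{2n}\mathbb{Z})\times(\frac1{4n}+\frac1{2n}\mathbb{Z})$ lying in $[\frac3{4n},1-\frac1{4n}]\times[\frac1{4n},1-\frac3{4n}]$ which do not intersect $\gamma\cup\hat\gamma$. It ends with the segments to $(1-\frac1{4n})+i(1-\frac1{4n})$ and then to $1+i$. Set $\mathcal{A}_n=\{\zeta_\gamma:\gamma\in\Gamma_n\}$. **The space $X$.** An element $\zeta\in\mathcal{A}_n$ is regarded as the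 growing family of traces $\{\zeta[0,t]\}_{t\in[0,1]}$ modulo reparametrization. More generally, consider families $\kappa=\{\kappa_t\}_{t\in[0,1]}$ of nonempty compact subsets of $\overline{Q}$ with $\kappa_s\subseteq\kappa_t$ for $s\le t$, modulo reparametrization by increasing homeomorphisms of $[0,1]$, with distance $$d(\kappa,\kappa')=\inf\ \sup_{t\in[0,1]} d_H(\kappa_t,\kappa'_t),$$ where the infimum is over all reparametrizations of $\kappa$ and $\kappa'$, and $d_H$ is the Hausdorff distance; families at distance $0$ are identified. $X=\overline{\bigcup_n\mathcal{A}_n}$ is the closure of $\bigcup_n\mathcal{A}_n$ with respect to $d$, equipped with the Borel $\sigma$-algebra induced by $d$. The family $\lambda$ is an element of $X$. Weak convergence means convergence of integrals of all bounded continuous functions on $(X,d)$. *)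

theory Defs
  imports "HOL-Probability.Probability"
begin

section \<open>Multigraphs, spanning trees and fair trees\<close>

text \<open>
  Undirected multigraphs: every edge is a name together with its set of end vertices.
\<close>

record ('v, 'e) multigraph =
  verts :: "'v set"
  edges :: "'e set"
  ends  :: "'e \<Rightarrow> 'v set"

definition connected_by :: "('v, 'e) multigraph \<Rightarrow> 'e set \<Rightarrow> bool" where
  "connected_by G T \<longleftrightarrow>
     (\<forall>u\<in>verts G. \<forall>v\<in>verts G. (u, v) \<in> {(a, b). \<exists>e\<in>T. ends G e = {a, b}}\<^sup>*)"

text \<open>
  A cycle is given by its successive distinct vertices and distinct edges; two parallel edges
  form a cycle of length two.
\<close>

definition is_cycle :: "('v, 'e) multigraph \<Rightarrow> 'v list \<Rightarrow> 'e list \<Rightarrow> bool" where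
  "is_cycle G vs es \<longleftrightarrow>
     es \<noteq> [] \<and> length vs = length es \<and> distinct vs \<and> distinct es \<and>
     (\<forall>k<length es. ends G (es ! k) = {vs ! k, vs ! (Suc k mod length vs)})"

definition acyclic_edges :: "('v, 'e) multigraph \<Rightarrow> 'e set \<Rightarrow> bool" where
  "acyclic_edges G T \<longleftrightarrow> \<not> (\<exists>vs es. set es \<subseteq> T \<and> is_cycle G vs es)"

definition spanning_trees :: "('v, 'e) multigraph \<Rightarrow> 'e set set" where
  "spanning_trees G = {T. T \<subseteq> edges G \<and> connected_by G T \<and> acyclic_edges G T}"

definition edge_prob :: "'e set pmf \<Rightarrow> 'e \<Rightarrow> real" where
  "edge_prob \<mu> e = measure_pmf.prob \<mu> {T. e \<in> T}"

text \<open>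
  Variance of a function with respect to the uniform distribution on a finite set; it is 0 for
  the empty set, which occurs as the edge set of the contracted lattice for \<open>n = 1\<close>.
\<close>

definition unif_mean :: "'e set \<Rightarrow> ('e \<Rightarrow> real) \<Rightarrow> real" where
  "unif_mean E f = (\<Sum>e\<in>E. f e) / real (card E)"

definition unif_variance :: "'e set \<Rightarrow> ('e \<Rightarrow> real) \<Rightarrow> real" where
  "unif_variance E f = unif_mean E (\<lambda>e. (f e - unif_mean E f)\<^sup>2)"

definition fair_pmf :: "('v, 'e) multigraph \<Rightarrow> 'e set pmf \<Rightarrow> bool" where
  "fair_pmf G \<mu> \<longleftrightarrow> set_pmf \<mu> \<subseteq> spanning_trees G \<and>
     (\<forall>\<nu>. set_pmf \<nu> \<subseteq> spanning_trees G \<longrightarrow>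
        unif_variance (edges G) (edge_prob \<mu>) \<le> unif_variance (edges G) (edge_prob \<nu>))"

definition fair_trees :: "('v, 'e) multigraph \<Rightarrow> 'e set set" where
  "fair_trees G = {T. \<exists>\<mu>. fair_pmf G \<mu> \<and> T \<in> set_pmf \<mu>}"

text \<open>
  Contraction of a vertex set \<open>B\<close> to a single vertex. The vertices of the contracted graph are
  the blocks \<open>B\<close> and \<open>{v}\<close> for \<open>v \<notin> B\<close>. Edges keep their names, so parallel edges are kept;
  edges which have become self-loops are removed.
\<close>

definition block :: "'v set \<Rightarrow> 'v \<Rightarrow> 'v set" where
  "block B v = (if v \<in> B then B else {v})"

definition contract :: "'v set \<Rightarrow> ('v, 'e) multigraph \<Rightarrow> ('v set, 'e) multigraph" where
  "contract B G =
     \<lparr> verts = block B ` verts G,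
       edges = {e \<in> edges G. card (block B ` ends G e) \<noteq> 1},
       ends = (\<lambda>e. block B ` ends G e) \<rparr>"

section \<open>The lattice and its fair trees\<close>

definition unit_square :: "complex set" where
  "unit_square = {z. 0 < Re z \<and> Re z \<le> 1 \<and> 0 \<le> Im z \<and> Im z < 1}"

definition Qbar :: "complex set" where
  "Qbar = {z. 0 \<le> Re z \<and> Re z \<le> 1 \<and> 0 \<le> Im z \<and> Im z \<le> 1}"

definition grid :: "real \<Rightarrow> real \<Rightarrow> complex set" where
  "grid a h = {Complex (a + of_int k * h) (a + of_int l * h) | k l. True}"

definition nn_graph :: "real \<Rightarrow> complex set \<Rightarrow> (complex, complex set) multigraph" where
  "nn_graph h V =
     \<lparr> verts = V, edges = {{z, w} | z w. z \<in> V \<and> w \<in> V \<and> dist z w = h}, ends = (\<lambda>e. e) \<rparr>"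

definition primal_graph :: "nat \<Rightarrow> (complex, complex set) multigraph" where
  "primal_graph n = nn_graph (1 / n) (grid 0 (1 / n) \<inter> unit_square)"

definition dual_graph :: "nat \<Rightarrow> (complex, complex set) multigraph" where
  "dual_graph n = nn_graph (1 / n) (grid (1 / (2 * n)) (1 / n) \<inter> unit_square)"

definition bottom_verts :: "nat \<Rightarrow> complex set" where
  "bottom_verts n = {z \<in> verts (primal_graph n). Im z = 0}"

definition right_verts :: "nat \<Rightarrow> complex set" where
  "right_verts n = {z \<in> verts (primal_graph n). Re z = 1}"

definition side_edges :: "nat \<Rightarrow> complex set set" where
  "side_edges n = {e \<in> edges (primal_graph n). e \<subseteq> bottom_verts n \<or> e \<subseteq> right_verts n}"

definition contracted_graph :: "nat \<Rightarrow> (complex set, complex set) multigraph" where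
  "contracted_graph n = contract (bottom_verts n \<union> right_verts n) (primal_graph n)"

definition fair_lattice_trees :: "nat \<Rightarrow> complex set set set" where
  "fair_lattice_trees n = {T \<in> spanning_trees (primal_graph n).
            side_edges n \<subseteq> T \<and> T \<inter> edges (contracted_graph n) \<in> fair_trees (contracted_graph n)}"

section \<open>Fair Peano paths\<close>

text \<open>An edge is a set of two points; its convex hull is the closed segment between them.\<close>

definition drawing :: "complex set set \<Rightarrow> complex set" where
  "drawing T = (\<Union>e\<in>T. convex hull e)"

definition primal_drawing :: "nat \<Rightarrow> complex set set \<Rightarrow> complex set" where
  "primal_drawing n T = drawing T
     \<union> closed_segment 0 (Complex (1 / n) 0)
     \<union> closed_segment (Complex 1 ((real n - 1) / n)) (Complex 1 1)"

text \<open>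
  For \<open>T\<close> in \<open>fair_lattice_trees n\<close> the dual tree \<open>T'\<close> and the lattice path below are unique, so that
  the relational formulation determines the Peano path of \<open>T\<close>.
\<close>

definition is_dual_tree :: "nat \<Rightarrow> complex set set \<Rightarrow> complex set set \<Rightarrow> bool" where
  "is_dual_tree n T T' \<longleftrightarrow>
     T' \<in> spanning_trees (dual_graph n) \<and> primal_drawing n T \<inter> drawing T' = {}"

definition peano_verts :: "nat \<Rightarrow> complex set" where
  "peano_verts n = {z \<in> grid (1 / (4 * n)) (1 / (2 * n)).
      3 / (4 * n) \<le> Re z \<and> Re z \<le> 1 - 1 / (4 * n) \<and>
      1 / (4 * n) \<le> Im z \<and> Im z \<le> 1 - 3 / (4 * n)}"

definition peano_edges :: "nat \<Rightarrow> complex set set \<Rightarrow> complex set set \<Rightarrow> complex set set" where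
  "peano_edges n T T' =
     {e \<in> edges (nn_graph (1 / (2 * n)) (peano_verts n)).
        convex hull e \<inter> (primal_drawing n T \<union> drawing T') = {}}"

text \<open>
  The simple lattice path, as the list of its successive vertices. For \<open>n = 1\<close> it is a single point.
\<close>

definition is_peano_list :: "nat \<Rightarrow> complex set set \<Rightarrow> complex set set \<Rightarrow> complex list \<Rightarrow> bool" where
  "is_peano_list n T T' ps \<longleftrightarrow>
     ps \<noteq> [] \<and> distinct ps \<and> set ps \<subseteq> peano_verts n \<and>
     hd ps = Complex (3 / (4 * n)) (1 / (4 * n)) \<and>
     last ps = Complex (1 - 1 / (4 * n)) (1 - 3 / (4 * n)) \<and>
     {{ps ! k, ps ! Suc k} | k. Suc k < length ps} = peano_edges n T T'"

fun polyline :: "complex list \<Rightarrow> real \<Rightarrow> complex" where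
  "polyline [] = linepath 0 0"
| "polyline [a] = linepath a a"
| "polyline [a, b] = linepath a b"
| "polyline (a # b # c # ps) = linepath a b +++ polyline (b # c # ps)"

definition is_peano_path :: "nat \<Rightarrow> complex set set \<Rightarrow> (real \<Rightarrow> complex) \<Rightarrow> bool" where
  "is_peano_path n T \<zeta> \<longleftrightarrow> (\<exists>T' ps. is_dual_tree n T T' \<and> is_peano_list n T T' ps \<and>
     \<zeta> = polyline ([0, Complex (1 / (4 * n)) (1 / (4 * n))] @ ps @
                   [Complex (1 - 1 / (4 * n)) (1 - 1 / (4 * n)), Complex 1 1]))"

section \<open>The metric space of growing families\<close>

definition hausdorff_dist :: "'a::metric_space set \<Rightarrow> 'a set \<Rightarrow> real" where
  "hausdorff_dist A B = max (SUP a\<in>A. infdist a B) (SUP b\<in>B. infdist b A)"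

text \<open>Only the values on \<open>{0..1}\<close> of a family matter.\<close>

definition growing_family :: "(real \<Rightarrow> complex set) \<Rightarrow> bool" where
  "growing_family \<kappa> \<longleftrightarrow>
     (\<forall>t\<in>{0..1}. \<kappa> t \<noteq> {} \<and> compact (\<kappa> t) \<and> \<kappa> t \<subseteq> Qbar) \<and> mono_on {0..1} \<kappa>"

definition reparam :: "(real \<Rightarrow> real) \<Rightarrow> bool" where
  "reparam \<phi> \<longleftrightarrow> strict_mono_on {0..1} \<phi> \<and> (\<exists>\<phi>'. homeomorphism {0..1} {0..1} \<phi> \<phi>')"

definition family_dist :: "(real \<Rightarrow> complex set) \<Rightarrow> (real \<Rightarrow> complex set) \<Rightarrow> real" where
  "family_dist \<kappa> \<kappa>' =
     (INF (\<phi>, \<psi>) \<in> {(\<phi>, \<psi>). reparam \<phi> \<and> reparam \<psi>}.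
        SUP t\<in>{0..1}. hausdorff_dist (\<kappa> (\<phi> t)) (\<kappa>' (\<psi> t)))"

lemma infdist_bound:
  assumes "x \<in> Qbar" "B \<subseteq> Qbar" "B \<noteq> {}"
  shows "infdist x B \<le> 2"
proof -
  obtain b where b: "b \<in> B" using assms by auto
  have "b \<in> Qbar" using b assms by auto
  have "dist x b \<le> \<bar>Re (x - b)\<bar> + \<bar>Im (x - b)\<bar>"
    unfolding dist_norm by (rule cmod_le)
  also have "\<dots> \<le> 2" using assms(1) \<open>b \<in> Qbar\<close> by (auto simp: Qbar_def)
  finally show ?thesis using infdist_le[OF b, of x] by linarith
qed

lemma hausdorff_dist_le_iff:
  assumes "A \<subseteq> Qbar" "A \<noteq> {}" "B \<subseteq> Qbar" "B \<noteq> {}"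
  shows "hausdorff_dist A B \<le> r \<longleftrightarrow> (\<forall>a\<in>A. infdist a B \<le> r) \<and> (\<forall>b\<in>B. infdist b A \<le> r)"
proof -
  have "bdd_above ((\<lambda>a. infdist a B) ` A)" "bdd_above ((\<lambda>b. infdist b A) ` B)"
    using infdist_bound assms by (auto intro!: bdd_aboveI2[where M = 2])
  then show ?thesis
    unfolding hausdorff_dist_def using assms by (simp add: cSUP_le_iff)
qed

lemma hausdorff_dist_commute: "hausdorff_dist A B = hausdorff_dist B A"
  by (simp add: hausdorff_dist_def max.commute)

lemma hausdorff_dist_bounds:
  assumes "A \<subseteq> Qbar" "A \<noteq> {}" "B \<subseteq> Qbar" "B \<noteq> {}"
  shows "0 \<le> hausdorff_dist A B" "hausdorff_dist A B \<le> 2"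
proof -
  obtain a where "a \<in> A" using assms by auto
  then have "infdist a B \<le> hausdorff_dist A B"
    using hausdorff_dist_le_iff[OF assms, of "hausdorff_dist A B"] by auto
  then show "0 \<le> hausdorff_dist A B" using infdist_nonneg[of a B] by linarith
  have "\<forall>a\<in>A. infdist a B \<le> 2" "\<forall>b\<in>B. infdist b A \<le> 2"
    using infdist_bound assms by blast+
  then show "hausdorff_dist A B \<le> 2"
    using hausdorff_dist_le_iff[OF assms] by blast
qed

lemma infdist_le_hausdorff_dist:
  assumes "a \<in> A" "compact B" "A \<subseteq> Qbar" "B \<subseteq> Qbar" "B \<noteq> {}" "C \<subseteq> Qbar" "C \<noteq> {}"
  shows "infdist a C \<le> infdist a B + hausdorff_dist B C"
proof -
  obtain b where b: "b \<in> B" "infdist a B = dist a b"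
    using infdist_attains_inf[of B a] assms compact_imp_closed by metis
  have "infdist b C \<le> hausdorff_dist B C"
    using hausdorff_dist_le_iff[of B C "hausdorff_dist B C"] assms b by auto
  then show ?thesis using infdist_triangle[of a C b] b by linarith
qed

lemma hausdorff_dist_triangle:
  assumes "A \<subseteq> Qbar" "A \<noteq> {}" "B \<subseteq> Qbar" "B \<noteq> {}" "compact B" "C \<subseteq> Qbar" "C \<noteq> {}"
  shows "hausdorff_dist A C \<le> hausdorff_dist A B + hausdorff_dist B C"
proof -
  have AB: "\<forall>a\<in>A. infdist a B \<le> hausdorff_dist A B"
    using hausdorff_dist_le_iff[of A B "hausdorff_dist A B"] assms by auto
  have CB: "\<forall>c\<in>C. infdist c B \<le> hausdorff_dist B C"
    using hausdorff_dist_le_iff[of B C "hausdorff_dist B C"] assms by auto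
  have "infdist a C \<le> hausdorff_dist A B + hausdorff_dist B C" if "a \<in> A" for a
    using infdist_le_hausdorff_dist[of a A B C] that assms AB by force
  moreover have "infdist c A \<le> hausdorff_dist A B + hausdorff_dist B C" if "c \<in> C" for c
    using infdist_le_hausdorff_dist[of c C B A] that assms CB hausdorff_dist_commute[of A B] by force
  ultimately show ?thesis using hausdorff_dist_le_iff[of A C] assms by auto
qed

lemma reparam_id: "reparam (\<lambda>t. t)"
  unfolding reparam_def
  by (auto simp: strict_mono_on_def intro!: exI[of _ "\<lambda>t. t"] homeomorphism_ident)

lemma reparam_in: "reparam \<phi> \<Longrightarrow> t \<in> {0..1} \<Longrightarrow> \<phi> t \<in> {0..1}"
  unfolding reparam_def homeomorphism_def by blast

lemma reparam_compose:
  assumes "reparam \<phi>" "reparam \<psi>"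
  shows "reparam (\<lambda>t. \<phi> (\<psi> t))"
proof -
  obtain \<phi>' \<psi>' where "homeomorphism {0..1} {0..1} \<phi> \<phi>'" "homeomorphism {0..1} {0..1} \<psi> \<psi>'"
    using assms unfolding reparam_def by auto
  then have "homeomorphism {0..1} {0..1} (\<phi> \<circ> \<psi>) (\<psi>' \<circ> \<phi>')"
    by (rule homeomorphism_compose[rotated])
  moreover have "strict_mono_on {0..1} (\<lambda>t. \<phi> (\<psi> t))"
    using assms reparam_in[OF assms(2)] unfolding reparam_def strict_mono_on_def by simp
  ultimately show ?thesis unfolding reparam_def o_def by blast
qed

lemma reparam_inverse:
  assumes "reparam \<phi>"
  obtains \<phi>' where "reparam \<phi>'" "\<And>t. t \<in> {0..1} \<Longrightarrow> \<phi> (\<phi>' t) = t"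
proof -
  obtain \<phi>' where h: "homeomorphism {0..1} {0..1} \<phi> \<phi>'" and m: "strict_mono_on {0..1} \<phi>"
    using assms unfolding reparam_def by auto
  have inv: "\<phi> (\<phi>' t) = t" "\<phi>' t \<in> {0..1}" if "t \<in> {0..1}" for t
    using h that unfolding homeomorphism_def by auto
  have "strict_mono_on {0..1} \<phi>'"
  proof (rule strict_mono_onI)
    fix r s :: real assume *: "r \<in> {0..1}" "s \<in> {0..1}" "r < s"
    show "\<phi>' r < \<phi>' s"
    proof (rule ccontr)
      assume "\<not> \<phi>' r < \<phi>' s"
      then have "\<phi> (\<phi>' s) \<le> \<phi> (\<phi>' r)"
        using strict_mono_on_leD[OF m inv(2)[OF *(2)] inv(2)[OF *(1)]] by simp
      then show False using inv(1)[OF *(1)] inv(1)[OF *(2)] *(3) by simp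
    qed
  qed
  then have "reparam \<phi>'" using homeomorphism_symD[OF h] unfolding reparam_def by blast
  then show thesis using that inv by blast
qed

definition sup_dist :: "(real \<Rightarrow> complex set) \<Rightarrow> (real \<Rightarrow> complex set) \<Rightarrow> real" where
  "sup_dist \<kappa> \<kappa>' = (SUP t\<in>{0..1}. hausdorff_dist (\<kappa> t) (\<kappa>' t))"

lemma growing_familyD:
  assumes "growing_family \<kappa>" "t \<in> {0..1}"
  shows "\<kappa> t \<noteq> {}" "compact (\<kappa> t)" "\<kappa> t \<subseteq> Qbar"
  using assms unfolding growing_family_def by auto

lemma growing_family_reparam:
  assumes "growing_family \<kappa>" "reparam \<phi>"
  shows "growing_family (\<lambda>t. \<kappa> (\<phi> t))"
proof -
  have "mono_on {0..1} \<phi>" using assms(2) unfolding reparam_def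
    by (auto intro: strict_mono_on_imp_mono_on)
  then have "mono_on {0..1} (\<lambda>t. \<kappa> (\<phi> t))"
    using assms(1) reparam_in[OF assms(2)] unfolding growing_family_def mono_on_def by blast
  then show ?thesis
    using assms(1) reparam_in[OF assms(2)] unfolding growing_family_def by blast
qed

lemma sup_dist_le_iff:
  assumes "growing_family \<kappa>" "growing_family \<kappa>'"
  shows "sup_dist \<kappa> \<kappa>' \<le> r \<longleftrightarrow> (\<forall>t\<in>{0..1}. hausdorff_dist (\<kappa> t) (\<kappa>' t) \<le> r)"
proof -
  have "bdd_above ((\<lambda>t. hausdorff_dist (\<kappa> t) (\<kappa>' t)) ` {0..1})"
    using growing_familyD[OF assms(1)] growing_familyD[OF assms(2)] hausdorff_dist_bounds
    by (intro bdd_aboveI2[where M = 2]) auto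
  then show ?thesis unfolding sup_dist_def by (simp add: cSUP_le_iff)
qed

lemma sup_dist_nonneg:
  assumes "growing_family \<kappa>" "growing_family \<kappa>'"
  shows "0 \<le> sup_dist \<kappa> \<kappa>'"
proof -
  have "hausdorff_dist (\<kappa> 0) (\<kappa>' 0) \<le> sup_dist \<kappa> \<kappa>'"
    using sup_dist_le_iff[OF assms, of "sup_dist \<kappa> \<kappa>'"] by auto
  moreover have "0 \<le> hausdorff_dist (\<kappa> 0) (\<kappa>' 0)"
    using growing_familyD[OF assms(1), of 0] growing_familyD[OF assms(2), of 0]
    by (intro hausdorff_dist_bounds) auto
  ultimately show ?thesis by linarith
qed

lemma sup_dist_reparam_nonneg:
  assumes "growing_family \<kappa>" "growing_family \<kappa>'" "reparam \<phi>" "reparam \<psi>"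
  shows "0 \<le> sup_dist (\<lambda>t. \<kappa> (\<phi> t)) (\<lambda>t. \<kappa>' (\<psi> t))"
  by (rule sup_dist_nonneg[OF growing_family_reparam[OF assms(1,3)]
        growing_family_reparam[OF assms(2,4)]])

lemma family_dist_eq:
  "family_dist \<kappa> \<kappa>' = (INF (\<phi>, \<psi>) \<in> {(\<phi>, \<psi>). reparam \<phi> \<and> reparam \<psi>}.
     sup_dist (\<lambda>t. \<kappa> (\<phi> t)) (\<lambda>t. \<kappa>' (\<psi> t)))"
  by (simp add: family_dist_def sup_dist_def)

lemma family_dist_le:
  assumes "growing_family \<kappa>" "growing_family \<kappa>'" "reparam \<phi>" "reparam \<psi>"
  shows "family_dist \<kappa> \<kappa>' \<le> sup_dist (\<lambda>t. \<kappa> (\<phi> t)) (\<lambda>t. \<kappa>' (\<psi> t))"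
proof -
  have "bdd_below ((\<lambda>(\<phi>, \<psi>). sup_dist (\<lambda>t. \<kappa> (\<phi> t)) (\<lambda>t. \<kappa>' (\<psi> t))) `
          {(\<phi>, \<psi>). reparam \<phi> \<and> reparam \<psi>})"
    using sup_dist_reparam_nonneg[OF assms(1,2)] by (intro bdd_belowI2[where m = 0]) auto
  from cINF_lower[OF this, of "(\<phi>, \<psi>)"] show ?thesis using assms by (simp add: family_dist_eq)
qed

lemma family_dist_lessE:
  assumes "family_dist \<kappa> \<kappa>' < r"
  obtains \<phi> \<psi> where "reparam \<phi>" "reparam \<psi>" "sup_dist (\<lambda>t. \<kappa> (\<phi> t)) (\<lambda>t. \<kappa>' (\<psi> t)) < r"
proof -
  let ?S = "{(\<phi>, \<psi>). reparam \<phi> \<and> reparam \<psi>}"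
  have "?S \<noteq> {}" using reparam_id by auto
  then have "\<exists>p\<in>?S. (\<lambda>(\<phi>, \<psi>). sup_dist (\<lambda>t. \<kappa> (\<phi> t)) (\<lambda>t. \<kappa>' (\<psi> t))) p < r"
    using assms cInf_lessD[of "(\<lambda>(\<phi>, \<psi>). sup_dist (\<lambda>t. \<kappa> (\<phi> t)) (\<lambda>t. \<kappa>' (\<psi> t))) ` ?S" r]
    unfolding family_dist_eq by blast
  then show thesis using that by auto
qed

lemma family_dist_nonneg:
  assumes "growing_family \<kappa>" "growing_family \<kappa>'"
  shows "0 \<le> family_dist \<kappa> \<kappa>'"
proof (rule ccontr)
  assume "\<not> 0 \<le> family_dist \<kappa> \<kappa>'"
  then obtain \<phi> \<psi> where *: "reparam \<phi>" "reparam \<psi>"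
    "sup_dist (\<lambda>t. \<kappa> (\<phi> t)) (\<lambda>t. \<kappa>' (\<psi> t)) < 0"
    using family_dist_lessE[of \<kappa> \<kappa>' 0] by auto
  show False using sup_dist_reparam_nonneg[OF assms *(1,2)] *(3) by linarith
qed

lemma family_dist_refl:
  assumes "growing_family \<kappa>"
  shows "family_dist \<kappa> \<kappa> = 0"
proof -
  have "hausdorff_dist (\<kappa> t) (\<kappa> t) \<le> 0" if "t \<in> {0..1}" for t
    using growing_familyD[OF assms that] by (subst hausdorff_dist_le_iff) auto
  then have "sup_dist \<kappa> \<kappa> \<le> 0" using sup_dist_le_iff[OF assms assms] by auto
  then show ?thesis
    using family_dist_le[OF assms assms reparam_id reparam_id] family_dist_nonneg[OF assms assms]
    by auto
qed

lemma family_dist_commute_le: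
  assumes "growing_family \<kappa>" "growing_family \<kappa>'"
  shows "family_dist \<kappa> \<kappa>' \<le> family_dist \<kappa>' \<kappa>"
proof (rule ccontr)
  assume "\<not> ?thesis"
  then obtain \<phi> \<psi> where *: "reparam \<phi>" "reparam \<psi>"
    "sup_dist (\<lambda>t. \<kappa>' (\<phi> t)) (\<lambda>t. \<kappa> (\<psi> t)) < family_dist \<kappa> \<kappa>'"
    using family_dist_lessE[of \<kappa>' \<kappa> "family_dist \<kappa> \<kappa>'"] by auto
  moreover have "family_dist \<kappa> \<kappa>' \<le> sup_dist (\<lambda>t. \<kappa> (\<psi> t)) (\<lambda>t. \<kappa>' (\<phi> t))"
    using family_dist_le assms * by blast
  ultimately show False by (simp add: sup_dist_def hausdorff_dist_commute)
qed

lemma family_dist_commute: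
  assumes "growing_family \<kappa>" "growing_family \<kappa>'"
  shows "family_dist \<kappa> \<kappa>' = family_dist \<kappa>' \<kappa>"
  using family_dist_commute_le[OF assms] family_dist_commute_le[OF assms(2,1)] by simp

lemma family_dist_triangle:
  assumes "growing_family \<kappa>" "growing_family \<kappa>'" "growing_family \<kappa>''"
  shows "family_dist \<kappa> \<kappa>'' \<le> family_dist \<kappa> \<kappa>' + family_dist \<kappa>' \<kappa>''"
proof (rule field_le_epsilon)
  fix e :: real assume "0 < e"
  obtain \<phi>1 \<psi>1 where 1: "reparam \<phi>1" "reparam \<psi>1"
    "sup_dist (\<lambda>t. \<kappa> (\<phi>1 t)) (\<lambda>t. \<kappa>' (\<psi>1 t)) < family_dist \<kappa> \<kappa>' + e / 2"
    using family_dist_lessE[of \<kappa> \<kappa>' "family_dist \<kappa> \<kappa>' + e / 2"] \<open>0 < e\<close> by auto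
  obtain \<phi>2 \<psi>2 where 2: "reparam \<phi>2" "reparam \<psi>2"
    "sup_dist (\<lambda>t. \<kappa>' (\<phi>2 t)) (\<lambda>t. \<kappa>'' (\<psi>2 t)) < family_dist \<kappa>' \<kappa>'' + e / 2"
    using family_dist_lessE[of \<kappa>' \<kappa>'' "family_dist \<kappa>' \<kappa>'' + e / 2"] \<open>0 < e\<close> by auto
  obtain \<theta> where \<theta>: "reparam \<theta>" "\<And>t. t \<in> {0..1} \<Longrightarrow> \<psi>1 (\<theta> t) = t"
    using reparam_inverse[OF 1(2)] by blast
  define \<phi> where "\<phi> = (\<lambda>t. \<phi>1 (\<theta> (\<phi>2 t)))"
  have \<phi>: "reparam \<phi>"
    unfolding \<phi>_def by (rule reparam_compose[OF 1(1) reparam_compose[OF \<theta>(1) 2(1)]])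
  note g1 = growing_family_reparam[OF assms(1) 1(1)] growing_family_reparam[OF assms(2) 1(2)]
  note g2 = growing_family_reparam[OF assms(2) 2(1)] growing_family_reparam[OF assms(3) 2(2)]
  note g3 = growing_family_reparam[OF assms(1) \<phi>]
  have "hausdorff_dist (\<kappa> (\<phi> t)) (\<kappa>'' (\<psi>2 t)) \<le> family_dist \<kappa> \<kappa>' + family_dist \<kappa>' \<kappa>'' + e"
    if t: "t \<in> {0..1}" for t
  proof -
    let ?s = "\<theta> (\<phi>2 t)"
    have s: "?s \<in> {0..1}" using reparam_in[OF \<theta>(1) reparam_in[OF 2(1) t]] .
    have "\<phi>2 t \<in> {0..1}" using reparam_in[OF 2(1) t] .
    then have eq: "\<kappa>' (\<psi>1 ?s) = \<kappa>' (\<phi>2 t)" using \<theta> by auto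
    have "hausdorff_dist (\<kappa> (\<phi> t)) (\<kappa>' (\<phi>2 t)) \<le> family_dist \<kappa> \<kappa>' + e / 2"
      using sup_dist_le_iff[OF g1, THEN iffD1, OF less_imp_le[OF 1(3)], rule_format, OF s] eq
      unfolding \<phi>_def by simp
    moreover have "hausdorff_dist (\<kappa>' (\<phi>2 t)) (\<kappa>'' (\<psi>2 t)) \<le> family_dist \<kappa>' \<kappa>'' + e / 2"
      using sup_dist_le_iff[OF g2, THEN iffD1, OF less_imp_le[OF 2(3)], rule_format, OF t] .
    moreover have "hausdorff_dist (\<kappa> (\<phi> t)) (\<kappa>'' (\<psi>2 t))
        \<le> hausdorff_dist (\<kappa> (\<phi> t)) (\<kappa>' (\<phi>2 t)) + hausdorff_dist (\<kappa>' (\<phi>2 t)) (\<kappa>'' (\<psi>2 t))"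
      using growing_familyD[OF g3 t] growing_familyD[OF g2(1) t] growing_familyD[OF g2(2) t]
      by (intro hausdorff_dist_triangle)
    ultimately show ?thesis by linarith
  qed
  then have "sup_dist (\<lambda>t. \<kappa> (\<phi> t)) (\<lambda>t. \<kappa>'' (\<psi>2 t))
      \<le> family_dist \<kappa> \<kappa>' + family_dist \<kappa>' \<kappa>'' + e"
    using sup_dist_le_iff[OF g3 g2(2)] by blast
  then show "family_dist \<kappa> \<kappa>'' \<le> family_dist \<kappa> \<kappa>' + family_dist \<kappa>' \<kappa>'' + e"
    using family_dist_le[OF assms(1,3) \<phi> 2(2)] by linarith
qed

text \<open>
  Families that differ by a reparametrization have distance 0, so identifying families at
  distance 0 subsumes passing to classes modulo reparametrization.
\<close>

definition same_growth :: "(real \<Rightarrow> complex set) \<Rightarrow> (real \<Rightarrow> complex set) \<Rightarrow> bool" where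
  "same_growth \<kappa> \<kappa>' \<longleftrightarrow> growing_family \<kappa> \<and> growing_family \<kappa>' \<and> family_dist \<kappa> \<kappa>' = 0"

lemma family_dist_cong:
  assumes "same_growth \<kappa>1 \<kappa>1'" "same_growth \<kappa>2 \<kappa>2'"
  shows "family_dist \<kappa>1 \<kappa>2 = family_dist \<kappa>1' \<kappa>2'"
proof -
  have le: "family_dist a b \<le> family_dist a' b'"
    if "same_growth a a'" "same_growth b b'" for a a' b b'
  proof -
    have *: "growing_family a" "growing_family a'" "growing_family b" "growing_family b'"
      "family_dist a a' = 0" "family_dist b b' = 0"
      using that unfolding same_growth_def by auto
    have "family_dist b' b = 0" using family_dist_commute[OF *(3,4)] * by simp
    then show ?thesis
      using family_dist_triangle[OF *(1,2,3)] family_dist_triangle[OF *(2,4,3)] * by linarith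
  qed
  have "same_growth \<kappa>1' \<kappa>1" "same_growth \<kappa>2' \<kappa>2"
    using assms by (simp_all add: same_growth_def family_dist_commute)
  then show ?thesis
    using le[OF assms] le[of "\<kappa>1'" \<kappa>1 "\<kappa>2'" \<kappa>2] by simp
qed

definition triangle_family :: "real \<Rightarrow> complex set" where
  "triangle_family t = {z \<in> Qbar. Re z + Im z \<le> 2 * t}"

lemma Qbar_eq_cbox: "Qbar = cbox 0 (Complex 1 1)"
  by (auto simp: Qbar_def in_cbox_complex_iff)

lemma growing_triangle_family: "growing_family triangle_family"
proof -
  have "compact (triangle_family t)" for t
  proof -
    have "triangle_family t = Qbar \<inter> {z. Re z + Im z \<le> 2 * t}"
      by (auto simp: triangle_family_def)
    moreover have "closed {z. Re z + Im z \<le> 2 * t}"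
      by (intro closed_Collect_le continuous_intros)
    ultimately show ?thesis by (simp add: Qbar_eq_cbox compact_Int_closed)
  qed
  moreover have "0 \<in> triangle_family t" if "t \<in> {0..1}" for t
    using that by (auto simp: triangle_family_def Qbar_def)
  ultimately show ?thesis
    unfolding growing_family_def mono_on_def by (fastforce simp: triangle_family_def)
qed

quotient_type growing = "real \<Rightarrow> complex set" / partial: same_growth
proof (rule part_equivpI)
  show "\<exists>\<kappa>. same_growth \<kappa> \<kappa>"
    using growing_triangle_family family_dist_refl unfolding same_growth_def by blast
  show "symp same_growth"
    by (simp add: symp_def same_growth_def family_dist_commute)
  show "transp same_growth"
  proof (rule transpI)
    fix a b c assume "same_growth a b" "same_growth b c"
    then have *: "growing_family a" "growing_family b" "growing_family c"
      "family_dist a b = 0" "family_dist b c = 0" unfolding same_growth_def by auto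
    have "family_dist a c \<le> 0" using family_dist_triangle[OF *(1,2,3)] * by simp
    then show "same_growth a c"
      using family_dist_nonneg[OF *(1,3)] * unfolding same_growth_def by auto
  qed
qed

instantiation growing :: metric_space
begin

lift_definition dist_growing :: "growing \<Rightarrow> growing \<Rightarrow> real" is family_dist
  by (rule family_dist_cong)

definition uniformity_growing :: "(growing \<times> growing) filter" where
  "uniformity_growing = (INF e\<in>{0<..}. principal {(x, y). dist x y < e})"

definition open_growing :: "growing set \<Rightarrow> bool" where
  "open_growing U \<longleftrightarrow> (\<forall>x\<in>U. eventually (\<lambda>(x', y). x' = x \<longrightarrow> y \<in> U) uniformity)"

instance
proof
  fix x y z :: growing
  show "dist x y = 0 \<longleftrightarrow> x = y"
    by transfer (auto simp: same_growth_def)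
  show "dist x y \<le> dist x z + dist y z"
    by transfer (metis same_growth_def family_dist_triangle family_dist_commute)
qed (rule uniformity_growing_def open_growing_def)+

end

lift_definition lambda_family :: growing is triangle_family
  using growing_triangle_family family_dist_refl by (simp add: same_growth_def)

section \<open>Fair Peano paths as random growing families\<close>

definition trace :: "(real \<Rightarrow> complex) \<Rightarrow> real \<Rightarrow> complex set" where
  "trace \<zeta> t = \<zeta> ` {0..t}"

definition fair_peano_paths :: "nat \<Rightarrow> growing set" where
  "fair_peano_paths n = {abs_growing (trace \<zeta>) | \<zeta> T. T \<in> fair_lattice_trees n \<and> is_peano_path n T \<zeta>}"

definition X_space :: "growing set" where
  "X_space = closure (\<Union>n\<in>{1..}. fair_peano_paths n)"

definition borel_X :: "growing measure" where
  "borel_X = restrict_space borel X_space"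

definition peano_measure :: "nat \<Rightarrow> growing measure" where
  "peano_measure n = distr (uniform_count_measure (fair_peano_paths n)) borel_X (\<lambda>x. x)"

definition weakly_converges_on ::
    "'a::topological_space set \<Rightarrow> (nat \<Rightarrow> 'a measure) \<Rightarrow> 'a measure \<Rightarrow> bool" where
  "weakly_converges_on S M N \<longleftrightarrow>
     (\<forall>f::'a \<Rightarrow> real. continuous_on S f \<and> bounded (f ` S) \<longrightarrow>
        (\<lambda>n. integral\<^sup>L (M n) f) \<longlonglongrightarrow> integral\<^sup>L N f)"

end

theory Submission
  imports Defs "HOL-Real_Asymp.Real_Asymp"
begin

text \<open>
  Spanning trees in \<open>fair_lattice_trees n\<close> are the outcomes of \<open>(n - 1)\<^sup>2\<close> independent coin flips: every
  vertex in the interior of the square chooses the edge to its right or the edge below it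
  (\<open>fair_lattice_trees_eq\<close>). The reason is a count. Choosing a configuration or its opposite with
  probability \<open>1/2\<close> each uses every edge of the contracted graph with the same probability \<open>1/2\<close>, so
  the minimal variance is 0, and under every fair pmf all edges have probability \<open>1/2\<close>. A set of
  vertices that is closed towards the upper left meets exactly twice as many edges as it has vertices,
  hence on average as many tree edges as it has vertices; as every tree needs at least that many, every
  fair tree has exactly that many, and removing one vertex from the set isolates its two edges.

  Following the chosen edges from a vertex gives a branch along which \<open>x - y\<close> grows by one lattice
  step each time, while \<open>x + y\<close> performs a simple random walk until the branch meets the bottom or the
  right side. The edges of the dual tree are read off from the same coins: its branches run to the left
  and upwards, and the point reflection of the square exchanges the two kinds of branches. By the
  exponential Markov inequality and a union bound, all branches stay within \<open>\<delta>\<close> of an antidiagonal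
  \<open>x + y = const\<close>, except for a fraction of the configurations that tends to 0
  (\<open>fraction_not_tame_tendsto_0\<close>).

  A vertex of the Peano path lies between a vertex of the tree and a vertex of the dual tree.
  The dual branch to the upper left and the primal branch to the lower right form a staircase through
  it which cuts the square in two, and the path has visited exactly the lower part. One step of the
  path adds exactly one vertex to the lower part (\<open>before_move\<close>). This proves at one stroke that the
  local rule of the path never closes up, that the path visits all vertices, and, if the branches
  are nearly antidiagonal, that \<open>x + y\<close> is nearly monotone along it (\<open>orbit_props\<close>, \<open>before_level\<close>).

  A path that comes close to every point of the square and along which \<open>x + y\<close> is nearly monotone fills, up to a small
  error, a growing triangle; its running maximum of \<open>x + y\<close>, slightly tilted, is the
  time change (\<open>family_dist_trace_triangle_le\<close>). Finally, different configurations give families at positive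
  distance, because the final set already shows which way each vertex has chosen. The uniform
  measure on the set of paths is thus the image of the uniform measure on configurations, and convergence
  in probability to a constant is weak convergence.
\<close>

section \<open>Spanning trees of multigraphs\<close>

text \<open>
  A walk can be shortened: on returning to a vertex already visited, cut out the detour.
\<close>

lemma simple_path_exists:
  assumes "(u, v) \<in> {(a, b). \<exists>e\<in>T. ends G e = {a, b}}\<^sup>*"
  shows "\<exists>vs es. distinct vs \<and> vs \<noteq> [] \<and> hd vs = u \<and> last vs = v \<and> length vs = Suc (length es) \<and>
           set es \<subseteq> T \<and> (\<forall>k<length es. ends G (es ! k) = {vs ! k, vs ! Suc k})"
  using assms
proof (induction rule: rtrancl_induct)
  case base
  show ?case by (rule exI[of _ "[u]"], rule exI[of _ "[]"]) auto
next
  case (step y z)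
  then obtain vs es where *: "distinct vs" "vs \<noteq> []" "hd vs = u" "last vs = y"
    "length vs = Suc (length es)" "set es \<subseteq> T" "\<forall>k<length es. ends G (es ! k) = {vs ! k, vs ! Suc k}"
    by blast
  obtain e where e: "e \<in> T" "ends G e = {y, z}" using step by auto
  show ?case
  proof (cases "z \<in> set vs")
    case True
    then obtain m where m: "m < length vs" "vs ! m = z" by (auto simp: in_set_conv_nth)
    have "last (take (Suc m) vs) = z" using m by (simp add: take_Suc_conv_app_nth)
    moreover have "hd (take (Suc m) vs) = u" using * by (cases vs) auto
    moreover have "set (take m es) \<subseteq> T" using * set_take_subset[of m es] by blast
    ultimately show ?thesis using * m
      by (intro exI[of _ "take (Suc m) vs"] exI[of _ "take m es"]) auto
  next
    case False
    have "vs ! length es = y" using * by (metis diff_Suc_1 last_conv_nth)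
    then show ?thesis using * e False
      by (intro exI[of _ "vs @ [z]"] exI[of _ "es @ [e]"]) (auto simp: nth_append less_Suc_eq)
  qed
qed

text \<open>
  An edge of \<open>T\<close> outside \<open>P\<close> would close a cycle with a simple path of \<open>P\<close> between its ends.
\<close>

lemma acyclic_connected_subset_eq:
  assumes acyclic: "acyclic_edges G T" and "P \<subseteq> T" and conn: "connected_by G P"
    and ends: "\<And>e. e \<in> T \<Longrightarrow> \<exists>u\<in>verts G. \<exists>v\<in>verts G. ends G e = {u, v}"
  shows "P = T"
proof (rule ccontr)
  assume "P \<noteq> T"
  then obtain e where e: "e \<in> T" "e \<notin> P" using \<open>P \<subseteq> T\<close> by blast
  obtain u v where uv: "u \<in> verts G" "v \<in> verts G" "ends G e = {u, v}" using ends[OF e(1)] by blast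
  obtain vs es where *: "distinct vs" "vs \<noteq> []" "hd vs = u" "last vs = v"
    "length vs = Suc (length es)" "set es \<subseteq> P" "\<forall>k<length es. ends G (es ! k) = {vs ! k, vs ! Suc k}"
    using simple_path_exists[of u v P G] conn uv unfolding connected_by_def by blast
  have last: "vs ! length es = v" using * by (metis diff_Suc_1 last_conv_nth)
  have first: "vs ! 0 = u" using * by (simp add: hd_conv_nth)
  have inj: "vs ! k = vs ! l \<longleftrightarrow> k = l" if "k \<le> length es" "l \<le> length es" for k l
    using that * by (simp add: nth_eq_iff_index_eq)
  have "distinct es"
  proof (subst distinct_conv_nth, intro allI impI)
    fix i j assume ij: "i < length es" "j < length es" "i \<noteq> j"
    then have "{vs ! i, vs ! Suc i} \<noteq> {vs ! j, vs ! Suc j}"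
      by (auto simp: doubleton_eq_iff inj)
    then show "es ! i \<noteq> es ! j" using * ij by metis
  qed
  then have "is_cycle G vs (es @ [e])"
    unfolding is_cycle_def
  proof (intro conjI allI impI)
    fix k assume "k < length (es @ [e])"
    then consider "k < length es" | "k = length es" by fastforce
    then show "ends G ((es @ [e]) ! k) = {vs ! k, vs ! (Suc k mod length vs)}"
    proof cases
      case 1
      then have "Suc k mod length vs = Suc k" using * by simp
      then show ?thesis using 1 * by (simp add: nth_append)
    next
      case 2
      then show ?thesis using * uv first last by (simp add: nth_append insert_commute)
    qed
  qed (use * e \<open>distinct es\<close> in auto)
  moreover have "set (es @ [e]) \<subseteq> T" using * e \<open>P \<subseteq> T\<close> by auto
  ultimately show False using acyclic unfolding acyclic_edges_def by blast
qed

lemma connected_by_rooted_edges: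
  fixes rank :: "'v \<Rightarrow> nat"
  assumes p: "\<And>v. v \<in> verts G \<Longrightarrow> v \<noteq> r \<Longrightarrow>
      p v \<in> verts G \<and> rank (p v) < rank v \<and> ends G (f v) = {v, p v}"
  shows "connected_by G (f ` (verts G - {r}))"
proof -
  let ?R = "{(a, b). \<exists>e\<in>f ` (verts G - {r}). ends G e = {a, b}}"
  have "v \<in> verts G \<Longrightarrow> (v, r) \<in> ?R\<^sup>*" for v
  proof (induction "rank v" arbitrary: v rule: less_induct)
    case less
    show ?case
    proof (cases "v = r")
      case False
      then have "(v, p v) \<in> ?R" "(p v, r) \<in> ?R\<^sup>*" using p[OF less.prems False] less by auto
      then show ?thesis by (rule converse_rtrancl_into_rtrancl)
    qed simp
  qed
  moreover have "sym (?R\<^sup>*)" by (intro sym_rtrancl) (auto simp: sym_def insert_commute)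
  ultimately show ?thesis
    unfolding connected_by_def by (meson rtrancl_trans symD)
qed

text \<open>
  A vertex of maximal rank on a cycle would be the child end of both of its cycle edges, and each
  vertex is the child end of only one edge.
\<close>

lemma acyclic_rooted_edges:
  fixes rank :: "'v \<Rightarrow> nat"
  assumes p: "\<And>v. v \<in> verts G \<Longrightarrow> v \<noteq> r \<Longrightarrow>
      p v \<in> verts G \<and> rank (p v) < rank v \<and> ends G (f v) = {v, p v}"
  shows "acyclic_edges G (f ` (verts G - {r}))"
  unfolding acyclic_edges_def
proof (intro notI, elim exE conjE)
  fix vs es assume sub: "set es \<subseteq> f ` (verts G - {r})" and cyc: "is_cycle G vs es"
  have c: "es \<noteq> []" "length vs = length es" "distinct vs" "distinct es"
    "\<And>k. k < length es \<Longrightarrow> ends G (es ! k) = {vs ! k, vs ! (Suc k mod length vs)}"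
    using cyc unfolding is_cycle_def by auto
  \<comment> \<open>A vertex of maximal rank on the cycle.\<close>
  have "Max (rank ` set vs) \<in> rank ` set vs" using c by (intro Max_in) auto
  then obtain k where k: "k < length es" "rank (vs ! k) = Max (rank ` set vs)"
    using c by (auto simp: in_set_conv_nth)
  have top: "rank (vs ! l) \<le> rank (vs ! k)" if "l < length es" for l
    unfolding k(2) using that c by (intro Max_ge) auto
  have own: "es ! l = f (vs ! k)" if lm: "l < length es" "m < length es" "ends G (es ! l) = {vs ! k, vs ! m}" for l m
  proof -
    obtain x where x: "x \<in> verts G" "x \<noteq> r" "es ! l = f x"
      using subsetD[OF sub nth_mem[OF lm(1)]] by blast
    have "{x, p x} = {vs ! k, vs ! m}" "rank (p x) < rank x" using p[OF x(1,2)] lm x by auto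
    moreover have "rank (vs ! m) \<le> rank (vs ! k)" using top lm by auto
    ultimately have "x = vs ! k" by (auto simp: doubleton_eq_iff)
    then show ?thesis using x by simp
  qed
  \<comment> \<open>The edges of the cycle after and before this vertex coincide, so the cycle has length one.\<close>
  let ?m = "Suc k mod length es" and ?l = "(k + length es - 1) mod length es"
  have bounds: "?m < length es" "?l < length es" using c(1) by simp_all
  have l: "Suc ?l mod length es = k"
  proof -
    have "Suc ?l mod length es = Suc (k + length es - 1) mod length es" by (rule mod_Suc_eq)
    also have "Suc (k + length es - 1) = k + length es" using c(1) by (cases es) auto
    finally show ?thesis using k by simp
  qed
  have "es ! k = f (vs ! k)" using own[OF k(1) bounds(1)] c(5)[OF k(1)] c(2) by simp
  moreover have "es ! ?l = f (vs ! k)"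
    using own[OF bounds(2) bounds(2)] c(5)[OF bounds(2)] c(2) l by (simp add: insert_commute)
  ultimately have "es ! ?l = es ! k" by simp
  then have "?l = k" using c(4) bounds(2) k(1) nth_eq_iff_index_eq by blast
  then have "?m = k" using l by metis
  then have "ends G (es ! k) = {vs ! k}" using c(5)[OF k(1)] c(2) by simp
  moreover obtain x where "x \<in> verts G" "x \<noteq> r" "es ! k = f x"
    using subsetD[OF sub nth_mem[OF k(1)]] by blast
  ultimately have "{x, p x} = {vs ! k}" "rank (p x) < rank x" using p[of x] by auto
  then show False by (auto simp: doubleton_eq_iff)
qed

text \<open>
  The rank is the graph distance to the root: every other vertex has a neighbour that is closer.
\<close>

lemma connected_by_parents:
  assumes conn: "connected_by G T" and r: "r \<in> verts G"
    and ends: "\<And>e. e \<in> T \<Longrightarrow> ends G e \<subseteq> verts G"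
  obtains f p and rank :: "'v \<Rightarrow> nat" where
    "\<And>v. v \<in> verts G \<Longrightarrow> v \<noteq> r \<Longrightarrow>
       f v \<in> T \<and> p v \<in> verts G \<and> rank (p v) < rank v \<and> ends G (f v) = {v, p v}"
proof -
  let ?R = "{(a, b). \<exists>e\<in>T. ends G e = {a, b}}"
  define rank where "rank v = (LEAST k. (v, r) \<in> ?R ^^ k)" for v
  have "\<exists>e w. e \<in> T \<and> w \<in> verts G \<and> rank w < rank v \<and> ends G e = {v, w}"
    if v: "v \<in> verts G" "v \<noteq> r" for v
  proof -
    have "(v, r) \<in> ?R\<^sup>*" using conn v r unfolding connected_by_def by blast
    then obtain k where "(v, r) \<in> ?R ^^ k" using rtrancl_imp_relpow by blast
    then have k: "(v, r) \<in> ?R ^^ rank v" unfolding rank_def by (rule LeastI)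
    then obtain m where m: "rank v = Suc m" using v by (cases "rank v") auto
    then obtain w where w: "(v, w) \<in> ?R" "(w, r) \<in> ?R ^^ m" using relpow_Suc_D2[OF k[unfolded m]] by blast
    have "rank w \<le> m" unfolding rank_def by (rule Least_le) (rule w(2))
    then show ?thesis using w m ends by fastforce
  qed
  then show thesis using that by metis
qed

lemma inj_on_rooted_edges:
  fixes rank :: "'v \<Rightarrow> nat"
  assumes p: "\<And>v. v \<in> A \<Longrightarrow> rank (p v) < rank v \<and> ends G (f v) = {v, p v}"
  shows "inj_on f A"
proof (rule inj_onI)
  fix v w assume *: "v \<in> A" "w \<in> A" "f v = f w"
  then have "{v, p v} = {w, p w}" using p by metis
  then show "v = w" using p[OF *(1)] p[OF *(2)] by (auto simp: doubleton_eq_iff)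
qed

text \<open>
  Following parents from all vertices but the root gives a connected set of edges inside the tree, which
  by acyclicity is the whole tree.
\<close>

lemma card_spanning_tree:
  fixes G :: "('v, 'e) multigraph"
  assumes T: "T \<in> spanning_trees G" and r: "r \<in> verts G" and "finite (verts G)"
    and ends: "\<And>e. e \<in> edges G \<Longrightarrow> \<exists>u\<in>verts G. \<exists>v\<in>verts G. ends G e = {u, v}"
  shows "card T = card (verts G) - 1"
proof -
  have T': "T \<subseteq> edges G" "connected_by G T" "acyclic_edges G T"
    using T unfolding spanning_trees_def by auto
  have ends': "ends G e \<subseteq> verts G" if "e \<in> T" for e
    using ends[of e] T'(1) that by (metis empty_subsetI insert_subset subsetD)
  obtain f p and rank :: "'v \<Rightarrow> nat" where p: "\<And>v. v \<in> verts G \<Longrightarrow> v \<noteq> r \<Longrightarrow>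
       f v \<in> T \<and> p v \<in> verts G \<and> rank (p v) < rank v \<and> ends G (f v) = {v, p v}"
    using connected_by_parents[OF T'(2) r ends'] by blast
  have "connected_by G (f ` (verts G - {r}))"
    using p by (intro connected_by_rooted_edges[where p = p and rank = rank]) auto
  moreover have "f ` (verts G - {r}) \<subseteq> T" using p by blast
  ultimately have "f ` (verts G - {r}) = T"
    using ends T'(1) by (intro acyclic_connected_subset_eq[OF T'(3)]) auto
  moreover have "inj_on f (verts G - {r})"
    using p by (intro inj_on_rooted_edges[where p = p and rank = rank and G = G]) auto
  ultimately have "card T = card (verts G - {r})" using card_image by metis
  then show ?thesis using r by simp
qed

section \<open>Paths on the Manhattan lattice\<close>

text \<open>
  The pair \<open>(a, b)\<close> stands for the point \<open>((2 a + 1) / (4 n), (2 b + 1) / (4 n))\<close>. The steps of the Peano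
  paths respect the orientation of the Manhattan lattice: even rows lead to the right, odd rows to the
  left, even columns down and odd columns up. The two steps that this allows
  cross two potential edges, one of the tree and one of the dual tree, which also cross each other. Both belong
  to the index \<open>(i, j)\<close>, and the arrow \<open>r i j\<close> tells which one of them is present and blocks the way.
\<close>

definition move :: "(int \<Rightarrow> int \<Rightarrow> bool) \<Rightarrow> int \<times> int \<Rightarrow> int \<times> int" where
  "move r = (\<lambda>(a, b).
     let i = (if even b then a + 1 else a) div 2; j = (if even a then b + 1 else b + 2) div 2 in
     if r i j then (if even b then (a + 1, b) else (a - 1, b))
     else (if even a then (a, b - 1) else (a, b + 1)))"

text \<open>
  Branches start at a vertex with index \<open>(i, j)\<close> and follow the arrows, to the right or down if \<open>\<sigma> = 1\<close>
  and, for the dual tree, to the left or up if \<open>\<sigma> = - 1\<close>. The height is the value of \<open>2 (i + j)\<close>, interpolated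
  linearly, after \<open>h\<close> half steps. In the units of \<open>move\<close> half a step changes \<open>x - y\<close> by \<open>\<sigma>\<close>, so
  that \<open>h\<close> records on which antidiagonal slice \<open>x - y = const\<close> the branch has arrived.
\<close>

fun branch_height :: "(int \<Rightarrow> int \<Rightarrow> bool) \<Rightarrow> int \<Rightarrow> int \<Rightarrow> int \<Rightarrow> nat \<Rightarrow> int" where
  "branch_height r \<sigma> i j 0 = 2 * (i + j)"
| "branch_height r \<sigma> i j (Suc 0) = 2 * (i + j) + (if r i j then \<sigma> else - \<sigma>)"
| "branch_height r \<sigma> i j (Suc (Suc h)) =
     (if r i j then branch_height r \<sigma> (i + \<sigma>) j h else branch_height r \<sigma> i (j - \<sigma>) h)"

text \<open>
  The vertex \<open>(a, b)\<close> lies between the tree vertex with index \<open>(i, j)\<close> and the dual vertex with index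
  \<open>(k, l)\<close>. The branches from these two vertices, together with \<open>(a, b)\<close> itself on its own slice \<open>x - y = a - b\<close>,
  form a staircase, and \<open>(a', b')\<close> comes before \<open>(a, b)\<close> if it lies on the lower left side of it.
  The level of \<open>(a', b')\<close> in the units of the heights is \<open>a' + b' + 1\<close>.
\<close>

definition before :: "(int \<Rightarrow> int \<Rightarrow> bool) \<Rightarrow> int \<times> int \<Rightarrow> int \<times> int \<Rightarrow> bool" where
  "before r = (\<lambda>(a', b') (a, b).
     (let i = (a + 1) div 2; j = (b + 1) div 2; k = a div 2; l = b div 2 + 1 in
      if a' - b' = a - b then a' < a
      else if a' - b' > a - b then a' + b' + 1 < branch_height r 1 i j (nat (a' - b' - 2 * (i - j)))
      else a' + b' + 1 < branch_height r (- 1) k l (nat (2 * (k - l) + 2 - (a' - b')))))"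

lemma branch_height_0: "x = 0 \<Longrightarrow> branch_height r \<sigma> i j (nat x) = 2 * (i + j)" by simp
lemma branch_height_1: "x = 1 \<Longrightarrow> branch_height r \<sigma> i j (nat x) = 2 * (i + j) + (if r i j then \<sigma> else - \<sigma>)" by simp
lemma branch_height_step: "x \<ge> 2 \<Longrightarrow> branch_height r \<sigma> i j (nat x) =
     (if r i j then branch_height r \<sigma> (i + \<sigma>) j (nat (x - 2)) else branch_height r \<sigma> i (j - \<sigma>) (nat (x - 2)))"
proof -
  assume "x \<ge> 2"
  then have "nat x = Suc (Suc (nat (x - 2)))" by auto
  then show ?thesis by simp
qed

lemma branch_height_2: "branch_height r \<sigma> i j 2 = (if r i j then 2 * (i + \<sigma> + j) else 2 * (i + j - \<sigma>))"
  by (simp add: numeral_2_eq_2)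
lemma branch_height_3: "branch_height r \<sigma> i j 3 = (if r i j then branch_height r \<sigma> (i + \<sigma>) j 1 else branch_height r \<sigma> i (j - \<sigma>) 1)"
  by (simp add: numeral_3_eq_3)

lemma not_before_self: "\<not> before r p p"
  by (simp add: before_def split: prod.splits)

text \<open>
  The vertex \<open>(a, b)\<close> is the upper right, lower right, upper left or lower left neighbour of its tree
  vertex according to the parities of its coordinates. In each of these four positions, and with the slice of
  \<open>(a', b')\<close> counted from that of \<open>(a, b)\<close>, the definition becomes explicit.
\<close>

lemma before_NE: "a' = b' + 2 * i - 2 * j + d \<Longrightarrow> before r (a', b') (2 * i, 2 * j) \<longleftrightarrow>
    (if d = 0 then a' < 2 * i else if 0 < d then a' + b' + 1 < branch_height r 1 i j (nat d)
     else a' + b' + 1 < branch_height r (- 1) i (j + 1) (nat (- d)))"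
  by (simp add: before_def Let_def algebra_simps)

lemma before_SE: "a' = b' + 2 * i - (2 * j + 1) + d \<Longrightarrow> before r (a', b') (2 * i, 2 * j + 1) \<longleftrightarrow>
    (if d = 0 then a' < 2 * i else if 0 < d then a' + b' + 1 < branch_height r 1 i (j + 1) (nat (d + 1))
     else a' + b' + 1 < branch_height r (- 1) i (j + 1) (nat (1 - d)))"
  by (simp add: before_def Let_def add.commute)

lemma before_NW: "a' = b' + 2 * i + 1 - 2 * j + d \<Longrightarrow> before r (a', b') (2 * i + 1, 2 * j) \<longleftrightarrow>
    (if d = 0 then a' < 2 * i + 1 else if 0 < d then a' + b' + 1 < branch_height r 1 (i + 1) j (nat (d - 1))
     else a' + b' + 1 < branch_height r (- 1) i (j + 1) (nat (- 1 - d)))"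
  by (simp add: before_def Let_def algebra_simps)

lemma before_SW: "a' = b' + 2 * i + 1 - (2 * j + 1) + d \<Longrightarrow> before r (a', b') (2 * i + 1, 2 * j + 1) \<longleftrightarrow>
    (if d = 0 then a' < 2 * i + 1 else if 0 < d then a' + b' + 1 < branch_height r 1 (i + 1) (j + 1) (nat d)
     else a' + b' + 1 < branch_height r (- 1) i (j + 1) (nat (- d)))"
  by (simp add: before_def Let_def algebra_simps)

lemma move_cases:
  "move r (2 * i, 2 * j) = (if r i j then (2 * i + 1, 2 * j) else (2 * i, 2 * (j - 1) + 1))"
  "move r (2 * i, 2 * j + 1) = (if r i (j + 1) then (2 * (i - 1) + 1, 2 * j + 1) else (2 * i, 2 * j))"
  "move r (2 * i + 1, 2 * j) = (if r (i + 1) (j + 1) then (2 * (i + 1), 2 * j) else (2 * i + 1, 2 * j + 1))"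
  "move r (2 * i + 1, 2 * j + 1) = (if r i (j + 1) then (2 * i, 2 * j + 1) else (2 * i + 1, 2 * (j + 1)))"
  by (auto simp: move_def Let_def algebra_simps)

lemma parity_cases:
  fixes a b :: int
  obtains (NE) i j where "a = 2 * i" "b = 2 * j" | (SE) i j where "a = 2 * i" "b = 2 * j + 1"
    | (NW) i j where "a = 2 * i + 1" "b = 2 * j" | (SW) i j where "a = 2 * i + 1" "b = 2 * j + 1"
  by (metis evenE oddE)

text \<open>
  The branches of the old and the new vertex are the same up to one step of one of them, so the two
  staircases agree on all slices but those of the two vertices. There, as levels on a slice are multiples
  of 2 apart, \<open>p\<close> is the only point that fits between them.
\<close>

lemma before_move: "before r q (move r p) \<longleftrightarrow> q = p \<or> before r q p"
proof -
  obtain a b a' b' where pq: "p = (a, b)" "q = (a', b')" by fastforce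
  define d where "d = a' - b' - (a - b)"
  have a': "a' = b' + a - b + d" unfolding d_def by simp
  consider "d \<ge> 2" | "d = 1" | "d = 0" | "d = -1" | "d \<le> -2"
    by linarith
  note d_cases = this
  have "- 1 - d = - d - 1" "- 2 - d = - d - 2" by simp_all
  note heights = branch_height_step branch_height_0 branch_height_1 branch_height_2 branch_height_3 this
  show ?thesis
  proof (cases a b rule: parity_cases)
    case (NE i j)
    have "before r q (2 * i + 1, 2 * j) \<longleftrightarrow> q = p \<or> before r q p" if "r i j"
      using d_cases by cases (use before_NE[of a' b' i j d] before_NW[of a' b' i j "d - 1"] a' that NE pq
        in \<open>auto simp: heights\<close>)
    moreover have "before r q (2 * i, 2 * (j - 1) + 1) \<longleftrightarrow> q = p \<or> before r q p" if "\<not> r i j"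
      using d_cases by cases (use before_NE[of a' b' i j d] before_SE[of a' b' i "j - 1" "d - 1"] a' that NE pq
        in \<open>auto simp: heights\<close>)
    ultimately show ?thesis by (simp add: move_cases pq NE)
  next
    case (SE i j)
    have "before r q (2 * (i - 1) + 1, 2 * j + 1) \<longleftrightarrow> q = p \<or> before r q p" if "r i (j + 1)"
      using d_cases by cases (use before_SE[of a' b' i j d] before_SW[of a' b' "i - 1" j "d + 1"] a' that SE pq
        in \<open>auto simp: heights\<close>)
    moreover have "before r q (2 * i, 2 * j) \<longleftrightarrow> q = p \<or> before r q p" if "\<not> r i (j + 1)"
      using d_cases by cases (use before_SE[of a' b' i j d] before_NE[of a' b' i j "d - 1"] a' that SE pq
        in \<open>auto simp: heights\<close>)
    ultimately show ?thesis by (simp add: move_cases pq SE)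
  next
    case (NW i j)
    have "before r q (2 * (i + 1), 2 * j) \<longleftrightarrow> q = p \<or> before r q p" if "r (i + 1) (j + 1)"
      using d_cases by cases (use before_NW[of a' b' i j d] before_NE[of a' b' "i + 1" j "d - 1"] a' that NW pq
        in \<open>auto simp: heights\<close>)
    moreover have "before r q (2 * i + 1, 2 * j + 1) \<longleftrightarrow> q = p \<or> before r q p" if "\<not> r (i + 1) (j + 1)"
      using d_cases by cases (use before_NW[of a' b' i j d] before_SW[of a' b' i j "d + 1"] a' that NW pq
        in \<open>auto simp: heights\<close>)
    ultimately show ?thesis by (simp add: move_cases pq NW)
  next
    case (SW i j)
    have "before r q (2 * i, 2 * j + 1) \<longleftrightarrow> q = p \<or> before r q p" if "r i (j + 1)"
      using d_cases by cases (use before_SW[of a' b' i j d] before_SE[of a' b' i j "d + 1"] a' that SW pq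
        in \<open>auto simp: heights\<close>)
    moreover have "before r q (2 * i + 1, 2 * (j + 1)) \<longleftrightarrow> q = p \<or> before r q p" if "\<not> r i (j + 1)"
      using d_cases by cases (use before_SW[of a' b' i j d] before_NW[of a' b' i "j + 1" "d + 1"] a' that SW pq
        in \<open>auto simp: heights\<close>)
    ultimately show ?thesis by (simp add: move_cases pq SW)
  qed
qed

section \<open>The path through the square\<close>

definition interior_idx :: "nat \<Rightarrow> (int \<times> int) set" where
  "interior_idx n = {1..int n - 1} \<times> {1..int n - 1}"

text \<open>
  The indices of the vertices of the Peano path.
\<close>

definition square :: "nat \<Rightarrow> (int \<times> int) set" where
  "square n = {1..2 * int n - 1} \<times> {0..2 * int n - 2}"

text \<open>
  The arrows outside of the interior make the tree contain the bottom and the right side and make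
  the dual tree contain the left column and the top row. The definition is symmetric under the
  reflection of the indices at the centre of the square.
\<close>

definition directions :: "nat \<Rightarrow> (int \<times> int) set \<Rightarrow> int \<Rightarrow> int \<Rightarrow> bool" where
  "directions n C i j \<longleftrightarrow> 0 < i \<and> i < int n \<and> (j \<le> 0 \<or> int n \<le> j \<or> (i, j) \<in> C)"

definition rotated :: "nat \<Rightarrow> int \<times> int \<Rightarrow> int \<times> int" where
  "rotated n = (\<lambda>(i, j). (int n - i, int n - j))"

lemma directions_rotated:
  "directions n (rotated n -` C) i j = directions n C (int n - i) (int n - j)"
  by (auto simp: directions_def rotated_def)

definition arrow :: "(int \<Rightarrow> int \<Rightarrow> bool) \<Rightarrow> int \<Rightarrow> int \<times> int \<Rightarrow> int \<times> int" where
  "arrow r \<sigma> = (\<lambda>(i, j). if r i j then (i + \<sigma>, j) else (i, j - \<sigma>))"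

text \<open>
  The walk stops when it leaves \<open>A\<close>. Unlike the branch itself, which runs along the sides after it has met
  them, the stopped branch stays close to an antidiagonal.
\<close>

fun walk :: "('p \<Rightarrow> 'p) \<Rightarrow> 'p set \<Rightarrow> nat \<Rightarrow> 'p \<Rightarrow> 'p" where
  "walk f A 0 v = v"
| "walk f A (Suc k) v = (if v \<in> A then walk f A k (f v) else v)"

abbreviation level :: "int \<times> int \<Rightarrow> int" where
  "level v \<equiv> fst v + snd v"

lemma two_step_induct [case_names zero one step]:
  assumes "P 0" "P (Suc 0)" "\<And>h. P h \<Longrightarrow> P (Suc (Suc h))"
  shows "P (h::nat)"
proof -
  have "P h \<and> P (Suc h)" by (induction h) (use assms in auto)
  then show ?thesis ..
qed

lemma branch_height_bottom:
  "0 < i \<Longrightarrow> 2 * i + int h \<le> 2 * int n - 1 \<Longrightarrow> branch_height (directions n C) 1 i 0 h = 2 * i + int h"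
  by (induction h arbitrary: i rule: two_step_induct) (auto simp: directions_def)

lemma branch_height_right: "branch_height (directions n C) 1 (int n) j h = 2 * (int n + j) - int h"
  by (induction h arbitrary: j rule: two_step_induct) (auto simp: directions_def)

lemma branch_height_left: "branch_height (directions n C) (- 1) 0 j h = 2 * j + int h"
  by (induction h arbitrary: j rule: two_step_induct) (auto simp: directions_def)

lemma branch_height_rotated:
  "branch_height (directions n C) (- 1) i j h =
     4 * int n - branch_height (directions n (rotated n -` C)) 1 (int n - i) (int n - j) h"
proof (induction h arbitrary: i j rule: two_step_induct)
  case (step h)
  show ?case using step[of "i - 1" j] step[of i "j + 1"]
    by (auto simp: directions_rotated algebra_simps)
qed (auto simp: directions_rotated)

lemma walk_rotated:
  "walk (arrow (directions n C) (- 1)) (interior_idx n) k (rotated n v) =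
     rotated n (walk (arrow (directions n (rotated n -` C)) 1) (interior_idx n) k v)"
proof (induction k arbitrary: v)
  case (Suc k)
  have "rotated n v \<in> interior_idx n \<longleftrightarrow> v \<in> interior_idx n"
    by (cases v) (auto simp: rotated_def interior_idx_def)
  moreover have "arrow (directions n C) (- 1) (rotated n v) =
      rotated n (arrow (directions n (rotated n -` C)) 1 v)"
    by (cases v) (auto simp: arrow_def rotated_def directions_rotated directions_rotated[unfolded rotated_def])
  ultimately show ?case using Suc by simp
qed simp

text \<open>
  Once a branch has met the bottom, no point of the square is below it, and once it has met the right side,
  every point of the square on a later slice has a smaller level than the point where it did.
  So a point below the branch is below some position of the stopped branch, up to one half step.
\<close>

lemma walk_below:
  assumes "1 \<le> i" "i \<le> int n" "0 \<le> j" "j \<le> int n - 1" and "(a, b) \<in> square n"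
    and "a - b = 2 * (i - j) + int h"
    and "a + b + 1 < branch_height (directions n C) 1 i j h"
  shows "\<exists>k\<le>h. a + b \<le> 2 * level (walk (arrow (directions n C) 1) (interior_idx n) k (i, j)) + 2"
  using assms(1-4,6,7)
proof (induction h arbitrary: i j rule: two_step_induct)
  case zero
  then show ?case by auto
next
  case one
  then show ?case by (intro exI[of _ 0]) (auto split: if_splits)
next
  case (step h)
  let ?r = "directions n C"
  have sq: "1 \<le> a" "a \<le> 2 * int n - 1" "0 \<le> b" "b \<le> 2 * int n - 2" using assms(5) by (auto simp: square_def)
  show ?case
  proof (cases "(i, j) \<in> interior_idx n")
    case True
    have "\<exists>k\<le>h. a + b \<le> 2 * level (walk (arrow ?r 1) (interior_idx n) k (arrow ?r 1 (i, j))) + 2"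
    proof (cases "?r i j")
      case r: True
      show ?thesis using step.IH[of "i + 1" j] step.prems r True by (auto simp: arrow_def interior_idx_def)
    next
      case r: False
      show ?thesis using step.IH[of i "j - 1"] step.prems r True by (auto simp: arrow_def interior_idx_def)
    qed
    then obtain k where "k \<le> h" "a + b \<le> 2 * level (walk (arrow ?r 1) (interior_idx n) k (arrow ?r 1 (i, j))) + 2"
      by blast
    then show ?thesis using True by (intro exI[of _ "Suc k"]) auto
  next
    case False
    then have "j = 0 \<or> i = int n" using step.prems by (auto simp: interior_idx_def)
    then show ?thesis
    proof
      assume "j = 0"
      then show ?thesis using step.prems sq branch_height_bottom[of i "Suc (Suc h)" n C] by auto
    next
      assume "i = int n"
      then show ?thesis using step.prems sq by (intro exI[of _ 0]) auto
    qed
  qed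
qed

text \<open>
  The roles of the two sides are exchanged: above a branch that has met the right side there is no point
  of the square, and above one that has met the bottom, later points have larger levels.
\<close>

lemma walk_above:
  assumes "1 \<le> i" "i \<le> int n" "0 \<le> j" "j \<le> int n - 1" and "(a, b) \<in> square n"
    and "a - b = 2 * (i - j) + int h"
    and "branch_height (directions n C) 1 i j h < a + b + 1"
  shows "\<exists>k\<le>h. 2 * level (walk (arrow (directions n C) 1) (interior_idx n) k (i, j)) - 2 \<le> a + b"
  using assms(1-4,6,7)
proof (induction h arbitrary: i j rule: two_step_induct)
  case zero
  then show ?case by auto
next
  case one
  then show ?case by (intro exI[of _ 0]) (auto split: if_splits)
next
  case (step h)
  let ?r = "directions n C"
  have sq: "1 \<le> a" "a \<le> 2 * int n - 1" "0 \<le> b" "b \<le> 2 * int n - 2" using assms(5) by (auto simp: square_def)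
  show ?case
  proof (cases "(i, j) \<in> interior_idx n")
    case True
    have "\<exists>k\<le>h. 2 * level (walk (arrow ?r 1) (interior_idx n) k (arrow ?r 1 (i, j))) - 2 \<le> a + b"
    proof (cases "?r i j")
      case r: True
      show ?thesis using step.IH[of "i + 1" j] step.prems r True by (auto simp: arrow_def interior_idx_def)
    next
      case r: False
      show ?thesis using step.IH[of i "j - 1"] step.prems r True by (auto simp: arrow_def interior_idx_def)
    qed
    then obtain k where "k \<le> h" "2 * level (walk (arrow ?r 1) (interior_idx n) k (arrow ?r 1 (i, j))) - 2 \<le> a + b"
      by blast
    then show ?thesis using True by (intro exI[of _ "Suc k"]) auto
  next
    case False
    then have "j = 0 \<or> i = int n" using step.prems by (auto simp: interior_idx_def)
    then show ?thesis
    proof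
      assume "j = 0"
      then show ?thesis using step.prems sq by (intro exI[of _ 0]) auto
    next
      assume "i = int n"
      then show ?thesis using step.prems sq branch_height_right[of n C j "Suc (Suc h)"] by auto
    qed
  qed
qed

text \<open>
  The bound \<open>4 n\<close> on the number of steps exceeds the number of slices of the square, so that it does not cut
  off any branch; it makes the union bound finite.
\<close>

definition tame :: "nat \<Rightarrow> int \<Rightarrow> (int \<times> int) set \<Rightarrow> bool" where
  "tame n m C \<longleftrightarrow> (\<forall>\<sigma>\<in>{1, - 1}. \<forall>v\<in>interior_idx n. \<forall>k\<le>4 * n.
     \<bar>level (walk (arrow (directions n C) \<sigma>) (interior_idx n) k v) - level v\<bar> \<le> m)"

lemma tame_walk:
  assumes "tame n m C" "0 \<le> m" "\<sigma> \<in> {1, - 1}" "k \<le> 4 * n"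
  shows "\<bar>level (walk (arrow (directions n C) \<sigma>) (interior_idx n) k v) - level v\<bar> \<le> m"
proof (cases "v \<in> interior_idx n")
  case False
  then have "walk (arrow (directions n C) \<sigma>) (interior_idx n) k v = v" by (cases k) auto
  then show ?thesis using assms by simp
qed (use assms in \<open>auto simp: tame_def\<close>)

text \<open>
  A vertex before \<open>p\<close> is below \<open>p\<close> on the same slice or below one of the branches from the neighbours of
  \<open>p\<close>, and these branches stay close to the antidiagonal through \<open>p\<close>.
\<close>

lemma before_level:
  assumes "tame n m C" "0 \<le> m" "p \<in> square n" "q \<in> square n" "before (directions n C) q p"
  shows "level q \<le> level p + 2 * m + 4"
proof -
  let ?r = "directions n C"
  obtain a b a' b' where pq: "p = (a, b)" "q = (a', b')" by fastforce
  define i j k l where "i = (a + 1) div 2" "j = (b + 1) div 2" "k = a div 2" "l = b div 2 + 1"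
  note d = this
  have sq: "1 \<le> a" "a \<le> 2 * int n - 1" "0 \<le> b" "b \<le> 2 * int n - 2"
    "1 \<le> a'" "a' \<le> 2 * int n - 1" "0 \<le> b'" "b' \<le> 2 * int n - 2" using assms pq by (auto simp: square_def)
  have rng: "1 \<le> i" "i \<le> int n" "0 \<le> j" "j \<le> int n - 1"
    "0 \<le> k" "k \<le> int n - 1" "1 \<le> l" "l \<le> int n"
    using sq(1-4) unfolding d by presburger+
  have q: "(a', b') \<in> square n" using assms pq by simp
  have bd: "2 * i \<le> a + 1" "b \<le> 2 * j" "2 * k \<ge> a - 1" "2 * l \<le> b + 2"
    unfolding d by presburger+
  consider "a' - b' = a - b" "a' < a"
    | "a' - b' > a - b" "a' + b' + 1 < branch_height ?r 1 i j (nat (a' - b' - 2 * (i - j)))"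
    | "a' - b' < a - b" "a' + b' + 1 < branch_height ?r (- 1) k l (nat (2 * (k - l) + 2 - (a' - b')))"
    using assms(5) unfolding before_def pq d by (auto simp: Let_def split: if_splits)
  then show ?thesis
  proof cases
    case 1
    then show ?thesis using pq assms by auto
  next
    case 2
    define h where "h = nat (a' - b' - 2 * (i - j))"
    have h: "int h = a' - b' - 2 * (i - j)" proof -
      have "2 * i - 2 * j \<le> a + 1 - b" using bd(1,2) by (rule diff_mono)
      also have "\<dots> \<le> a' - b'" using 2(1) by linarith
      finally have "0 \<le> a' - b' - 2 * (i - j)" by (simp only: right_diff_distrib diff_ge_0_iff_ge)
      then show ?thesis unfolding h_def by (rule nat_0_le)
    qed
    have "\<exists>k\<le>h. a' + b' \<le> 2 * level (walk (arrow ?r 1) (interior_idx n) k (i, j)) + 2"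
      using rng(1-4) q h 2(2)[folded h_def] by (intro walk_below) auto
    then obtain k' where k': "k' \<le> h" "a' + b' \<le> 2 * level (walk (arrow ?r 1) (interior_idx n) k' (i, j)) + 2" by blast
    have "int h \<le> 4 * int n" using h[unfolded right_diff_distrib] rng(1,4,6,7) sq(5-8) by linarith
    then have "h \<le> 4 * n" by linarith
    then have "\<bar>level (walk (arrow ?r 1) (interior_idx n) k' (i, j)) - level (i, j)\<bar> \<le> m"
      using k' by (intro tame_walk assms) auto
    moreover have "2 * (i + j) \<le> a + b + 2" unfolding d by presburger
    ultimately show ?thesis using k' pq by (auto simp: abs_le_iff)
  next
    case 3
    \<comment> \<open>Reflecting the square turns the dual branch into a primal one; the shift between the two
      lattices of indices makes the reflection of \<open>q\<close> the point \<open>(2 n - a', 2 n - 2 - b')\<close>.\<close>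
    define h where "h = nat (2 * (k - l) + 2 - (a' - b'))"
    have h: "int h = 2 * (k - l) + 2 - (a' - b')" proof -
      have "a' - b' \<le> a - 1 - (b + 2) + 2" using 3(1) by linarith
      also have "\<dots> \<le> 2 * k - 2 * l + 2" using diff_mono[OF bd(3,4)] by linarith
      finally have "0 \<le> 2 * (k - l) + 2 - (a' - b')" by (simp only: right_diff_distrib diff_ge_0_iff_ge)
      then show ?thesis unfolding h_def by (rule nat_0_le)
    qed
    let ?r' = "directions n (rotated n -` C)"
    have "\<exists>k'\<le>h. 2 * level (walk (arrow ?r' 1) (interior_idx n) k' (int n - k, int n - l)) - 2
        \<le> (2 * int n - a') + (2 * int n - 2 - b')"
    proof (rule walk_above)
      show "(2 * int n - a', 2 * int n - 2 - b') \<in> square n" using sq by (auto simp: square_def)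
      show "branch_height ?r' 1 (int n - k) (int n - l) h < 2 * int n - a' + (2 * int n - 2 - b') + 1"
        using 3(2)[folded h_def] branch_height_rotated[of n C k l h] by linarith
    qed (use rng h in \<open>auto simp: algebra_simps\<close>)
    then obtain k' where k': "k' \<le> h" "2 * level (walk (arrow ?r' 1) (interior_idx n) k' (rotated n (k, l))) - 2
        \<le> (2 * int n - a') + (2 * int n - 2 - b')" by (auto simp: rotated_def)
    have "walk (arrow ?r (- 1)) (interior_idx n) k' (k, l) =
        rotated n (walk (arrow ?r' 1) (interior_idx n) k' (rotated n (k, l)))"
      using walk_rotated[of n C k' "rotated n (k, l)"] by (simp add: rotated_def)
    then have eq: "level (walk (arrow ?r (- 1)) (interior_idx n) k' (k, l)) =
       2 * int n - level (walk (arrow ?r' 1) (interior_idx n) k' (rotated n (k, l)))"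
      by (simp add: rotated_def split: prod.splits)
    have "int h \<le> 4 * int n" using h[unfolded right_diff_distrib] rng(1,4,6,7) sq(5-8) by linarith
    then have "h \<le> 4 * n" by linarith
    then have "\<bar>level (walk (arrow ?r (- 1)) (interior_idx n) k' (k, l)) - level (k, l)\<bar> \<le> m"
      using k' by (intro tame_walk assms) auto
    moreover have "2 * (k + l) \<le> a + b + 2" unfolding d by presburger
    ultimately show ?thesis using k' eq pq by (auto simp: abs_le_iff)
  qed
qed

text \<open>
  The staircase of the first vertex consists of the bottom side and the left column.
\<close>

lemma not_before_start:
  assumes "q \<in> square n"
  shows "\<not> before (directions n C) q (1, 0)"
proof -
  obtain a b where q: "q = (a, b)" "1 \<le> a" "a \<le> 2 * int n - 1" "0 \<le> b" "b \<le> 2 * int n - 2"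
    using assms by (auto simp: square_def)
  then show ?thesis
    by (auto simp: before_def Let_def branch_height_bottom branch_height_left)
qed

text \<open>
  The staircase of the last vertex consists of the right side and the top row.
\<close>

lemma before_end:
  assumes "q \<in> square n" "q \<noteq> (2 * int n - 1, 2 * int n - 2)"
  shows "before (directions n C) q (2 * int n - 1, 2 * int n - 2)"
proof -
  obtain a b where q: "q = (a, b)" "1 \<le> a" "a \<le> 2 * int n - 1" "0 \<le> b" "b \<le> 2 * int n - 2"
    using assms by (auto simp: square_def)
  have div: "(2 * int n - 1) div 2 = int n - 1" "(2 * int n - 2 + 1) div 2 = int n - 1"
    "(2 * int n - 2) div 2 = int n - 1"
    by auto
  show ?thesis using q assms(2)
    by (auto simp: before_def Let_def div branch_height_right branch_height_rotated branch_height_bottom)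
qed

lemma move_in_square:
  assumes "p \<in> square n" "p \<noteq> (2 * int n - 1, 2 * int n - 2)"
  shows "move (directions n C) p \<in> square n"
proof -
  obtain a b where p: "p = (a, b)" "1 \<le> a" "a \<le> 2 * int n - 1" "0 \<le> b" "b \<le> 2 * int n - 2"
    using assms by (auto simp: square_def)
  show ?thesis
    using p assms(2)
    by (cases a b rule: parity_cases) (auto simp: move_cases square_def directions_def p(1), presburger+)
qed

definition orbit :: "nat \<Rightarrow> (int \<times> int) set \<Rightarrow> nat \<Rightarrow> int \<times> int" where
  "orbit n C k = (move (directions n C) ^^ k) (1, 0)"

lemma orbit_props:
  assumes "n \<ge> 1"
  defines "M \<equiv> card (square n)"
  shows "orbit n C ` {..<M} = square n" "inj_on (orbit n C) {..<M}"
    "orbit n C (M - 1) = (2 * int n - 1, 2 * int n - 2)" "0 < M"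
    "\<And>j k. k < M \<Longrightarrow> j < k \<Longrightarrow> before (directions n C) (orbit n C j) (orbit n C k)"
proof -
  let ?r = "directions n C" and ?x = "orbit n C" and ?e = "(2 * int n - 1, 2 * int n - 2)"
  have fin: "finite (square n)" unfolding square_def by simp
  have e: "?e \<in> square n" using assms by (auto simp: square_def)
  have "0 < M" unfolding M_def using e fin card_gt_0_iff by blast
  then show "0 < M" .
  let ?L = "\<lambda>k. {q \<in> square n. before ?r q (?x k)}"
  have x_Suc: "?x (Suc k) = move ?r (?x k)" for k by (simp add: orbit_def)
  \<comment> \<open>The vertices of the square before the current one are the ones visited so far; as their number
    grows with each step, the end cannot be reached before all vertices have been visited.\<close>
  have main: "?x k \<in> square n \<and> ?L k = ?x ` {..<k} \<and> card (?L k) = k" if "k < M" for k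
    using that
  proof (induction k)
    case 0
    have "(1, 0) \<in> square n" using assms by (auto simp: square_def)
    moreover have "?L 0 = {}" using not_before_start[of _ n C] by (auto simp: orbit_def)
    ultimately show ?case by (simp only: card.empty) (simp add: orbit_def)
  next
    case (Suc k)
    then have IH: "?x k \<in> square n" "?L k = ?x ` {..<k}" "card (?L k) = k" by auto
    have "?x k \<noteq> ?e"
    proof
      assume "?x k = ?e"
      then have "?L k = square n - {?e}"
        using before_end[of _ n C] not_before_self[of ?r ?e] by auto
      then have "card (?L k) = M - 1" unfolding M_def using fin e by simp
      then show False using IH Suc.prems by simp
    qed
    then have "?x (Suc k) \<in> square n" using move_in_square IH x_Suc by simp
    moreover have L: "?L (Suc k) = insert (?x k) (?L k)"
      using IH(1) by (auto simp: x_Suc before_move)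
    moreover have "?x k \<notin> ?L k" by (simp add: not_before_self)
    ultimately show ?case using IH fin by (auto simp: lessThan_Suc)
  qed
  show bef: "before ?r (?x j) (?x k)" if "k < M" "j < k" for j k
  proof -
    have "?x j \<in> ?L k" using main[OF that(1)] that(2) by blast
    then show ?thesis by simp
  qed
  show inj: "inj_on ?x {..<M}"
  proof (rule inj_onI)
    fix j k assume "j \<in> {..<M}" "k \<in> {..<M}" "?x j = ?x k"
    then show "j = k" using bef[of k j] bef[of j k] not_before_self[of ?r "?x k"]
      by (metis lessThan_iff linorder_neqE_nat)
  qed
  show img: "?x ` {..<M} = square n"
  proof (rule card_subset_eq[OF fin])
    show "?x ` {..<M} \<subseteq> square n" using main by blast
    show "card (?x ` {..<M}) = card (square n)" using inj by (simp add: card_image M_def)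
  qed
  obtain j where j: "j < M" "?x j = ?e" using e img by (metis imageE lessThan_iff)
  have "?L j = square n - {?e}"
    using before_end[of _ n C] not_before_self[of ?r ?e] j by auto
  then have "card (?L j) = M - 1" unfolding M_def using fin e by simp
  then have "j = M - 1" using main[OF j(1)] by metis
  then show "?x (M - 1) = ?e" using j by simp
qed

section \<open>Lattice points and segments\<close>

text \<open>
  In units of \<open>1 / (4 n)\<close> all vertices have integer coordinates: tree vertices are congruent to
  \<open>(0, 0)\<close> and dual vertices to \<open>(2, 2)\<close> modulo 4, and the vertices of the Peano path have odd coordinates. Questions
  about intersections of edges become questions about divisibility.
\<close>

definition pt :: "nat \<Rightarrow> int \<Rightarrow> int \<Rightarrow> complex" where
  "pt n x y = Complex (of_int x / (4 * real n)) (of_int y / (4 * real n))"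

lemma Re_pt [simp]: "Re (pt n x y) = of_int x / (4 * real n)"
  and Im_pt [simp]: "Im (pt n x y) = of_int y / (4 * real n)"
  by (simp_all add: pt_def)

lemma pt_eq_iff: "0 < n \<Longrightarrow> pt n x y = pt n x' y' \<longleftrightarrow> x = x' \<and> y = y'"
  by (simp add: complex_eq_iff)

lemma hull_horizontal:
  "0 < n \<Longrightarrow> convex hull {pt n x1 y, pt n x2 y} =
     {z. Im z * (4 * n) = y \<and> min x1 x2 \<le> Re z * (4 * n) \<and> Re z * (4 * n) \<le> max x1 x2}"
  unfolding segment_convex_hull[symmetric]
  by (subst closed_segment_same_Im)
     (auto simp: closed_segment_eq_real_ivl field_simps min_def max_def)

lemma hull_vertical:
  "0 < n \<Longrightarrow> convex hull {pt n x y1, pt n x y2} =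
     {z. Re z * (4 * n) = x \<and> min y1 y2 \<le> Im z * (4 * n) \<and> Im z * (4 * n) \<le> max y1 y2}"
  unfolding segment_convex_hull[symmetric]
  by (subst closed_segment_same_Re)
     (auto simp: closed_segment_eq_real_ivl field_simps min_def max_def)

lemma disjoint_hh:
  "0 < n \<Longrightarrow> y \<noteq> y' \<Longrightarrow> convex hull {pt n x1 y, pt n x2 y} \<inter> convex hull {pt n x3 y', pt n x4 y'} = {}"
  by (auto simp: hull_horizontal)

lemma disjoint_vv:
  "0 < n \<Longrightarrow> x \<noteq> x' \<Longrightarrow> convex hull {pt n x y1, pt n x y2} \<inter> convex hull {pt n x' y3, pt n x' y4} = {}"
  by (auto simp: hull_vertical)

lemma disjoint_hv:
  assumes "0 < n"
  shows "convex hull {pt n x1 y, pt n x2 y} \<inter> convex hull {pt n x y1, pt n x y2} = {} \<longleftrightarrow>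
    \<not> (min x1 x2 \<le> x \<and> x \<le> max x1 x2 \<and> min y1 y2 \<le> y \<and> y \<le> max y1 y2)"
proof -
  have "pt n x y \<in> convex hull {pt n x1 y, pt n x2 y} \<inter> convex hull {pt n x y1, pt n x y2}"
    if "min x1 x2 \<le> x \<and> x \<le> max x1 x2 \<and> min y1 y2 \<le> y \<and> y \<le> max y1 y2"
    using that assms by (auto simp: hull_horizontal hull_vertical min_def max_def)
  moreover have "min x1 x2 \<le> x \<and> x \<le> max x1 x2 \<and> min y1 y2 \<le> y \<and> y \<le> max y1 y2"
    if "z \<in> convex hull {pt n x1 y, pt n x2 y} \<inter> convex hull {pt n x y1, pt n x y2}" for z
    using that assms by (auto simp: hull_horizontal hull_vertical)
  ultimately show ?thesis by blast
qed

lemma disjoint_vh: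
  assumes "0 < n"
  shows "convex hull {pt n x y1, pt n x y2} \<inter> convex hull {pt n x1 y, pt n x2 y} = {} \<longleftrightarrow>
    \<not> (min x1 x2 \<le> x \<and> x \<le> max x1 x2 \<and> min y1 y2 \<le> y \<and> y \<le> max y1 y2)"
  using disjoint_hv[OF assms] by (subst Int_commute)

lemma sum_squares_eq_one:
  fixes p q :: int
  shows "p\<^sup>2 + q\<^sup>2 = 1 \<longleftrightarrow> \<bar>p\<bar> + \<bar>q\<bar> = 1"
proof
  assume *: "p\<^sup>2 + q\<^sup>2 = 1"
  have "\<bar>p\<bar> \<le> p\<^sup>2" "\<bar>q\<bar> \<le> q\<^sup>2" using self_le_power[of "\<bar>p\<bar>" 2] self_le_power[of "\<bar>q\<bar>" 2] 
    by (cases "p = 0"; cases "q = 0"; simp)+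
  then have "\<bar>p\<bar> + \<bar>q\<bar> \<le> 1" using * by linarith
  moreover have "p \<noteq> 0 \<or> q \<noteq> 0" using * by auto
  ultimately show "\<bar>p\<bar> + \<bar>q\<bar> = 1" by linarith
next
  assume "\<bar>p\<bar> + \<bar>q\<bar> = 1"
  then have "(\<bar>p\<bar> = 1 \<and> q = 0) \<or> (p = 0 \<and> \<bar>q\<bar> = 1)" by linarith
  then show "p\<^sup>2 + q\<^sup>2 = 1" by (auto simp: power2_eq_1_iff abs_if split: if_splits)
qed

definition adjacent :: "int \<times> int \<Rightarrow> int \<times> int \<Rightarrow> bool" where
  "adjacent v w \<longleftrightarrow> \<bar>fst v - fst w\<bar> + \<bar>snd v - snd w\<bar> = 1"

definition sublattice :: "nat \<Rightarrow> int \<Rightarrow> int \<Rightarrow> int \<Rightarrow> int \<times> int \<Rightarrow> complex" where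
  "sublattice n c \<alpha> \<beta> v = pt n (c * fst v + \<alpha>) (c * snd v + \<beta>)"

lemma dist_sublattice:
  assumes "0 < n" "0 < c"
  shows "dist (sublattice n c \<alpha> \<beta> v) (sublattice n c \<alpha> \<beta> w) = of_int c / (4 * real n) \<longleftrightarrow> adjacent v w"
proof -
  let ?p = "fst v - fst w" and ?q = "snd v - snd w"
  let ?s = "of_int c / (4 * real n)"
  have s: "?s > 0" using assms by simp
  have "sublattice n c \<alpha> \<beta> v - sublattice n c \<alpha> \<beta> w = Complex (?s * of_int ?p) (?s * of_int ?q)"
    by (simp add: sublattice_def complex_eq_iff add_divide_distrib diff_divide_distrib right_diff_distrib)
  then have "dist (sublattice n c \<alpha> \<beta> v) (sublattice n c \<alpha> \<beta> w)
      = sqrt (?s\<^sup>2 * ((of_int ?p)\<^sup>2 + (of_int ?q)\<^sup>2))"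
    by (simp add: dist_norm complex_norm power_mult_distrib power_divide distrib_left add_divide_distrib)
  also have "\<dots> = ?s * sqrt (of_int (?p\<^sup>2 + ?q\<^sup>2))"
    using s assms by (simp add: real_sqrt_mult)
  also have "\<dots> = ?s \<longleftrightarrow> ?p\<^sup>2 + ?q\<^sup>2 = 1"
    using s by (metis mult_cancel_left2 of_int_eq_1_iff order_less_irrefl real_sqrt_eq_1_iff)
  finally show ?thesis by (simp add: sum_squares_eq_one adjacent_def)
qed

lemma inj_sublattice: "0 < n \<Longrightarrow> 0 < c \<Longrightarrow> inj_on (sublattice n c \<alpha> \<beta>) A"
  by (auto simp: inj_on_def sublattice_def pt_eq_iff prod_eq_iff)

lemma edges_nn_graph_sublattice:
  assumes "0 < n" "0 < c" "h = of_int c / (4 * real n)"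
  shows "edges (nn_graph h (sublattice n c \<alpha> \<beta> ` A)) =
    {{sublattice n c \<alpha> \<beta> v, sublattice n c \<alpha> \<beta> w} | v w. v \<in> A \<and> w \<in> A \<and> adjacent v w}"
  using dist_sublattice[OF assms(1,2)] by (auto simp: nn_graph_def assms(3)) blast+

lemma nn_graph_simps [simp]:
  "verts (nn_graph h V) = V" "ends (nn_graph h V) e = e"
  by (simp_all add: nn_graph_def)

abbreviation primal :: "nat \<Rightarrow> int \<times> int \<Rightarrow> complex" where
  "primal n \<equiv> sublattice n 4 0 0"
abbreviation dual :: "nat \<Rightarrow> int \<times> int \<Rightarrow> complex" where
  "dual n \<equiv> sublattice n 4 2 (- 2)"
abbreviation peano :: "nat \<Rightarrow> int \<times> int \<Rightarrow> complex" where
  "peano n \<equiv> sublattice n 2 1 1"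

definition primal_idx :: "nat \<Rightarrow> (int \<times> int) set" where
  "primal_idx n = {1..int n} \<times> {0..int n - 1}"
definition dual_idx :: "nat \<Rightarrow> (int \<times> int) set" where
  "dual_idx n = {0..int n - 1} \<times> {1..int n}"

lemma grid_eq_range:
  fixes f :: "int \<times> int \<Rightarrow> complex"
  assumes "\<And>k l. f (k, l + m) = Complex (a + of_int k * h) (a + of_int l * h)"
  shows "grid a h = range f"
proof -
  have "f (k, l) \<in> grid a h" for k l
    using assms[of k "l - m"] unfolding grid_def by (auto simp del: of_int_diff)
  moreover have "grid a h \<subseteq> range f"
    unfolding grid_def assms[symmetric] by auto
  ultimately show ?thesis by auto
qed

lemma verts_primal: 
  assumes "0 < n"
  shows "grid 0 (1 / real n) \<inter> unit_square = primal n ` primal_idx n"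
proof -
  have "grid 0 (1 / real n) = range (primal n)"
    using assms by (intro grid_eq_range[where m = 0]) (simp add: sublattice_def pt_def field_simps)
  moreover have "primal n (k, l) \<in> unit_square \<longleftrightarrow> (k, l) \<in> primal_idx n" for k l
    using assms by (auto simp: sublattice_def unit_square_def primal_idx_def field_simps)
  ultimately show ?thesis by auto
qed

lemma verts_dual: 
  assumes "0 < n"
  shows "grid (1 / (2 * real n)) (1 / real n) \<inter> unit_square = dual n ` dual_idx n"
proof -
  have "grid (1 / (2 * real n)) (1 / real n) = range (dual n)"
    using assms by (intro grid_eq_range[where m = 1]) (simp add: sublattice_def pt_def field_simps)
  moreover have "dual n (k, l) \<in> unit_square \<longleftrightarrow> (k, l) \<in> dual_idx n" for k l
  proof -
    have "dual n (k, l) \<in> unit_square \<longleftrightarrow> 0 < 4 * k + 2 \<and> 4 * k + 2 \<le> 4 * int n \<and> 0 \<le> 4 * l - 2 \<and> 4 * l - 2 < 4 * int n"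
      using assms by (simp add: sublattice_def unit_square_def field_simps) linarith
    also have "\<dots> \<longleftrightarrow> (k, l) \<in> dual_idx n" by (auto simp: dual_idx_def)
    finally show ?thesis .
  qed
  ultimately show ?thesis by auto
qed

lemma peano_verts_eq: 
  assumes "0 < n"
  shows "peano_verts n = peano n ` square n"
proof -
  have "grid (1 / (4 * real n)) (1 / (2 * real n)) = range (peano n)"
    using assms by (intro grid_eq_range[where m = 0]) (simp add: sublattice_def pt_def field_simps)
  moreover have "(3 / (4 * real n) \<le> Re (peano n (k, l)) \<and> Re (peano n (k, l)) \<le> 1 - 1 / (4 * real n) \<and>
      1 / (4 * real n) \<le> Im (peano n (k, l)) \<and> Im (peano n (k, l)) \<le> 1 - 3 / (4 * real n)) \<longleftrightarrow> (k, l) \<in> square n" for k l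
  proof -
    have "(3 / (4 * real n) \<le> Re (peano n (k, l)) \<and> Re (peano n (k, l)) \<le> 1 - 1 / (4 * real n) \<and>
      1 / (4 * real n) \<le> Im (peano n (k, l)) \<and> Im (peano n (k, l)) \<le> 1 - 3 / (4 * real n)) \<longleftrightarrow>
      3 \<le> 2 * k + 1 \<and> 2 * k + 1 \<le> 4 * int n - 1 \<and> 1 \<le> 2 * l + 1 \<and> 2 * l + 1 \<le> 4 * int n - 3"
    proof -
      have 1: "1 - 1 / (4 * real n) = of_int (4 * int n - 1) / (4 * real n)"
        "1 - 3 / (4 * real n) = of_int (4 * int n - 3) / (4 * real n)"
        using assms by (simp_all add: field_simps)
      show ?thesis
        unfolding 1 sublattice_def Re_pt Im_pt using assms
        by (simp add: divide_le_cancel del: of_int_add of_int_diff of_int_mult)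
    qed
    also have "\<dots> \<longleftrightarrow> (k, l) \<in> square n" by (auto simp: square_def)
    finally show ?thesis .
  qed
  ultimately show ?thesis unfolding peano_verts_def by auto
qed

section \<open>The tree of a configuration and its dual\<close>

text \<open>
  All arrows but that of the lower right corner, which is the root.
\<close>

definition tree :: "nat \<Rightarrow> (int \<times> int) set \<Rightarrow> complex set set" where
  "tree n C = (\<lambda>v. {primal n v, primal n (arrow (directions n C) 1 v)}) ` (primal_idx n - {(int n, 0)})"

definition dual_tree :: "nat \<Rightarrow> (int \<times> int) set \<Rightarrow> complex set set" where
  "dual_tree n C = (\<lambda>w. {dual n w, dual n (arrow (directions n C) (- 1) w)}) ` (dual_idx n - {(0, int n)})"

lemma arrow_primal:
  assumes "v \<in> primal_idx n" "v \<noteq> (int n, 0)"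
  shows "arrow (directions n C) 1 v \<in> primal_idx n" "adjacent v (arrow (directions n C) 1 v)"
    "nat (int n - fst (arrow (directions n C) 1 v) + snd (arrow (directions n C) 1 v)) < nat (int n - fst v + snd v)"
  using assms by (auto simp: primal_idx_def arrow_def directions_def adjacent_def split: if_splits)

lemma arrow_dual:
  assumes "v \<in> dual_idx n" "v \<noteq> (0, int n)"
  shows "arrow (directions n C) (- 1) v \<in> dual_idx n" "adjacent v (arrow (directions n C) (- 1) v)"
    "nat (int n + fst (arrow (directions n C) (- 1) v) - snd (arrow (directions n C) (- 1) v)) < nat (int n + fst v - snd v)"
  using assms by (auto simp: dual_idx_def arrow_def directions_def adjacent_def split: if_splits)

lemma primal_graph_eq:
  assumes "0 < n"
  shows "verts (primal_graph n) = primal n ` primal_idx n"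
    "edges (primal_graph n) = {{primal n v, primal n w} | v w. v \<in> primal_idx n \<and> w \<in> primal_idx n \<and> adjacent v w}"
    "ends (primal_graph n) e = e"
proof -
  show "verts (primal_graph n) = primal n ` primal_idx n"
    using assms by (simp add: primal_graph_def verts_primal)
  have "1 / real n = of_int 4 / (4 * real n)" using assms by simp
  from edges_nn_graph_sublattice[OF assms _ this, of 0 0 "primal_idx n"]
  show "edges (primal_graph n) = {{primal n v, primal n w} | v w. v \<in> primal_idx n \<and> w \<in> primal_idx n \<and> adjacent v w}"
    unfolding primal_graph_def verts_primal[OF assms] by simp
qed (simp add: primal_graph_def)

lemma dual_graph_eq:
  assumes "0 < n"
  shows "verts (dual_graph n) = dual n ` dual_idx n"
    "edges (dual_graph n) = {{dual n v, dual n w} | v w. v \<in> dual_idx n \<and> w \<in> dual_idx n \<and> adjacent v w}"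
    "ends (dual_graph n) e = e"
proof -
  show "verts (dual_graph n) = dual n ` dual_idx n"
    using assms by (simp add: dual_graph_def verts_dual)
  have "1 / real n = of_int 4 / (4 * real n)" using assms by simp
  from edges_nn_graph_sublattice[OF assms _ this, of 2 "- 2" "dual_idx n"]
  show "edges (dual_graph n) = {{dual n v, dual n w} | v w. v \<in> dual_idx n \<and> w \<in> dual_idx n \<and> adjacent v w}"
    unfolding dual_graph_def verts_dual[OF assms] by simp
qed (simp add: dual_graph_def)

text \<open>
  Parents and ranks are defined on pairs of integers, whereas the vertices are points of the plane or,
  after the contraction, sets of points; the embedding \<open>g\<close> passes from the former to the latter.
\<close>

lemma rooted_spanning_tree:
  fixes g :: "'a \<Rightarrow> 'v" and rank :: "'a \<Rightarrow> nat"
  assumes inj: "inj_on g A" and V: "verts G = g ` A"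
    and p: "\<And>v. v \<in> A \<Longrightarrow> v \<noteq> r \<Longrightarrow> p v \<in> A \<and> rank (p v) < rank v \<and>
      f v \<in> edges G \<and> ends G (f v) = {g v, g (p v)}"
    and r: "r \<in> A"
  shows "f ` (A - {r}) \<in> spanning_trees G"
proof -
  define h where "h = the_inv_into A g"
  have h: "h (g v) = v" if "v \<in> A" for v
    unfolding h_def using the_inv_into_f_f[OF inj that] .
  have eq: "f ` (A - {r}) = (\<lambda>x. f (h x)) ` (verts G - {g r})"
  proof -
    have "verts G - {g r} = g ` (A - {r})" using inj r V by (auto simp: inj_on_def)
    then show ?thesis by (auto simp: image_image h)
  qed
  have *: "g (p (h x)) \<in> verts G \<and> rank (h (g (p (h x)))) < rank (h x) \<and> ends G (f (h x)) = {x, g (p (h x))}"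
    if x: "x \<in> verts G" "x \<noteq> g r" for x
  proof -
    obtain v where v: "v \<in> A" "x = g v" using x V by auto
    then have "v \<noteq> r" using x by auto
    then show ?thesis using p[OF v(1)] V v h by auto
  qed
  have "connected_by G (f ` (A - {r}))" unfolding eq
    using * by (intro connected_by_rooted_edges[where p = "\<lambda>x. g (p (h x))" and rank = "\<lambda>x. rank (h x)"]) auto
  moreover have "acyclic_edges G (f ` (A - {r}))" unfolding eq
    using * by (intro acyclic_rooted_edges[where p = "\<lambda>x. g (p (h x))" and rank = "\<lambda>x. rank (h x)"]) auto
  moreover have "f ` (A - {r}) \<subseteq> edges G" using p by auto
  ultimately show ?thesis by (simp add: spanning_trees_def)
qed

lemma tree_spanning:
  assumes "0 < n"
  shows "tree n C \<in> spanning_trees (primal_graph n)"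
  unfolding tree_def
proof (rule rooted_spanning_tree[where g = "primal n" and p = "arrow (directions n C) 1"
      and rank = "\<lambda>v. nat (int n - fst v + snd v)"])
  show "(int n, 0) \<in> primal_idx n" using assms by (simp add: primal_idx_def)
  fix v assume v: "v \<in> primal_idx n" "v \<noteq> (int n, 0)"
  then have "{primal n v, primal n (arrow (directions n C) 1 v)} \<in> edges (primal_graph n)"
    unfolding primal_graph_eq[OF assms] using arrow_primal by blast
  then show "arrow (directions n C) 1 v \<in> primal_idx n \<and>
      nat (int n - fst (arrow (directions n C) 1 v) + snd (arrow (directions n C) 1 v)) < nat (int n - fst v + snd v) \<and>
      {primal n v, primal n (arrow (directions n C) 1 v)} \<in> edges (primal_graph n) \<and>
      ends (primal_graph n) {primal n v, primal n (arrow (directions n C) 1 v)} = {primal n v, primal n (arrow (directions n C) 1 v)}"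
    using arrow_primal[OF v] assms by (simp add: primal_graph_eq)
qed (use assms in \<open>simp_all add: primal_graph_eq inj_sublattice\<close>)

lemma dual_tree_spanning:
  assumes "0 < n"
  shows "dual_tree n C \<in> spanning_trees (dual_graph n)"
  unfolding dual_tree_def
proof (rule rooted_spanning_tree[where g = "dual n" and p = "arrow (directions n C) (- 1)"
      and rank = "\<lambda>v. nat (int n + fst v - snd v)"])
  show "(0, int n) \<in> dual_idx n" using assms by (simp add: dual_idx_def)
  fix v assume v: "v \<in> dual_idx n" "v \<noteq> (0, int n)"
  then have "{dual n v, dual n (arrow (directions n C) (- 1) v)} \<in> edges (dual_graph n)"
    unfolding dual_graph_eq[OF assms] using arrow_dual by blast
  then show "arrow (directions n C) (- 1) v \<in> dual_idx n \<and>
      nat (int n + fst (arrow (directions n C) (- 1) v) - snd (arrow (directions n C) (- 1) v)) < nat (int n + fst v - snd v) \<and>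
      {dual n v, dual n (arrow (directions n C) (- 1) v)} \<in> edges (dual_graph n) \<and>
      ends (dual_graph n) {dual n v, dual n (arrow (directions n C) (- 1) v)} = {dual n v, dual n (arrow (directions n C) (- 1) v)}"
    using arrow_dual[OF v] assms by (simp add: dual_graph_eq)
qed (use assms in \<open>simp_all add: dual_graph_eq inj_sublattice\<close>)

lemma primal_edge: "{primal n (i, j), primal n (arrow r 1 (i, j))} =
    (if r i j then {pt n (4 * i) (4 * j), pt n (4 * i + 4) (4 * j)} else {pt n (4 * i) (4 * j), pt n (4 * i) (4 * j - 4)})"
  by (simp add: sublattice_def arrow_def)

lemma dual_edge: "{dual n (i, j), dual n (arrow r (- 1) (i, j))} =
    (if r i j then {pt n (4 * i + 2) (4 * j - 2), pt n (4 * i - 2) (4 * j - 2)}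
     else {pt n (4 * i + 2) (4 * j - 2), pt n (4 * i + 2) (4 * j + 2)})"
  by (simp add: sublattice_def arrow_def algebra_simps)

lemma primal_drawing_eq:
  assumes "0 < n"
  shows "primal_drawing n T = drawing T \<union> convex hull {pt n 0 0, pt n 4 0}
     \<union> convex hull {pt n (4 * int n) (4 * int n - 4), pt n (4 * int n) (4 * int n)}"
proof -
  have "pt n 0 0 = 0" "pt n 4 0 = Complex (1 / n) 0" "pt n (4 * int n) (4 * int n - 4) = Complex 1 ((real n - 1) / n)"
    "pt n (4 * int n) (4 * int n) = Complex 1 1"
    using assms by (simp_all add: complex_eq_iff field_simps)
  then show ?thesis by (simp add: primal_drawing_def segment_convex_hull)
qed

lemmas disjoint_segments = disjoint_hh disjoint_vv disjoint_hv disjoint_vh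

lemma drawing_image_disjoint:
  "A \<inter> drawing (f ` S) = {} \<longleftrightarrow> (\<forall>v\<in>S. A \<inter> convex hull (f v) = {})"
  by (auto simp: drawing_def)

text \<open>
  An edge of the tree and an edge of the dual tree can only meet if they belong to the same index, and then
  the arrow of this index would have to point both to the right and down.
\<close>

lemma dual_tree_disjoint:
  assumes "0 < n"
  shows "primal_drawing n (tree n C) \<inter> drawing (dual_tree n C) = {}"
proof -
  let ?r = "directions n C"
  have "primal_drawing n (tree n C) \<inter> convex hull {dual n w, dual n (arrow ?r (- 1) w)} = {}"
    if w: "w \<in> dual_idx n" for w
  proof -
    obtain k l where kl: "w = (k, l)" "0 \<le> k" "k \<le> int n - 1" "1 \<le> l" "l \<le> int n"
      using w by (auto simp: dual_idx_def)
    let ?W = "convex hull {dual n w, dual n (arrow ?r (- 1) w)}"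
    have 1: "?W \<inter> convex hull {primal n v, primal n (arrow ?r 1 v)} = {}" for v
    proof -
      obtain i j where v: "v = (i, j)" by fastforce
      have ne: "4 * l - 2 \<noteq> 4 * j" "4 * k + 2 \<noteq> 4 * i" by presburger+
      have cross: "i = k \<and> j = l" if "4 * i \<le> 4 * k + 2" "4 * k \<le> 2 + 4 * i" "4 * l - 2 \<le> 4 * j" "4 * j \<le> 4 * l + 2"
        using that by presburger
      have cross': "i = k \<and> j = l" if "4 * k - 2 \<le> 4 * i" "4 * i \<le> 4 * k + 2" "4 * j \<le> 2 + 4 * l" "4 * l - 2 \<le> 4 * j"
        using that by presburger
      show ?thesis
        unfolding kl(1) v primal_edge dual_edge
      proof (cases "?r i j"; cases "?r k l")
        assume r: "?r i j" "?r k l"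
        show "convex hull (if ?r k l then {pt n (4 * k + 2) (4 * l - 2), pt n (4 * k - 2) (4 * l - 2)}
            else {pt n (4 * k + 2) (4 * l - 2), pt n (4 * k + 2) (4 * l + 2)}) \<inter>
          convex hull (if ?r i j then {pt n (4 * i) (4 * j), pt n (4 * i + 4) (4 * j)}
            else {pt n (4 * i) (4 * j), pt n (4 * i) (4 * j - 4)}) = {}"
          using r disjoint_hh[OF assms ne(1)] by simp
      next
        assume r: "\<not> ?r i j" "\<not> ?r k l"
        show "convex hull (if ?r k l then {pt n (4 * k + 2) (4 * l - 2), pt n (4 * k - 2) (4 * l - 2)}
            else {pt n (4 * k + 2) (4 * l - 2), pt n (4 * k + 2) (4 * l + 2)}) \<inter>
          convex hull (if ?r i j then {pt n (4 * i) (4 * j), pt n (4 * i + 4) (4 * j)}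
            else {pt n (4 * i) (4 * j), pt n (4 * i) (4 * j - 4)}) = {}"
          using r disjoint_vv[OF assms ne(2)] by simp
      qed (use assms in \<open>auto simp: disjoint_hv disjoint_vh dest: cross cross'\<close>)
    qed
    have 2: "?W \<inter> convex hull {pt n 0 0, pt n 4 0} = {}"
      unfolding kl(1) dual_edge
      using assms kl by (cases "?r k l") (simp_all add: disjoint_segments)
    have 3: "?W \<inter> convex hull {pt n (4 * int n) (4 * int n - 4), pt n (4 * int n) (4 * int n)} = {}"
      unfolding kl(1) dual_edge
      using assms kl by (cases "?r k l") (simp_all add: disjoint_segments)
    show ?thesis using 1 2 3 unfolding primal_drawing_eq[OF assms] tree_def drawing_def by blast
  qed
  then show ?thesis unfolding dual_tree_def drawing_image_disjoint by blast
qed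

lemma adjacentE:
  assumes "adjacent v w"
  obtains "w = (fst v + 1, snd v)" | "w = (fst v - 1, snd v)" | "w = (fst v, snd v + 1)" | "w = (fst v, snd v - 1)"
  using assms unfolding adjacent_def prod_eq_iff by (cases v; cases w) (simp, linarith)

text \<open>
  A dual edge outside of the dual tree crosses the edge of the tree that has the same index. So all trees
  disjoint from the given one are contained in \<open>dual_tree n C\<close>, and a spanning tree has no proper connected
  subset.
\<close>

lemma dual_tree_unique:
  assumes "0 < n" and T': "is_dual_tree n (tree n C) T'"
  shows "T' = dual_tree n C"
proof -
  let ?r = "directions n C"
  have T: "T' \<subseteq> edges (dual_graph n)" "connected_by (dual_graph n) T'"
    and disj: "primal_drawing n (tree n C) \<inter> drawing T' = {}"
    using T' unfolding is_dual_tree_def spanning_trees_def by auto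
  have no_cross: "\<not> convex hull e \<inter> convex hull {primal n v, primal n (arrow ?r 1 v)} \<noteq> {}"
    if "e \<in> T'" "v \<in> primal_idx n" "v \<noteq> (int n, 0)" for e v
    using disj that unfolding primal_drawing_eq[OF assms(1)] tree_def drawing_def by blast
  have left: "{dual n (i, j), dual n (i - 1, j)} \<in> dual_tree n C"
    if e: "{dual n (i, j), dual n (i - 1, j)} \<in> T'" and ij: "1 \<le> i" "i \<le> int n - 1" "1 \<le> j" "j \<le> int n" for i j
  proof -
    have "?r i j"
    proof (rule ccontr)
      assume "\<not> ?r i j"
      then have "j < int n" using ij by (auto simp: directions_def)
      then show False using no_cross[OF e, of "(i, j)"] assms(1) ij \<open>\<not> ?r i j\<close>
        unfolding primal_edge by (simp add: sublattice_def disjoint_segments primal_idx_def)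
    qed
    then show ?thesis using ij unfolding dual_tree_def
      by (intro image_eqI[where x = "(i, j)"]) (auto simp: arrow_def dual_idx_def)
  qed
  have up: "{dual n (i, j), dual n (i, j + 1)} \<in> dual_tree n C"
    if e: "{dual n (i, j), dual n (i, j + 1)} \<in> T'" and ij: "0 \<le> i" "i \<le> int n - 1" "1 \<le> j" "j \<le> int n - 1" for i j
  proof -
    have "\<not> ?r i j"
    proof (rule ccontr)
      assume "\<not> \<not> ?r i j"
      then have "1 \<le> i" using ij by (auto simp: directions_def)
      then show False using no_cross[OF e, of "(i, j)"] assms(1) ij \<open>\<not> \<not> ?r i j\<close>
        unfolding primal_edge by (simp add: sublattice_def disjoint_segments primal_idx_def)
    qed
    then show ?thesis using ij unfolding dual_tree_def
      by (intro image_eqI[where x = "(i, j)"]) (auto simp: arrow_def dual_idx_def)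
  qed
  have "T' \<subseteq> dual_tree n C"
  proof
    fix e assume e: "e \<in> T'"
    then obtain v w where vw: "e = {dual n v, dual n w}" "v \<in> dual_idx n" "w \<in> dual_idx n" "adjacent v w"
      using T(1) dual_graph_eq(2)[OF assms(1)] by blast
    obtain i j where v: "v = (i, j)" by fastforce
    from vw(4) show "e \<in> dual_tree n C"
    proof (cases rule: adjacentE)
      case 1
      then show ?thesis using left[of "i + 1" j] e vw v by (simp add: dual_idx_def insert_commute)
    next
      case 2
      then show ?thesis using left[of i j] e vw v by (simp add: dual_idx_def)
    next
      case 3
      then show ?thesis using up[of i j] e vw v by (simp add: dual_idx_def)
    next
      case 4
      then show ?thesis using up[of i "j - 1"] e vw v by (simp add: dual_idx_def insert_commute)
    qed
  qed
  moreover have "dual_tree n C \<in> spanning_trees (dual_graph n)" by (rule dual_tree_spanning[OF assms(1)])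
  then have D: "acyclic_edges (dual_graph n) (dual_tree n C)" "dual_tree n C \<subseteq> edges (dual_graph n)"
    unfolding spanning_trees_def by auto
  moreover have "\<exists>u\<in>verts (dual_graph n). \<exists>v\<in>verts (dual_graph n). ends (dual_graph n) e = {u, v}"
    if "e \<in> dual_tree n C" for e
    using subsetD[OF D(2) that] unfolding dual_graph_eq[OF assms(1)] by blast
  ultimately show ?thesis using T(2) by (intro acyclic_connected_subset_eq)
qed

section \<open>The Peano path of a configuration\<close>

lemma peano_horizontal: "{peano n (a, b), peano n (a + 1, b)} = {pt n (2 * a + 1) (2 * b + 1), pt n (2 * a + 3) (2 * b + 1)}"
  by (simp add: sublattice_def add.commute)

lemma peano_vertical: "{peano n (a, b), peano n (a, b + 1)} = {pt n (2 * a + 1) (2 * b + 1), pt n (2 * a + 1) (2 * b + 3)}"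
  by (simp add: sublattice_def add.commute)

text \<open>
  A step of the Peano path meets a grid line only in its midpoint, so it can meet only one edge of the tree
  or of the dual tree. This and the next three lemmas determine that edge.
\<close>

lemma cross_horizontal_primal:
  assumes "0 < n"
  shows "convex hull {peano n (a, b), peano n (a + 1, b)} \<inter> convex hull {primal n (i, j), primal n (arrow r 1 (i, j))} = {} \<longleftrightarrow>
    (2 * i = a + 1 \<and> j = (b + 2) div 2 \<longrightarrow> r i j)"
proof -
  have ne: "2 * b + 1 \<noteq> 4 * j" by presburger
  have "(2 * a + 1 \<le> 4 * i \<and> 4 * i \<le> 2 * a + 3 \<and> 4 * j - 4 \<le> 2 * b + 1 \<and> 2 * b + 1 \<le> 4 * j) \<longleftrightarrow>
      2 * i = a + 1 \<and> j = (b + 2) div 2" by presburger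
  then show ?thesis unfolding peano_horizontal primal_edge
    using assms disjoint_hh[OF assms ne] by (cases "r i j") (auto simp: disjoint_hv)
qed

lemma cross_horizontal_dual:
  assumes "0 < n"
  shows "convex hull {peano n (a, b), peano n (a + 1, b)} \<inter> convex hull {dual n (i, j), dual n (arrow r (- 1) (i, j))} = {} \<longleftrightarrow>
    (2 * i = a \<and> j = (b + 1) div 2 \<longrightarrow> r i j)"
proof -
  have ne: "2 * b + 1 \<noteq> 4 * j - 2" by presburger
  have "(2 * a + 1 \<le> 4 * i + 2 \<and> 4 * i + 2 \<le> 2 * a + 3 \<and> 4 * j - 2 \<le> 2 * b + 1 \<and> 2 * b + 1 \<le> 4 * j + 2) \<longleftrightarrow>
      2 * i = a \<and> j = (b + 1) div 2" by presburger
  then show ?thesis unfolding peano_horizontal dual_edge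
    using assms disjoint_hh[OF assms ne] by (cases "r i j") (auto simp: disjoint_hv)
qed

lemma cross_vertical_primal:
  assumes "0 < n"
  shows "convex hull {peano n (a, b), peano n (a, b + 1)} \<inter> convex hull {primal n (i, j), primal n (arrow r 1 (i, j))} = {} \<longleftrightarrow>
    (i = a div 2 \<and> 2 * j = b + 1 \<longrightarrow> \<not> r i j)"
proof -
  have ne: "2 * a + 1 \<noteq> 4 * i" by presburger
  have "(4 * i \<le> 2 * a + 1 \<and> 2 * a + 1 \<le> 4 * i + 4 \<and> 2 * b + 1 \<le> 4 * j \<and> 4 * j \<le> 2 * b + 3) \<longleftrightarrow>
      i = a div 2 \<and> 2 * j = b + 1" by presburger
  then show ?thesis unfolding peano_vertical primal_edge
    using assms disjoint_vv[OF assms ne] by (cases "r i j") (auto simp: disjoint_vh)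
qed

lemma cross_vertical_dual:
  assumes "0 < n"
  shows "convex hull {peano n (a, b), peano n (a, b + 1)} \<inter> convex hull {dual n (i, j), dual n (arrow r (- 1) (i, j))} = {} \<longleftrightarrow>
    (i = (a + 1) div 2 \<and> 2 * j = b + 2 \<longrightarrow> \<not> r i j)"
proof -
  have ne: "2 * a + 1 \<noteq> 4 * i + 2" by presburger
  have "(4 * i - 2 \<le> 2 * a + 1 \<and> 2 * a + 1 \<le> 4 * i + 2 \<and> 2 * b + 1 \<le> 4 * j - 2 \<and> 4 * j - 2 \<le> 2 * b + 3) \<longleftrightarrow>
      i = (a + 1) div 2 \<and> 2 * j = b + 2" by presburger
  then show ?thesis unfolding peano_vertical dual_edge
    using assms disjoint_vv[OF assms ne] by (cases "r i j") (auto simp: disjoint_vh)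
qed

lemma peano_edge_avoids_iff:
  assumes "0 < n" and E: "E \<inter> convex hull {pt n 0 0, pt n 4 0} = {}"
     "E \<inter> convex hull {pt n (4 * int n) (4 * int n - 4), pt n (4 * int n) (4 * int n)} = {}"
  shows "E \<inter> (primal_drawing n (tree n C) \<union> drawing (dual_tree n C)) = {} \<longleftrightarrow>
    (\<forall>(i, j)\<in>primal_idx n - {(int n, 0)}. E \<inter> convex hull {primal n (i, j), primal n (arrow (directions n C) 1 (i, j))} = {}) \<and>
    (\<forall>(i, j)\<in>dual_idx n - {(0, int n)}. E \<inter> convex hull {dual n (i, j), dual n (arrow (directions n C) (- 1) (i, j))} = {})"
  using E unfolding primal_drawing_eq[OF assms(1)] Int_Un_distrib Un_empty tree_def dual_tree_def drawing_image_disjoint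
  by auto

text \<open>
  If the step crosses a line of the tree it is free if the edge there is missing, that is, if the arrow points
  to the right; if it crosses a line of the dual tree, it is free if the dual edge is missing, which is again
  the case if the arrow points to the right.
\<close>

lemma horizontal_avoids_iff:
  assumes "0 < n" "(a, b) \<in> square n" "(a + 1, b) \<in> square n"
  shows "convex hull {peano n (a, b), peano n (a + 1, b)} \<inter> (primal_drawing n (tree n C) \<union> drawing (dual_tree n C)) = {} \<longleftrightarrow>
    directions n C ((a + 1) div 2) ((if even a then b + 1 else b + 2) div 2)"
proof -
  have ab: "1 \<le> a" "a + 1 \<le> 2 * int n - 1" "0 \<le> b" "b \<le> 2 * int n - 2" using assms by (auto simp: square_def)
  have "convex hull {peano n (a, b), peano n (a + 1, b)} \<inter> convex hull {pt n 0 0, pt n 4 0} = {}"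
    "convex hull {peano n (a, b), peano n (a + 1, b)} \<inter> convex hull {pt n (4 * int n) (4 * int n - 4), pt n (4 * int n) (4 * int n)} = {}"
    unfolding peano_horizontal using assms(1) ab by (auto intro!: disjoint_hh simp: disjoint_hv, presburger)
  note iff = peano_edge_avoids_iff[OF assms(1) this]
  have "(\<forall>(i, j)\<in>primal_idx n - {(int n, 0)}. 2 * i = a + 1 \<and> j = (b + 2) div 2 \<longrightarrow> directions n C i j) \<longleftrightarrow>
      (odd a \<longrightarrow> directions n C ((a + 1) div 2) ((b + 2) div 2))" (is "?P \<longleftrightarrow> ?Q")
  proof
    assume ?P
    show ?Q
    proof
      assume odd: "odd a"
      show "directions n C ((a + 1) div 2) ((b + 2) div 2)"
      proof (rule ccontr)
        assume r: "\<not> directions n C ((a + 1) div 2) ((b + 2) div 2)"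
        have i: "2 * ((a + 1) div 2) = a + 1" using odd by presburger
        have "(b + 2) div 2 \<noteq> int n" using r i ab by (auto simp: directions_def)
        then have "((a + 1) div 2, (b + 2) div 2) \<in> primal_idx n - {(int n, 0)}"
          using ab i by (auto simp: primal_idx_def)
        then show False using \<open>?P\<close> i r by blast
      qed
    qed
  next
    assume Q: ?Q
    show ?P
    proof (clarify)
      fix i assume "2 * i = a + 1"
      then have "odd a" "i = (a + 1) div 2" by presburger+
      then show "directions n C i ((b + 2) div 2)" using Q by simp
    qed
  qed
  moreover have "(\<forall>(i, j)\<in>dual_idx n - {(0, int n)}. 2 * i = a \<and> j = (b + 1) div 2 \<longrightarrow> directions n C i j) \<longleftrightarrow>
      (even a \<longrightarrow> directions n C ((a + 1) div 2) ((b + 1) div 2))" (is "?P \<longleftrightarrow> ?Q")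
  proof
    assume ?P
    show ?Q
    proof
      assume even: "even a"
      show "directions n C ((a + 1) div 2) ((b + 1) div 2)"
      proof (rule ccontr)
        assume r: "\<not> directions n C ((a + 1) div 2) ((b + 1) div 2)"
        have i: "2 * ((a + 1) div 2) = a" using even by presburger
        have "(b + 1) div 2 \<noteq> 0" using r i ab by (auto simp: directions_def)
        then have "((a + 1) div 2, (b + 1) div 2) \<in> dual_idx n - {(0, int n)}"
          using ab i by (auto simp: dual_idx_def)
        then show False using \<open>?P\<close> i r by blast
      qed
    qed
  next
    assume Q: ?Q
    show ?P
    proof (clarify)
      fix i assume "a = 2 * i"
      then show "directions n C i ((b + 1) div 2)" using Q by simp
    qed
  qed
  ultimately show ?thesis
    unfolding iff cross_horizontal_primal[OF assms(1)] cross_horizontal_dual[OF assms(1)] by auto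
qed

lemma vertical_avoids_iff:
  assumes "0 < n" "(a, b) \<in> square n" "(a, b + 1) \<in> square n"
  shows "convex hull {peano n (a, b), peano n (a, b + 1)} \<inter> (primal_drawing n (tree n C) \<union> drawing (dual_tree n C)) = {} \<longleftrightarrow>
    \<not> directions n C ((if even b then a + 1 else a) div 2) ((b + 2) div 2)"
proof -
  have ab: "1 \<le> a" "a \<le> 2 * int n - 1" "0 \<le> b" "b + 1 \<le> 2 * int n - 2" using assms by (auto simp: square_def)
  have "convex hull {peano n (a, b), peano n (a, b + 1)} \<inter> convex hull {pt n 0 0, pt n 4 0} = {}"
    "convex hull {peano n (a, b), peano n (a, b + 1)} \<inter> convex hull {pt n (4 * int n) (4 * int n - 4), pt n (4 * int n) (4 * int n)} = {}"
    unfolding peano_vertical using assms(1) ab by (auto intro!: disjoint_vv simp: disjoint_vh, presburger)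
  note iff = peano_edge_avoids_iff[OF assms(1) this]
  have "(\<forall>(i, j)\<in>primal_idx n - {(int n, 0)}. i = a div 2 \<and> 2 * j = b + 1 \<longrightarrow> \<not> directions n C i j) \<longleftrightarrow>
      (odd b \<longrightarrow> \<not> directions n C (a div 2) ((b + 2) div 2))" (is "?P \<longleftrightarrow> ?Q")
  proof
    assume ?P
    show ?Q
    proof (intro impI notI)
      assume odd: "odd b" and r: "directions n C (a div 2) ((b + 2) div 2)"
      have j: "2 * ((b + 2) div 2) = b + 1" using odd by presburger
      have "0 < a div 2" using r by (auto simp: directions_def)
      then have "(a div 2, (b + 2) div 2) \<in> primal_idx n - {(int n, 0)}"
        using ab j by (auto simp: primal_idx_def)
      then show False using \<open>?P\<close> j r by blast
    qed
  next
    assume Q: ?Q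
    show ?P
    proof (clarify)
      fix j assume "2 * j = b + 1" "directions n C (a div 2) j"
      moreover from this have "odd b" "j = (b + 2) div 2" by presburger+
      ultimately show False using Q by simp
    qed
  qed
  moreover have "(\<forall>(i, j)\<in>dual_idx n - {(0, int n)}. i = (a + 1) div 2 \<and> 2 * j = b + 2 \<longrightarrow> \<not> directions n C i j) \<longleftrightarrow>
      (even b \<longrightarrow> \<not> directions n C ((a + 1) div 2) ((b + 2) div 2))" (is "?P \<longleftrightarrow> ?Q")
  proof
    assume ?P
    show ?Q
    proof (intro impI notI)
      assume even: "even b" and r: "directions n C ((a + 1) div 2) ((b + 2) div 2)"
      have j: "2 * ((b + 2) div 2) = b + 2" using even by presburger
      have "(a + 1) div 2 < int n" using r by (auto simp: directions_def)
      then have "((a + 1) div 2, (b + 2) div 2) \<in> dual_idx n - {(0, int n)}"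
        using ab j by (auto simp: dual_idx_def)
      then show False using \<open>?P\<close> j r by blast
    qed
  next
    assume Q: ?Q
    show ?P
    proof (clarify)
      fix j assume "2 * j = b + 2" "directions n C ((a + 1) div 2) j"
      moreover from this have "even b" "j = (b + 2) div 2" by presburger+
      ultimately show False using Q by simp
    qed
  qed
  ultimately show ?thesis
    unfolding iff cross_vertical_primal[OF assms(1)] cross_vertical_dual[OF assms(1)] by auto
qed

text \<open>
  The free edges, oriented as in the Manhattan lattice, are just the moves.
\<close>

lemma peano_edges_eq:
  assumes "0 < n"
  shows "peano_edges n (tree n C) (dual_tree n C) =
    (\<lambda>p. {peano n p, peano n (move (directions n C) p)}) ` (square n - {(2 * int n - 1, 2 * int n - 2)})"
    (is "?L = ?f ` (square n - {?e})")
proof -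
  let ?r = "directions n C"
  let ?X = "primal_drawing n (tree n C) \<union> drawing (dual_tree n C)"
  have "1 / (2 * real n) = of_int 2 / (4 * real n)" using assms by simp
  from edges_nn_graph_sublattice[OF assms _ this, of 1 1 "square n"]
  have L: "?L = {{peano n v, peano n w} | v w. v \<in> square n \<and> w \<in> square n \<and> adjacent v w \<and>
      convex hull {peano n v, peano n w} \<inter> ?X = {}}"
    unfolding peano_edges_def peano_verts_eq[OF assms] by auto
  have h: "{peano n (a, b), peano n (a + 1, b)} \<in> ?f ` (square n - {?e})"
    if "(a, b) \<in> square n" "(a + 1, b) \<in> square n" "convex hull {peano n (a, b), peano n (a + 1, b)} \<inter> ?X = {}" for a b
  proof -
    have r: "?r ((a + 1) div 2) ((if even a then b + 1 else b + 2) div 2)"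
      using horizontal_avoids_iff[OF assms that(1,2)] that(3) by blast
    show ?thesis
    proof (cases "even b")
      case True
      then have "move ?r (a, b) = (a + 1, b)" using r by (simp add: move_def Let_def)
      moreover have "(a, b) \<noteq> ?e" using that(2) by (auto simp: square_def)
      ultimately show ?thesis using that(1) by (intro image_eqI[of _ _ "(a, b)"]) auto
    next
      case False
      then have "(if even a then b + 1 else b + 2) div 2 = (if even (a + 1) then b + 1 else b + 2) div 2"
        using False by (cases "even a"; simp; presburger)
      then have "move ?r (a + 1, b) = (a, b)" using r False by (simp add: move_def Let_def)
      moreover have "(a + 1, b) \<noteq> ?e" using False by auto
      ultimately show ?thesis using that(2) by (intro image_eqI[of _ _ "(a + 1, b)"]) auto
    qed
  qed
  have v: "{peano n (a, b), peano n (a, b + 1)} \<in> ?f ` (square n - {?e})"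
    if "(a, b) \<in> square n" "(a, b + 1) \<in> square n" "convex hull {peano n (a, b), peano n (a, b + 1)} \<inter> ?X = {}" for a b
  proof -
    have r: "\<not> ?r ((if even b then a + 1 else a) div 2) ((b + 2) div 2)"
      using vertical_avoids_iff[OF assms that(1,2)] that(3) by blast
    show ?thesis
    proof (cases "even a")
      case False
      then have "move ?r (a, b) = (a, b + 1)" using r by (simp add: move_def Let_def)
      moreover have "(a, b) \<noteq> ?e" using that(2) by (auto simp: square_def)
      ultimately show ?thesis using that(1) by (intro image_eqI[of _ _ "(a, b)"]) auto
    next
      case True
      then have "(if even b then a + 1 else a) div 2 = (if even (b + 1) then a + 1 else a) div 2"
        using True by (cases "even b"; simp; presburger)
      then have "move ?r (a, b + 1) = (a, b)" using r True by (simp add: move_def Let_def)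
      moreover have "(a, b + 1) \<noteq> ?e" using True by auto
      ultimately show ?thesis using that(2) by (intro image_eqI[of _ _ "(a, b + 1)"]) auto
    qed
  qed
  have "?L \<subseteq> ?f ` (square n - {?e})"
  proof
    fix e assume "e \<in> ?L"
    then obtain u w where uw: "e = {peano n u, peano n w}" "u \<in> square n" "w \<in> square n" "adjacent u w"
      "convex hull {peano n u, peano n w} \<inter> ?X = {}" unfolding L by blast
    obtain a b where u: "u = (a, b)" by fastforce
    from uw(4) show "e \<in> ?f ` (square n - {?e})"
    proof (cases rule: adjacentE)
      case 1
      then show ?thesis using h[of a b] uw u by simp
    next
      case 2
      then show ?thesis using h[of "a - 1" b] uw u by (simp add: insert_commute)
    next
      case 3
      then show ?thesis using v[of a b] uw u by simp
    next
      case 4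
      then show ?thesis using v[of a "b - 1"] uw u by (simp add: insert_commute)
    qed
  qed
  moreover have "?f p \<in> ?L" if p: "p \<in> square n" "p \<noteq> ?e" for p
  proof -
    obtain a b where ab: "p = (a, b)" by fastforce
    have q: "move ?r p \<in> square n" using move_in_square[OF p] .
    have adj: "adjacent p (move ?r p)" by (auto simp: ab move_def Let_def adjacent_def)
    let ?i = "(if even b then a + 1 else a) div 2" and ?j = "(if even a then b + 1 else b + 2) div 2"
    have "convex hull {peano n p, peano n (move ?r p)} \<inter> ?X = {}"
    proof (cases "?r ?i ?j")
      case r: True
      show ?thesis
      proof (cases "even b")
        case True
        then have m: "move ?r p = (a + 1, b)" using r by (simp add: ab move_def Let_def)
        show ?thesis using horizontal_avoids_iff[OF assms, of a b C] p q r True unfolding m unfolding ab by simp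
      next
        case False
        then have m: "move ?r p = (a - 1, b)" using r by (simp add: ab move_def Let_def)
        have "(if even a then b + 1 else b + 2) div 2 = (if even (a - 1) then b + 1 else b + 2) div 2"
          using False by (cases "even a"; simp; presburger)
        then show ?thesis using horizontal_avoids_iff[OF assms, of "a - 1" b C] p q r False unfolding m unfolding ab
          by (simp add: insert_commute)
      qed
    next
      case r: False
      show ?thesis
      proof (cases "even a")
        case False
        then have m: "move ?r p = (a, b + 1)" using r by (simp add: ab move_def Let_def)
        show ?thesis using vertical_avoids_iff[OF assms, of a b C] p q r False unfolding m unfolding ab by simp
      next
        case True
        then have m: "move ?r p = (a, b - 1)" using r by (simp add: ab move_def Let_def)
        have "(if even b then a + 1 else a) div 2 = (if even (b - 1) then a + 1 else a) div 2"
          using True by (cases "even b"; simp; presburger)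
        then show ?thesis using vertical_avoids_iff[OF assms, of a "b - 1" C] p q r True unfolding m unfolding ab
          by (simp add: insert_commute add.commute[of 1 b])
      qed
    qed
    then show ?thesis unfolding L using p q adj by blast
  qed
  ultimately show ?thesis by blast
qed

text \<open>
  The first vertex lies on no step but the first one, which therefore leads to the second vertex; without
  this step the same argument applies to the tails.
\<close>

lemma path_list_unique:
  assumes "distinct xs" "distinct ys" "xs \<noteq> []" "ys \<noteq> []" "hd xs = hd ys"
    and "{{xs ! k, xs ! Suc k} | k. Suc k < length xs} = {{ys ! k, ys ! Suc k} | k. Suc k < length ys}"
  shows "xs = ys"
  using assms
proof (induction xs arbitrary: ys)
  case (Cons x xs)
  obtain ys' where ys: "ys = x # ys'" using Cons.prems by (cases ys) auto
  have steps: "{{(x # zs) ! k, (x # zs) ! Suc k} | k. Suc k < length (x # zs)} =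
      (if zs = [] then {} else insert {x, hd zs} {{zs ! k, zs ! Suc k} | k. Suc k < length zs})" (is "?A = ?B") for zs
  proof (cases zs)
    case (Cons z zs')
    have "e \<in> ?A \<longleftrightarrow> e \<in> ?B" for e
    proof
      assume "e \<in> ?A"
      then obtain k where k: "e = {(x # zs) ! k, (x # zs) ! Suc k}" "Suc k < length (x # zs)" by blast
      then show "e \<in> ?B" using Cons by (cases k) auto
    next
      assume "e \<in> ?B"
      then consider "e = {x, z}" | k where "e = {zs ! k, zs ! Suc k}" "Suc k < length zs" using Cons by auto
      then show "e \<in> ?A"
      proof cases
        case 1
        then show ?thesis using Cons by (auto intro!: exI[of _ 0])
      next
        case 2
        then show ?thesis by (auto intro!: exI[of _ "Suc k"])
      qed
    qed
    then show ?thesis by blast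
  qed simp
  have x: "x \<notin> e" if "e \<in> {{zs ! k, zs ! Suc k} | k. Suc k < length zs}" "x \<notin> set zs" for e zs
    using that by auto
  show ?case
  proof (cases "xs = [] \<or> ys' = []")
    case True
    then show ?thesis using Cons.prems(6) unfolding ys steps by (auto split: if_splits)
  next
    case False
    let ?S = "\<lambda>zs. {{zs ! k, zs ! Suc k} | k. Suc k < length zs}"
    have eq: "insert {x, hd xs} (?S xs) = insert {x, hd ys'} (?S ys')"
      using Cons.prems(6) False unfolding ys steps by simp
    have nx: "x \<notin> set xs" "x \<notin> set ys'" using Cons.prems ys by auto
    have S: "?S zs = {e \<in> insert {x, hd zs} (?S zs). x \<notin> e}" if "x \<notin> set zs" for zs
      using x[OF _ that] by blast
    have "?S xs = ?S ys'" using S[OF nx(1)] S[OF nx(2)] eq by simp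
    moreover have "hd xs = hd ys'"
    proof -
      have "{x, hd xs} \<in> insert {x, hd ys'} (?S ys')" using eq by blast
      then have "{x, hd xs} = {x, hd ys'}" using x[OF _ nx(2)] by blast
      then show ?thesis by (auto simp: doubleton_eq_iff)
    qed
    ultimately show ?thesis using Cons.IH[of ys'] Cons.prems False ys by auto
  qed
qed simp

definition path_list :: "nat \<Rightarrow> (int \<times> int) set \<Rightarrow> complex list" where
  "path_list n C = map (\<lambda>k. peano n (orbit n C k)) [0..<card (square n)]"

lemma is_peano_list_path_list:
  assumes "0 < n"
  shows "is_peano_list n (tree n C) (dual_tree n C) (path_list n C)"
proof -
  let ?M = "card (square n)" and ?x = "orbit n C" and ?e = "(2 * int n - 1, 2 * int n - 2)"
  have n: "n \<ge> 1" using assms by simp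
  note O = orbit_props(1-3)[OF n, of C] orbit_props(4)[OF n]
  have M: "0 < ?M" and img: "?x ` {..<?M} = square n" and inj: "inj_on ?x {..<?M}" and last: "?x (?M - 1) = ?e"
    using O assms by auto
  have "inj_on (\<lambda>k. peano n (?x k)) {..<?M}"
    using comp_inj_on[OF inj inj_sublattice[OF assms, of 2 1 1]] by (simp add: o_def)
  then have "distinct (path_list n C)" unfolding path_list_def distinct_map set_upt atLeast0LessThan by simp
  moreover have "set (path_list n C) = peano_verts n"
  proof -
    have "set (path_list n C) = peano n ` (?x ` {..<?M})" by (auto simp: path_list_def)
    then show ?thesis by (simp only: img peano_verts_eq[OF assms])
  qed
  moreover have "hd (path_list n C) = Complex (3 / (4 * real n)) (1 / (4 * real n))"
    using M by (simp add: path_list_def hd_map orbit_def sublattice_def pt_def)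
  moreover have "last (path_list n C) = Complex (1 - 1 / (4 * real n)) (1 - 3 / (4 * real n))"
    using M assms last by (simp add: path_list_def last_map sublattice_def pt_def field_simps)
  moreover have "{{path_list n C ! k, path_list n C ! Suc k} | k. Suc k < length (path_list n C)}
      = peano_edges n (tree n C) (dual_tree n C)"
  proof -
    have "{{path_list n C ! k, path_list n C ! Suc k} | k. Suc k < length (path_list n C)}
      = (\<lambda>k. {peano n (?x k), peano n (move (directions n C) (?x k))}) ` {..<?M - 1}"
      unfolding setcompr_eq_image by (rule image_cong) (auto simp: path_list_def orbit_def)
    also have "\<dots> = (\<lambda>p. {peano n p, peano n (move (directions n C) p)}) ` (?x ` {..<?M - 1})"
      by (simp add: image_image)
    also have "?x ` {..<?M - 1} = square n - {?e}"
    proof -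
      have "{..<?M - 1} = {..<?M} - {?M - 1}" using M by auto
      then show ?thesis using inj_on_image_set_diff[OF inj, of "{..<?M}" "{?M - 1}"] M img last by auto
    qed
    finally show ?thesis by (simp add: peano_edges_eq[OF assms])
  qed
  ultimately show ?thesis using M by (simp add: is_peano_list_def path_list_def)
qed

definition full_list :: "nat \<Rightarrow> (int \<times> int) set \<Rightarrow> complex list" where
  "full_list n C = [0, Complex (1 / (4 * real n)) (1 / (4 * real n))] @ path_list n C @
                   [Complex (1 - 1 / (4 * real n)) (1 - 1 / (4 * real n)), Complex 1 1]"

lemma is_peano_path_iff:
  assumes "0 < n"
  shows "is_peano_path n (tree n C) \<zeta> \<longleftrightarrow> \<zeta> = polyline (full_list n C)"
proof
  assume "is_peano_path n (tree n C) \<zeta>"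
  then obtain T' ps where *: "is_dual_tree n (tree n C) T'" "is_peano_list n (tree n C) T' ps"
    "\<zeta> = polyline ([0, Complex (1 / (4 * real n)) (1 / (4 * real n))] @ ps @
                   [Complex (1 - 1 / (4 * real n)) (1 - 1 / (4 * real n)), Complex 1 1])"
    unfolding is_peano_path_def by blast
  have T': "T' = dual_tree n C" using dual_tree_unique[OF assms *(1)] .
  have "ps = path_list n C"
    using *(2) is_peano_list_path_list[OF assms, of C] unfolding T'
    by (intro path_list_unique) (auto simp: is_peano_list_def)
  then show "\<zeta> = polyline (full_list n C)" using *(3) by (simp add: full_list_def)
next
  assume "\<zeta> = polyline (full_list n C)"
  moreover have "is_dual_tree n (tree n C) (dual_tree n C)"
    using dual_tree_spanning[OF assms] dual_tree_disjoint[OF assms] by (simp add: is_dual_tree_def)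
  ultimately show "is_peano_path n (tree n C) \<zeta>"
    using is_peano_list_path_list[OF assms] unfolding is_peano_path_def full_list_def by blast
qed

section \<open>Fair trees\<close>

definition right_edge :: "nat \<Rightarrow> int \<times> int \<Rightarrow> complex set" where
  "right_edge n v = primal n ` {v, (fst v + 1, snd v)}"

definition down_edge :: "nat \<Rightarrow> int \<times> int \<Rightarrow> complex set" where
  "down_edge n v = primal n ` {v, (fst v, snd v - 1)}"

definition choice :: "nat \<Rightarrow> (int \<times> int) set \<Rightarrow> complex set set" where
  "choice n C = (\<lambda>v. if v \<in> C then right_edge n v else down_edge n v) ` interior_idx n"

definition incident :: "nat \<Rightarrow> (int \<times> int) set \<Rightarrow> complex set set" where
  "incident n S = right_edge n ` S \<union> down_edge n ` S"

abbreviation sides :: "nat \<Rightarrow> complex set" where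
  "sides n \<equiv> bottom_verts n \<union> right_verts n"

lemma inj_primal: "0 < n \<Longrightarrow> inj (primal n)"
  by (rule inj_sublattice) auto

lemma edge_inj:
  assumes "0 < n"
  shows "right_edge n v = right_edge n w \<longleftrightarrow> v = w" "down_edge n v = down_edge n w \<longleftrightarrow> v = w"
    "right_edge n v \<noteq> down_edge n w"
  unfolding right_edge_def down_edge_def inj_image_eq_iff[OF inj_primal[OF assms]]
  by (auto simp: doubleton_eq_iff prod_eq_iff)

lemma mem_edge:
  assumes "0 < n"
  shows "primal n u \<in> right_edge n v \<longleftrightarrow> u = v \<or> u = (fst v + 1, snd v)"
    "primal n u \<in> down_edge n v \<longleftrightarrow> u = v \<or> u = (fst v, snd v - 1)"
  unfolding right_edge_def down_edge_def inj_image_mem_iff[OF inj_primal[OF assms]] by auto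

lemma interior_subset_primal_idx: "interior_idx n \<subseteq> primal_idx n"
  by (auto simp: interior_idx_def primal_idx_def)

lemma sides_eq:
  assumes "0 < n"
  shows "bottom_verts n = primal n ` {v \<in> primal_idx n. snd v = 0}"
    "right_verts n = primal n ` {v \<in> primal_idx n. fst v = int n}"
    "sides n = primal n ` (primal_idx n - interior_idx n)"
proof -
  show b: "bottom_verts n = primal n ` {v \<in> primal_idx n. snd v = 0}"
  proof -
    have "Im (primal n v) = 0 \<longleftrightarrow> snd v = 0" for v
      using assms by (simp add: sublattice_def)
    then show ?thesis using assms by (auto simp: bottom_verts_def primal_graph_eq)
  qed
  have "Re (primal n v) = 1 \<longleftrightarrow> fst v = int n" for v
    using assms by (auto simp: sublattice_def field_simps) 
  then show r: "right_verts n = primal n ` {v \<in> primal_idx n. fst v = int n}"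
    using assms by (auto simp: right_verts_def primal_graph_eq)
  show "sides n = primal n ` (primal_idx n - interior_idx n)"
    unfolding b r image_Un[symmetric] by (rule arg_cong[of _ _ "\<lambda>A. primal n ` A"]) (auto simp: interior_idx_def primal_idx_def)
qed

text \<open>
  The contraction changes only the vertices outside of the interior.
\<close>

lemma block_sides:
  assumes "0 < n"
  shows "v \<in> interior_idx n \<Longrightarrow> block (sides n) (primal n v) = {primal n v}"
    "v \<in> primal_idx n \<Longrightarrow> v \<notin> interior_idx n \<Longrightarrow> block (sides n) (primal n v) = sides n"
  using inj_primal[OF assms] by (auto simp: block_def sides_eq(3)[OF assms] inj_image_mem_iff)

lemma adjacent_edge:
  assumes "adjacent v w"
  obtains u where "{primal n v, primal n w} = right_edge n u" "{u, (fst u + 1, snd u)} = {v, w}"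
    | u where "{primal n v, primal n w} = down_edge n u" "{u, (fst u, snd u - 1)} = {v, w}"
  using assms
proof (cases rule: adjacentE)
  case 1
  then show ?thesis by (intro that(1)[of v]) (simp_all add: right_edge_def)
next
  case 2
  then show ?thesis by (intro that(1)[of w]) (simp_all add: right_edge_def insert_commute)
next
  case 3
  then show ?thesis by (intro that(2)[of w]) (simp_all add: down_edge_def insert_commute)
next
  case 4
  then show ?thesis by (intro that(2)[of v]) (simp_all add: down_edge_def)
qed

lemma incident_edges:
  assumes "0 < n" "v \<in> interior_idx n"
  shows "right_edge n v \<in> edges (primal_graph n)" "down_edge n v \<in> edges (primal_graph n)"
proof -
  obtain i j where v: "v = (i, j)" by fastforce
  have "v \<in> primal_idx n" "(i + 1, j) \<in> primal_idx n" "(i, j - 1) \<in> primal_idx n" "adjacent v (i + 1, j)" "adjacent v (i, j - 1)"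
    using assms(2) by (auto simp: v interior_idx_def primal_idx_def adjacent_def)
  then show "right_edge n v \<in> edges (primal_graph n)" "down_edge n v \<in> edges (primal_graph n)"
    unfolding primal_graph_eq[OF assms(1)] right_edge_def down_edge_def v by auto
qed

lemma edge_cases:
  assumes "0 < n" "e \<in> edges (primal_graph n)"
  shows "e \<in> incident n (interior_idx n) \<or> e \<subseteq> bottom_verts n \<or> e \<subseteq> right_verts n"
proof -
  obtain v w where vw: "e = {primal n v, primal n w}" "v \<in> primal_idx n" "w \<in> primal_idx n" "adjacent v w"
    using assms unfolding primal_graph_eq[OF assms(1)] by blast
  from vw(4) show ?thesis
  proof (cases rule: adjacent_edge[where n = n])
    case (1 u)
    have u: "u \<in> primal_idx n" "(fst u + 1, snd u) \<in> primal_idx n" using 1(2) vw by (auto simp: doubleton_eq_iff)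
    show ?thesis
    proof (cases "snd u = 0")
      case True
      then have "e \<subseteq> bottom_verts n" using u unfolding vw(1) 1(1) sides_eq(1)[OF assms(1)] right_edge_def by auto
      then show ?thesis by blast
    next
      case False
      then have "u \<in> interior_idx n" using u by (auto simp: primal_idx_def interior_idx_def)
      then show ?thesis using 1 vw(1) by (auto simp: incident_def)
    qed
  next
    case (2 u)
    have u: "u \<in> primal_idx n" "(fst u, snd u - 1) \<in> primal_idx n" using 2(2) vw by (auto simp: doubleton_eq_iff)
    show ?thesis
    proof (cases "fst u = int n")
      case True
      then have "e \<subseteq> right_verts n" using u unfolding vw(1) 2(1) sides_eq(2)[OF assms(1)] down_edge_def by auto
      then show ?thesis by blast
    next
      case False
      then have "u \<in> interior_idx n" using u by (auto simp: primal_idx_def interior_idx_def)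
      then show ?thesis using 2 vw(1) by (auto simp: incident_def)
    qed
  qed
qed

lemma incident_not_sides:
  assumes "0 < n" "e \<in> incident n (interior_idx n)"
  shows "\<not> e \<subseteq> sides n"
proof -
  obtain v where v: "v \<in> interior_idx n" "e = right_edge n v \<or> e = down_edge n v" using assms(2) by (auto simp: incident_def)
  then have "primal n v \<in> e" by (auto simp: right_edge_def down_edge_def)
  moreover have "primal n v \<notin> sides n"
    using v(1) inj_primal[OF assms(1)] by (auto simp: sides_eq(3)[OF assms(1)] inj_image_mem_iff)
  ultimately show ?thesis by blast
qed

lemma side_edges_eq:
  assumes "0 < n"
  shows "side_edges n = edges (primal_graph n) - incident n (interior_idx n)"
  using edge_cases[OF assms] incident_not_sides[OF assms] unfolding side_edges_def by blast

lemma contracted_graph_eq: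
  assumes "0 < n"
  shows "verts (contracted_graph n) = insert (sides n) ((\<lambda>v. {primal n v}) ` interior_idx n)"
    "edges (contracted_graph n) = incident n (interior_idx n)"
    "ends (contracted_graph n) e = block (sides n) ` e"
proof -
  have root: "(int n, 0) \<in> primal_idx n - interior_idx n" using assms by (auto simp: interior_idx_def primal_idx_def)
  have "primal_idx n = interior_idx n \<union> (primal_idx n - interior_idx n)" using interior_subset_primal_idx by blast
  then have "(\<lambda>v. block (sides n) (primal n v)) ` primal_idx n =
      (\<lambda>v. block (sides n) (primal n v)) ` interior_idx n \<union> (\<lambda>v. block (sides n) (primal n v)) ` (primal_idx n - interior_idx n)"
    by (metis image_Un)
  also have "(\<lambda>v. block (sides n) (primal n v)) ` interior_idx n = (\<lambda>v. {primal n v}) ` interior_idx n"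
    using block_sides(1)[OF assms] by (intro image_cong) auto
  also have "(\<lambda>v. block (sides n) (primal n v)) ` (primal_idx n - interior_idx n) = (\<lambda>v. sides n) ` (primal_idx n - interior_idx n)"
    using block_sides(2)[OF assms] by (intro image_cong) auto
  also have "\<dots> = {sides n}" using root by blast
  finally have "(\<lambda>v. block (sides n) (primal n v)) ` primal_idx n = insert (sides n) ((\<lambda>v. {primal n v}) ` interior_idx n)"
    by simp
  then show "verts (contracted_graph n) = insert (sides n) ((\<lambda>v. {primal n v}) ` interior_idx n)"
    unfolding contracted_graph_def contract_def by (simp add: primal_graph_eq[OF assms] image_image)
  show "ends (contracted_graph n) e = block (sides n) ` e"
    unfolding contracted_graph_def contract_def by (simp add: primal_graph_eq[OF assms])
  have card: "card (block (sides n) ` e) \<noteq> 1" if inc: "e \<in> incident n (interior_idx n)" for e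
  proof -
    obtain v w where vw: "v \<in> interior_idx n" "e = {primal n v, primal n w}" "v \<noteq> w"
      using inc by (auto simp: incident_def right_edge_def down_edge_def prod_eq_iff)
    have "block (sides n) (primal n v) = {primal n v}" using block_sides[OF assms] vw by blast
    moreover have "primal n v \<notin> block (sides n) (primal n w)"
      using vw(1,3) inj_primal[OF assms] by (auto simp: block_def sides_eq(3)[OF assms] inj_image_mem_iff inj_eq)
    ultimately have "block (sides n) (primal n v) \<noteq> block (sides n) (primal n w)" by blast
    then show ?thesis unfolding vw(2) by simp
  qed
  have "card (block (sides n) ` e) = 1" if e: "e \<in> edges (primal_graph n)" "e \<notin> incident n (interior_idx n)" for e
  proof -
    have "e \<subseteq> sides n" using edge_cases[OF assms e(1)] e(2) by blast
    then have "block (sides n) ` e \<subseteq> {sides n}" by (auto simp: block_def)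
    moreover have "e \<noteq> {}" using e(1) by (auto simp: primal_graph_eq[OF assms])
    ultimately have "block (sides n) ` e = {sides n}" by blast
    then show ?thesis by simp
  qed
  then show "edges (contracted_graph n) = incident n (interior_idx n)"
    unfolding contracted_graph_def contract_def using card incident_edges[OF assms]
    by (auto simp: primal_graph_eq(3)[OF assms] incident_def)
qed

lemma arrow_edge: "v \<in> interior_idx n \<Longrightarrow> {primal n v, primal n (arrow (directions n C) 1 v)} =
    (if v \<in> C then right_edge n v else down_edge n v)"
  by (cases v) (auto simp: arrow_def directions_def interior_idx_def right_edge_def down_edge_def)

lemma tree_eq:
  assumes "0 < n"
  shows "tree n C = side_edges n \<union> choice n C"
proof -
  let ?f = "\<lambda>v. {primal n v, primal n (arrow (directions n C) 1 v)}"
  let ?A = "primal_idx n - {(int n, 0)}"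
  have "?A = interior_idx n \<union> (?A - interior_idx n)" using interior_subset_primal_idx by (auto simp: interior_idx_def)
  then have "tree n C = ?f ` interior_idx n \<union> ?f ` (?A - interior_idx n)" unfolding tree_def by (metis image_Un)
  also have "?f ` interior_idx n = choice n C" unfolding choice_def by (intro image_cong arrow_edge refl)
  also have "?f ` (?A - interior_idx n) = side_edges n"
  proof
    show "?f ` (?A - interior_idx n) \<subseteq> side_edges n"
    proof
      fix e assume "e \<in> ?f ` (?A - interior_idx n)"
      then obtain i j where e: "e = ?f (i, j)"
        and v: "(i, j) \<in> primal_idx n" "(i, j) \<notin> interior_idx n" "(i, j) \<noteq> (int n, 0)" by auto
      let ?w = "arrow (directions n C) 1 (i, j)"
      have "{primal n (i, j), primal n ?w} \<in> edges (primal_graph n)"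
        unfolding primal_graph_eq[OF assms] using arrow_primal[OF v(1,3)] v by blast
      moreover have "?w \<notin> interior_idx n" using v by (auto simp: arrow_def directions_def interior_idx_def primal_idx_def)
      then have "{primal n (i, j), primal n ?w} \<subseteq> sides n"
        using v arrow_primal[OF v(1,3)] unfolding sides_eq(3)[OF assms] by blast
      ultimately show "e \<in> side_edges n"
        unfolding e side_edges_eq[OF assms] using incident_not_sides[OF assms] by blast
    qed
    show "side_edges n \<subseteq> ?f ` (?A - interior_idx n)"
    proof
      fix e assume e: "e \<in> side_edges n"
      then obtain v w where vw: "e = {primal n v, primal n w}" "v \<in> primal_idx n" "w \<in> primal_idx n" "adjacent v w"
        unfolding side_edges_def primal_graph_eq[OF assms] by blast
      have ni: "e \<notin> incident n (interior_idx n)" using e unfolding side_edges_eq[OF assms] by blast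
      from vw(4) show "e \<in> ?f ` (?A - interior_idx n)"
      proof (cases rule: adjacent_edge[where n = n])
        case (1 u)
        have u: "u \<in> primal_idx n" "(fst u + 1, snd u) \<in> primal_idx n" using 1(2) vw by (auto simp: doubleton_eq_iff)
        have "u \<notin> interior_idx n" using ni 1 vw(1) by (auto simp: incident_def)
        then have "snd u = 0" "fst u < int n" using u by (auto simp: primal_idx_def interior_idx_def)
        then have "?f u = e" using u unfolding vw(1) 1(1)
          by (cases u) (simp add: arrow_def directions_def right_edge_def primal_idx_def)
        then show ?thesis using u \<open>u \<notin> interior_idx n\<close> \<open>fst u < int n\<close> by (intro image_eqI[of _ _ u]) auto
      next
        case (2 u)
        have u: "u \<in> primal_idx n" "(fst u, snd u - 1) \<in> primal_idx n" using 2(2) vw by (auto simp: doubleton_eq_iff)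
        have "u \<notin> interior_idx n" using ni 2 vw(1) by (auto simp: incident_def)
        then have "fst u = int n" "0 < snd u" using u by (auto simp: primal_idx_def interior_idx_def)
        then have "?f u = e" using u unfolding vw(1) 2(1)
          by (cases u) (simp add: arrow_def directions_def down_edge_def primal_idx_def)
        then show ?thesis using u \<open>u \<notin> interior_idx n\<close> \<open>0 < snd u\<close> by (intro image_eqI[of _ _ u]) auto
      qed
    qed
  qed
  finally show ?thesis by blast
qed

lemma choice_subset: "choice n C \<subseteq> incident n (interior_idx n)"
  by (auto simp: choice_def incident_def)

lemma choice_spanning:
  assumes "0 < n"
  shows "choice n C \<in> spanning_trees (contracted_graph n)"
proof -
  let ?r = "(int n, 0) :: int \<times> int"
  let ?A = "insert ?r (interior_idx n)"
  define g where "g v = block (sides n) (primal n v)" for v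
  define p where "p v = (let w = arrow (directions n C) 1 v in if w \<in> interior_idx n then w else ?r)" for v
  let ?f = "\<lambda>v. {primal n v, primal n (arrow (directions n C) 1 v)}"
  have r: "?r \<in> primal_idx n" "?r \<notin> interior_idx n" using assms by (auto simp: primal_idx_def interior_idx_def)
  have gr: "g v = sides n" if "v \<in> primal_idx n" "v \<notin> interior_idx n" for v
    unfolding g_def by (rule block_sides(2)[OF assms that])
  have gi: "g v = {primal n v}" if "v \<in> interior_idx n" for v unfolding g_def by (rule block_sides(1)[OF assms that])
  have ne: "sides n \<noteq> {primal n v}" if "v \<in> interior_idx n" for v
  proof -
    have "primal n ?r \<in> sides n" using r unfolding sides_eq(3)[OF assms] by blast
    moreover have "primal n ?r \<noteq> primal n v" using inj_primal[OF assms] r that by (metis injD)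
    ultimately show ?thesis by blast
  qed
  have "?f ` (?A - {?r}) \<in> spanning_trees (contracted_graph n)"
  proof (rule rooted_spanning_tree[where g = g and p = p and rank = "\<lambda>v. nat (int n - fst v + snd v)"])
    show "inj_on g ?A"
    proof (rule inj_onI)
      fix x y assume xy: "x \<in> ?A" "y \<in> ?A" "g x = g y"
      consider "x = y" | "x = ?r" "y \<in> interior_idx n" | "x \<in> interior_idx n" "y = ?r" | "x \<in> interior_idx n" "y \<in> interior_idx n"
        using xy(1,2) by blast
      then show "x = y"
      proof cases
        case 2
        show ?thesis using xy(3) gr[OF r] gi[OF 2(2)] ne[OF 2(2)] 2(1) by simp
      next
        case 3
        show ?thesis using xy(3)[symmetric] gr[OF r] gi[OF 3(1)] ne[OF 3(1)] 3(2) by simp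
      next
        case 4
        then have "primal n x = primal n y" using xy(3) gi[OF 4(1)] gi[OF 4(2)] by simp
        then show ?thesis using inj_primal[OF assms] by (simp only: inj_eq)
      qed simp
    qed
    show "verts (contracted_graph n) = g ` ?A"
      unfolding contracted_graph_eq[OF assms] using gr[OF r] gi by simp
    fix v assume "v \<in> ?A" "v \<noteq> ?r"
    then have v: "v \<in> interior_idx n" "v \<in> primal_idx n" "v \<noteq> ?r" using interior_subset_primal_idx by auto
    let ?w = "arrow (directions n C) 1 v"
    note w = arrow_primal[OF v(2,3), of C]
    have "g (p v) = block (sides n) (primal n ?w)"
      using gr[OF r] gr[OF w(1)] by (auto simp: p_def Let_def g_def)
    then have "ends (contracted_graph n) (?f v) = {g v, g (p v)}"
      unfolding contracted_graph_eq[OF assms] by (simp add: g_def)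
    moreover have "?f v \<in> edges (contracted_graph n)"
      unfolding contracted_graph_eq[OF assms] arrow_edge[OF v(1)] using v(1) by (auto simp: incident_def)
    moreover have "nat (int n - fst (p v) + snd (p v)) < nat (int n - fst v + snd v)"
      using w(3) v(1) by (auto simp: p_def Let_def interior_idx_def)
    ultimately show "p v \<in> ?A \<and> nat (int n - fst (p v) + snd (p v)) < nat (int n - fst v + snd v) \<and>
        ?f v \<in> edges (contracted_graph n) \<and> ends (contracted_graph n) (?f v) = {g v, g (p v)}"
      by (auto simp: p_def Let_def)
  qed simp
  also have "?f ` (?A - {?r}) = choice n C"
    unfolding choice_def using r(2) by (intro image_cong arrow_edge) auto
  finally show ?thesis .
qed

lemma choice_iff:
  assumes "0 < n" "v \<in> interior_idx n"
  shows "right_edge n v \<in> choice n C \<longleftrightarrow> v \<in> C" "down_edge n v \<in> choice n C \<longleftrightarrow> v \<notin> C"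
  using assms(2) edge_inj[OF assms(1)] unfolding choice_def image_iff by (metis+)

lemma unif_variance_const:
  assumes "\<And>e. e \<in> E \<Longrightarrow> f e = c"
  shows "unif_variance E f = 0"
proof -
  have "unif_mean E f = c" if "E \<noteq> {}" "finite E"
    using that assms by (simp add: unif_mean_def)
  then have "f e = unif_mean E f" if "e \<in> E" "finite E" for e using that assms by auto
  then have "(\<Sum>e\<in>E. (f e - unif_mean E f)\<^sup>2) = 0" by (cases "finite E") auto
  then show ?thesis unfolding unif_variance_def unif_mean_def[of E "\<lambda>e. (f e - unif_mean E f)\<^sup>2"] by simp
qed

text \<open>
  Every edge belongs to exactly one of a configuration and its opposite.
\<close>

lemma edge_prob_coin:
  assumes "0 < n" "e \<in> incident n (interior_idx n)"
  shows "edge_prob (pmf_of_set {choice n C, choice n (interior_idx n - C)}) e = 1 / 2"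
proof -
  obtain v where v: "v \<in> interior_idx n" "e = right_edge n v \<or> e = down_edge n v" using assms(2) by (auto simp: incident_def)
  have "right_edge n v \<in> choice n C \<longleftrightarrow> right_edge n v \<notin> choice n (interior_idx n - C)"
    using choice_iff[OF assms(1) v(1)] v(1) by auto
  then have ne: "choice n C \<noteq> choice n (interior_idx n - C)" by auto
  have "e \<in> choice n C \<longleftrightarrow> e \<notin> choice n (interior_idx n - C)"
    using choice_iff[OF assms(1) v(1)] v by auto
  then have "{choice n C, choice n (interior_idx n - C)} \<inter> {T. e \<in> T} = {choice n C} \<or>
      {choice n C, choice n (interior_idx n - C)} \<inter> {T. e \<in> T} = {choice n (interior_idx n - C)}" by auto
  then have "card ({choice n C, choice n (interior_idx n - C)} \<inter> {T. e \<in> T}) = 1" by (metis card_1_singleton_iff One_nat_def)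
  then show ?thesis using ne by (simp add: edge_prob_def measure_pmf_of_set)
qed

lemma fair_coin:
  assumes "0 < n"
  shows "fair_pmf (contracted_graph n) (pmf_of_set {choice n C, choice n (interior_idx n - C)})"
    "unif_variance (edges (contracted_graph n)) (edge_prob (pmf_of_set {choice n C, choice n (interior_idx n - C)})) = 0"
proof -
  show var: "unif_variance (edges (contracted_graph n)) (edge_prob (pmf_of_set {choice n C, choice n (interior_idx n - C)})) = 0"
    by (rule unif_variance_const[of _ _ "1 / 2"]) (simp add: edge_prob_coin[OF assms] contracted_graph_eq[OF assms])
  have "unif_variance E f \<ge> 0" for E :: "complex set set" and f
    unfolding unif_variance_def unif_mean_def[of E "\<lambda>e. (f e - unif_mean E f)\<^sup>2"] by (simp add: sum_nonneg)
  then show "fair_pmf (contracted_graph n) (pmf_of_set {choice n C, choice n (interior_idx n - C)})"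
    unfolding fair_pmf_def var using choice_spanning[OF assms] by (simp add: set_pmf_of_set)
qed

lemma card_incident:
  assumes "0 < n" "finite S"
  shows "card (incident n S) = 2 * card S"
proof -
  have "inj_on (right_edge n) S" "inj_on (down_edge n) S" using edge_inj[OF assms(1)] by (auto simp: inj_on_def)
  moreover have "right_edge n ` S \<inter> down_edge n ` S = {}" using edge_inj[OF assms(1)] by auto
  ultimately show ?thesis using assms(2) by (simp add: incident_def card_Un_disjoint card_image)
qed

lemma block_in_verts:
  assumes "0 < n" "v \<in> primal_idx n"
  shows "block (sides n) (primal n v) \<in> verts (contracted_graph n)"
  using block_sides[OF assms(1), of v] assms(2) unfolding contracted_graph_eq[OF assms(1)]
  by (cases "v \<in> interior_idx n") auto

text \<open>
  Every vertex of \<open>S\<close> has its own parent edge in the tree, and this edge is the right edge or the down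
  edge of a vertex of \<open>S\<close>, since \<open>S\<close> is closed towards the upper left.
\<close>

lemma card_incident_tree_ge:
  assumes "0 < n" and T: "T \<in> spanning_trees (contracted_graph n)" and S: "S \<subseteq> interior_idx n"
    and closed: "\<And>u w. u \<in> S \<Longrightarrow> w \<in> interior_idx n \<Longrightarrow> fst w \<le> fst u \<Longrightarrow> snd u \<le> snd w \<Longrightarrow> w \<in> S"
  shows "card S \<le> card (incident n S \<inter> T)"
proof -
  let ?G = "contracted_graph n"
  have TE: "T \<subseteq> incident n (interior_idx n)" and conn: "connected_by ?G T"
    using T unfolding spanning_trees_def contracted_graph_eq[OF assms(1)] by auto
  have root: "sides n \<in> verts ?G" by (simp add: contracted_graph_eq[OF assms(1)])
  have ends: "ends ?G e \<subseteq> verts ?G" if e: "e \<in> T" for e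
  proof -
    have "e \<in> edges (primal_graph n)" using e TE incident_edges[OF assms(1)] by (auto simp: incident_def)
    then have "e \<subseteq> primal n ` primal_idx n" by (auto simp: primal_graph_eq[OF assms(1)])
    then show ?thesis unfolding contracted_graph_eq(3)[OF assms(1)]
      using block_in_verts[OF assms(1)] by blast
  qed
  obtain f p and rank :: "complex set \<Rightarrow> nat" where p: "\<And>x. x \<in> verts ?G \<Longrightarrow> x \<noteq> sides n \<Longrightarrow>
       f x \<in> T \<and> p x \<in> verts ?G \<and> rank (p x) < rank x \<and> ends ?G (f x) = {x, p x}"
    using connected_by_parents[OF conn root ends] by blast
  define x where "x u = {primal n u}" for u
  have x: "x u \<in> verts ?G" "x u \<noteq> sides n" if "u \<in> interior_idx n" for u
  proof -
    show "x u \<in> verts ?G" using that by (auto simp: x_def contracted_graph_eq[OF assms(1)])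
    have "primal n u \<notin> sides n"
      using that inj_primal[OF assms(1)] by (auto simp: sides_eq(3)[OF assms(1)] inj_image_mem_iff)
    then show "x u \<noteq> sides n" by (auto simp: x_def)
  qed
  have "inj_on f (x ` S)"
  proof (rule inj_on_rooted_edges[where p = p and rank = rank and G = ?G])
    fix y assume "y \<in> x ` S"
    then obtain u where u: "u \<in> interior_idx n" "y = x u" using S by blast
    then show "rank (p y) < rank y \<and> ends ?G (f y) = {y, p y}" using p[OF x[OF u(1)]] by simp
  qed
  moreover have "inj_on x S" by (rule inj_onI) (simp add: x_def inj_eq[OF inj_primal[OF assms(1)]])
  ultimately have "card S = card (f ` x ` S)" by (simp add: card_image)
  also have "\<dots> \<le> card (incident n S \<inter> T)"
  proof (rule card_mono)
    have "finite (incident n (interior_idx n))" by (simp add: incident_def interior_idx_def)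
    then show "finite (incident n S \<inter> T)" using TE finite_subset by blast
    show "f ` x ` S \<subseteq> incident n S \<inter> T"
    proof (clarify)
      fix u assume u: "u \<in> S"
      then have ui: "u \<in> interior_idx n" using S by blast
      have fT: "f (x u) \<in> T" and "x u \<in> block (sides n) ` f (x u)"
        using p[OF x[OF ui]] by (simp_all add: contracted_graph_eq(3)[OF assms(1)])
      then obtain z where z: "z \<in> f (x u)" "block (sides n) z = x u" by auto
      have zu: "z = primal n u"
        using z(2) x(2)[OF ui] by (auto simp: block_def x_def split: if_splits)
      obtain w where w: "w \<in> interior_idx n" "f (x u) = right_edge n w \<or> f (x u) = down_edge n w"
        using fT TE by (auto simp: incident_def)
      have "u = w \<or> u = (fst w + 1, snd w) \<or> u = (fst w, snd w - 1)"
        using z(1) w(2) unfolding zu by (auto simp: mem_edge[OF assms(1)])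
      then have "w \<in> S" using closed[OF u w(1)] by auto
      then show "f (x u) \<in> incident n S \<inter> T" using fT w(2) by (auto simp: incident_def)
    qed
  qed
  finally show ?thesis .
qed

lemma edge_prob_sum:
  assumes "finite S" "set_pmf \<mu> \<subseteq> S"
  shows "edge_prob \<mu> e = (\<Sum>T\<in>S. pmf \<mu> T * of_bool (e \<in> T))"
proof -
  have "edge_prob \<mu> e = measure_pmf.prob \<mu> ({T. e \<in> T} \<inter> S)"
    unfolding edge_prob_def using assms(2)
    by (intro measure_pmf.finite_measure_eq_AE) (auto simp: AE_measure_pmf_iff)
  also have "\<dots> = (\<Sum>T\<in>{T. e \<in> T} \<inter> S. pmf \<mu> T)"
    using assms(1) by (intro measure_measure_pmf_finite) auto
  also have "\<dots> = (\<Sum>T\<in>S. if e \<in> T then pmf \<mu> T else 0)"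
    using sum.inter_restrict[OF assms(1), of "pmf \<mu>" "{T. e \<in> T}"] by (simp add: Int_commute)
  also have "\<dots> = (\<Sum>T\<in>S. pmf \<mu> T * of_bool (e \<in> T))" by (intro sum.cong) auto
  finally show ?thesis .
qed

text \<open>
  Both sides are the expected number of edges of a random tree in \<open>F\<close>.
\<close>

lemma sum_edge_prob:
  assumes "finite S" "set_pmf \<mu> \<subseteq> S" "finite F"
  shows "(\<Sum>e\<in>F. edge_prob \<mu> e) = (\<Sum>T\<in>S. pmf \<mu> T * real (card (F \<inter> T)))"
proof -
  have "(\<Sum>e\<in>F. edge_prob \<mu> e) = (\<Sum>T\<in>S. \<Sum>e\<in>F. pmf \<mu> T * of_bool (e \<in> T))"
    unfolding edge_prob_sum[OF assms(1,2)] by (rule sum.swap)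
  also have "\<dots> = (\<Sum>T\<in>S. pmf \<mu> T * real (card (F \<inter> T)))"
    using assms(3) by (simp add: sum_distrib_left[symmetric] of_bool_def sum.inter_restrict[symmetric])
  finally show ?thesis .
qed

text \<open>
  Since variance 0 is possible, all edges have the same probability. The sum of these probabilities is the
  number of edges of a spanning tree, which is the number of interior vertices and half the number of all edges.
\<close>

lemma fair_imp_edge_prob_half:
  assumes "0 < n" and fair: "fair_pmf (contracted_graph n) \<mu>" and e: "e \<in> incident n (interior_idx n)"
  shows "edge_prob \<mu> e = 1 / 2"
proof -
  let ?G = "contracted_graph n" and ?E = "incident n (interior_idx n)"
  have finE: "finite ?E" by (simp add: incident_def interior_idx_def)
  have E: "edges ?G = ?E" by (rule contracted_graph_eq(2)[OF assms(1)])
  have N: "card ?E = 2 * card (interior_idx n)" by (rule card_incident[OF assms(1)]) (simp add: interior_idx_def)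
  have pos: "0 < card (interior_idx n)" using e finE N by (metis card_gt_0_iff empty_iff mult_0_right neq0_conv)
  let ?m = "unif_mean ?E (edge_prob \<mu>)"
  have "unif_variance ?E (edge_prob \<mu>) \<le> 0"
    using fair fair_coin[OF assms(1), of "{}"] unfolding fair_pmf_def E by metis
  then have "(\<Sum>e\<in>?E. (edge_prob \<mu> e - ?m)\<^sup>2) \<le> 0"
    using N pos by (simp add: unif_variance_def unif_mean_def[of ?E "\<lambda>e. (edge_prob \<mu> e - ?m)\<^sup>2"] divide_le_0_iff)
  then have "(\<Sum>e\<in>?E. (edge_prob \<mu> e - ?m)\<^sup>2) = 0" by (simp add: sum_nonneg antisym)
  then have const: "edge_prob \<mu> e = ?m" if "e \<in> ?E" for e
    using that finE by (simp add: sum_nonneg_eq_0_iff)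
  let ?S = "spanning_trees ?G"
  have S: "finite ?S" "set_pmf \<mu> \<subseteq> ?S"
    using fair finE unfolding fair_pmf_def spanning_trees_def E by auto
  have card: "card (?E \<inter> T) = card (interior_idx n)" if T: "T \<in> ?S" for T
  proof -
    have "T \<subseteq> ?E" using T unfolding spanning_trees_def E by auto
    then have "card (?E \<inter> T) = card T" by (simp add: Int_absorb1)
    also have "\<dots> = card (verts ?G) - 1"
    proof (rule card_spanning_tree[OF T])
      show "sides n \<in> verts ?G" "finite (verts ?G)" by (simp_all add: contracted_graph_eq[OF assms(1)] interior_idx_def)
      fix e assume "e \<in> edges ?G"
      then have "e \<in> edges (primal_graph n)" using incident_edges[OF assms(1)] by (auto simp: E incident_def)
      then obtain v w where vw: "e = {primal n v, primal n w}" "v \<in> primal_idx n" "w \<in> primal_idx n"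
        unfolding primal_graph_eq[OF assms(1)] by blast
      then show "\<exists>u\<in>verts ?G. \<exists>v\<in>verts ?G. ends ?G e = {u, v}"
        using block_in_verts[OF assms(1) vw(2)] block_in_verts[OF assms(1) vw(3)]
        unfolding contracted_graph_eq(3)[OF assms(1)] vw(1) image_insert image_empty by blast
    qed
    also have "card (verts ?G) = Suc (card (interior_idx n))"
    proof -
      have "sides n \<notin> (\<lambda>v. {primal n v}) ` interior_idx n"
      proof
        assume "sides n \<in> (\<lambda>v. {primal n v}) ` interior_idx n"
        then obtain v where "v \<in> interior_idx n" "sides n = {primal n v}" by blast
        then show False using inj_primal[OF assms(1)] unfolding sides_eq(3)[OF assms(1)]
          by (metis DiffD2 inj_image_mem_iff insertI1)
      qed
      moreover have "inj_on (\<lambda>v. {primal n v}) (interior_idx n)" by (rule inj_onI) (simp add: inj_eq[OF inj_primal[OF assms(1)]])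
      ultimately show ?thesis by (simp add: contracted_graph_eq[OF assms(1)] card_image interior_idx_def)
    qed
    finally show ?thesis by simp
  qed
  have "2 * real (card (interior_idx n)) * ?m = (\<Sum>e\<in>?E. edge_prob \<mu> e)" using const N by simp
  also have "\<dots> = (\<Sum>T\<in>?S. pmf \<mu> T * real (card (interior_idx n)))"
    unfolding sum_edge_prob[OF S finE] using card by simp
  also have "\<dots> = real (card (interior_idx n))" using sum_pmf_eq_1[OF S] by (simp flip: sum_distrib_right)
  finally show ?thesis using const[OF e] pos by simp
qed

lemma fair_imp_one_of_two:
  assumes "0 < n" and fair: "fair_pmf (contracted_graph n) \<mu>" and T: "T \<in> set_pmf \<mu>" and v: "v \<in> interior_idx n"
  shows "right_edge n v \<in> T \<longleftrightarrow> down_edge n v \<notin> T"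
proof -
  let ?G = "contracted_graph n" and ?E = "incident n (interior_idx n)"
  let ?S = "spanning_trees ?G"
  have finE: "finite ?E" by (simp add: incident_def interior_idx_def)
  have S: "finite ?S" "set_pmf \<mu> \<subseteq> ?S"
    using fair finE unfolding fair_pmf_def spanning_trees_def contracted_graph_eq(2)[OF assms(1)] by auto
  have tight: "card (incident n U \<inter> T) = card U" if U: "U \<subseteq> interior_idx n"
    and closed: "\<And>u w. u \<in> U \<Longrightarrow> w \<in> interior_idx n \<Longrightarrow> fst w \<le> fst u \<Longrightarrow> snd u \<le> snd w \<Longrightarrow> w \<in> U" for U
  proof -
    have finU: "finite U" using U by (rule finite_subset) (simp add: interior_idx_def)
    have sub: "incident n U \<subseteq> ?E" using U by (auto simp: incident_def)
    have finI: "finite (incident n U)" using finU by (simp add: incident_def)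
    have "(\<Sum>e\<in>incident n U. edge_prob \<mu> e) = real (card U)"
    proof -
      have "(\<Sum>e\<in>incident n U. edge_prob \<mu> e) = (\<Sum>e\<in>incident n U. 1 / 2)"
        using fair_imp_edge_prob_half[OF assms(1) fair] sub by (intro sum.cong) auto
      then show ?thesis using card_incident[OF assms(1) finU] by simp
    qed
    then have "(\<Sum>T\<in>?S. pmf \<mu> T * real (card (incident n U \<inter> T))) = (\<Sum>T\<in>?S. pmf \<mu> T * real (card U))"
      unfolding sum_edge_prob[OF S finI] using sum_pmf_eq_1[OF S] by (simp flip: sum_distrib_right)
    then have "(\<Sum>T\<in>?S. pmf \<mu> T * (real (card (incident n U \<inter> T)) - real (card U))) = 0"
      by (simp add: right_diff_distrib sum_subtractf)
    moreover have "0 \<le> pmf \<mu> T * (real (card (incident n U \<inter> T)) - real (card U))" if "T \<in> ?S" for T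
      using card_incident_tree_ge[OF assms(1) that U closed] by (intro mult_nonneg_nonneg) auto
    ultimately have "pmf \<mu> T * (real (card (incident n U \<inter> T)) - real (card U)) = 0"
      using S T sum_nonneg_eq_0_iff[OF S(1), of "\<lambda>T. pmf \<mu> T * (real (card (incident n U \<inter> T)) - real (card U))"] by blast
    moreover have "pmf \<mu> T \<noteq> 0" using T by (simp add: set_pmf_iff)
    ultimately show ?thesis by simp
  qed
  \<comment> \<open>Passing from the upper left quadrant of \<open>v\<close> to the quadrant without \<open>v\<close> loses one vertex and just
    the two edges of \<open>v\<close>.\<close>
  define U where "U = {w \<in> interior_idx n. fst w \<le> fst v \<and> snd v \<le> snd w}"
  let ?I = "incident n (U - {v})" and ?P = "{right_edge n v, down_edge n v}"
  have vU: "v \<in> U" "finite U" using v by (auto simp: U_def interior_idx_def)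
  have c: "card (incident n U \<inter> T) = card U" by (rule tight) (auto simp: U_def)
  have c': "card (?I \<inter> T) = card (U - {v})" by (rule tight) (auto simp: U_def prod_eq_iff)
  have "incident n U = ?I \<union> ?P" using vU by (auto simp: incident_def)
  then have split: "incident n U \<inter> T = (?I \<inter> T) \<union> (?P \<inter> T)" by blast
  have "?I \<inter> ?P = {}"
    by (auto simp: incident_def edge_inj[OF assms(1)] edge_inj(3)[OF assms(1), THEN not_sym])
  then have "card ((?I \<inter> T) \<union> (?P \<inter> T)) = card (?I \<inter> T) + card (?P \<inter> T)"
    using vU(2) by (intro card_Un_disjoint) (auto simp: incident_def)
  then have "card U = card (?I \<inter> T) + card (?P \<inter> T)" by (simp only: split[symmetric] c)
  moreover have "Suc (card (U - {v})) = card U" by (rule card_Suc_Diff1[OF vU(2,1)])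
  ultimately have "card (?P \<inter> T) = 1" using c' by linarith
  then show ?thesis using edge_inj(3)[OF assms(1), of v v] by (auto simp: card_1_singleton_iff)
qed

lemma fair_trees_contracted:
  assumes "0 < n"
  shows "fair_trees (contracted_graph n) = choice n ` Pow (interior_idx n)"
proof
  show "fair_trees (contracted_graph n) \<subseteq> choice n ` Pow (interior_idx n)"
  proof
    fix T assume "T \<in> fair_trees (contracted_graph n)"
    then obtain \<mu> where \<mu>: "fair_pmf (contracted_graph n) \<mu>" "T \<in> set_pmf \<mu>" unfolding fair_trees_def by blast
    have TE: "T \<subseteq> incident n (interior_idx n)"
      using \<mu> unfolding fair_pmf_def spanning_trees_def contracted_graph_eq(2)[OF assms] by auto
    note one = fair_imp_one_of_two[OF assms \<mu>]
    have "T = choice n {v \<in> interior_idx n. right_edge n v \<in> T}"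
    proof
      show "T \<subseteq> choice n {v \<in> interior_idx n. right_edge n v \<in> T}"
      proof
        fix e assume e: "e \<in> T"
        then obtain v where "v \<in> interior_idx n" "e = right_edge n v \<or> e = down_edge n v" using TE by (auto simp: incident_def)
        then show "e \<in> choice n {v \<in> interior_idx n. right_edge n v \<in> T}"
          using choice_iff[OF assms, of v] one[of v] e by auto
      qed
      show "choice n {v \<in> interior_idx n. right_edge n v \<in> T} \<subseteq> T"
        using one by (auto simp: choice_def)
    qed
    then show "T \<in> choice n ` Pow (interior_idx n)" by blast
  qed
  show "choice n ` Pow (interior_idx n) \<subseteq> fair_trees (contracted_graph n)"
    using fair_coin(1)[OF assms] by (force simp: fair_trees_def set_pmf_of_set)
qed

lemma fair_lattice_trees_eq:
  assumes "0 < n"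
  shows "fair_lattice_trees n = tree n ` Pow (interior_idx n)"
proof -
  have int: "tree n C \<inter> incident n (interior_idx n) = choice n C" for C
    unfolding tree_eq[OF assms] side_edges_eq[OF assms] using choice_subset by blast
  show ?thesis
  proof
    show "fair_lattice_trees n \<subseteq> tree n ` Pow (interior_idx n)"
    proof
      fix T assume "T \<in> fair_lattice_trees n"
      then have T: "T \<subseteq> edges (primal_graph n)" "side_edges n \<subseteq> T"
        "T \<inter> incident n (interior_idx n) \<in> choice n ` Pow (interior_idx n)"
        unfolding fair_lattice_trees_def spanning_trees_def contracted_graph_eq(2)[OF assms] fair_trees_contracted[OF assms] by auto
      then obtain C where C: "C \<in> Pow (interior_idx n)" "T \<inter> incident n (interior_idx n) = choice n C" by blast
      have "T = side_edges n \<union> (T \<inter> incident n (interior_idx n))"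
        using T(1,2) unfolding side_edges_eq[OF assms] by blast
      then show "T \<in> tree n ` Pow (interior_idx n)" using C tree_eq[OF assms] by auto
    qed
    show "tree n ` Pow (interior_idx n) \<subseteq> fair_lattice_trees n"
      using tree_spanning[OF assms] int tree_eq[OF assms]
      unfolding fair_lattice_trees_def contracted_graph_eq(2)[OF assms] fair_trees_contracted[OF assms] by auto
  qed
qed

section \<open>Counting configurations with deviating branches\<close>

text \<open>
  This is Hoeffding's lemma for a fair sign.
\<close>

lemma cosh_le_exp_half_square: "(exp l + exp (- l)) / 2 \<le> exp (l\<^sup>2 / 2)" for l :: real
proof -
  have pos: "(exp l + exp (- l)) / 2 \<le> exp (l\<^sup>2 / 2)" if "l > 0" for l :: real
  proof -
    have "- (2 * l) * (1/2) + ln (1 + 1/2 * (exp (2 * l) - 1)) \<le> (2 * l)\<^sup>2 / 8"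
      using Hoeffdings_lemma_aux[of "2 * l" "1/2"] that by simp
    then have L: "- l + ln ((1 + exp (2 * l)) / 2) \<le> l\<^sup>2 / 2" by (simp add: field_simps)
    have "(exp l + exp (- l)) / 2 = exp (- l) * ((1 + exp (2 * l)) / 2)"
      by (simp add: distrib_left flip: exp_add)
    also have "\<dots> = exp (- l + ln ((1 + exp (2 * l)) / 2))"
      by (subst exp_add, subst exp_ln) (auto intro: add_pos_pos)
    also have "\<dots> \<le> exp (l\<^sup>2 / 2)" using L by (simp only: exp_le_cancel_iff)
    finally show ?thesis .
  qed
  show ?thesis using pos[of l] pos[of "- l"] by (cases l "0::real" rule: linorder_cases) (auto simp: add.commute)
qed

lemma sum_Pow_insert:
  fixes F :: "'a set \<Rightarrow> 'b::comm_monoid_add"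
  assumes "finite J" "v \<notin> J"
  shows "(\<Sum>C\<in>Pow (insert v J). F C) = (\<Sum>C\<in>Pow J. F C + F (insert v C))"
proof -
  have "inj_on (insert v) (Pow J)" using assms(2) by (auto simp: inj_on_def)
  moreover have "Pow J \<inter> insert v ` Pow J = {}" using assms(2) by auto
  ultimately show ?thesis
    using assms(1) by (simp add: Pow_insert sum.union_disjoint sum.reindex sum.distrib)
qed

lemma finite_interior_idx [simp]: "finite (interior_idx n)" by (simp add: interior_idx_def)

text \<open>
  Along a branch the difference of the two coordinates changes strictly monotonically, so that a
  branch never returns to a vertex whose arrow it has used.
\<close>

lemma walk_insert:
  assumes "\<sigma> \<in> {1, - 1}" "\<sigma> * (fst v - snd v) < \<sigma> * (fst w - snd w)"
  shows "walk (arrow (directions n (insert v C)) \<sigma>) A k w = walk (arrow (directions n C) \<sigma>) A k w"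
  using assms(2)
proof (induction k arbitrary: w)
  case (Suc k)
  obtain i j where w: "w = (i, j)" by fastforce
  have "v \<noteq> w" using Suc.prems by auto
  then have eq: "arrow (directions n (insert v C)) \<sigma> w = arrow (directions n C) \<sigma> w"
    by (auto simp: w arrow_def directions_def)
  have "\<sigma> * (fst (arrow (directions n C) \<sigma> w) - snd (arrow (directions n C) \<sigma> w)) = \<sigma> * (fst w - snd w) + 1"
    using assms(1) by (auto simp: w arrow_def)
  then show ?case using Suc.IH[of "arrow (directions n C) \<sigma> w"] Suc.prems eq by simp
qed simp

text \<open>
  One step at a time: the walk after the first step does not depend on the coin at its starting point, so
  averaging over this coin contributes a factor of at most \<open>cosh l\<close>.
\<close>

lemma exp_moment_walk:
  fixes l :: real
  assumes \<sigma>: "\<sigma> \<in> {1, - 1}"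
  shows "(\<Sum>C\<in>Pow (interior_idx n). exp (l * (level (walk (arrow (directions n C) \<sigma>) (interior_idx n) k v) - level v)))
    \<le> 2 ^ card (interior_idx n) * exp (l\<^sup>2 / 2) ^ k"
proof (induction k arbitrary: v)
  case 0
  show ?case by (simp add: card_Pow)
next
  case (Suc k)
  let ?W = "\<lambda>C k w. walk (arrow (directions n C) \<sigma>) (interior_idx n) k w"
  let ?N = "2 ^ card (interior_idx n) :: real" and ?E = "exp (l\<^sup>2 / 2)"
  show ?case
  proof (cases "v \<in> interior_idx n")
    case False
    then have "(\<Sum>C\<in>Pow (interior_idx n). exp (l * (level (?W C (Suc k) v) - level v))) = ?N" by (simp add: card_Pow)
    also have "\<dots> \<le> ?N * ?E ^ Suc k" using one_le_power[of ?E "Suc k"] by simp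
    finally show ?thesis .
  next
    case True
    obtain i j where v: "v = (i, j)" by fastforce
    define J where "J = interior_idx n - {v}"
    have J: "interior_idx n = insert v J" "v \<notin> J" "finite J" using True by (auto simp: J_def)
    define G where "G w C = exp (l * (level (?W C k w) - level w))" for w C
    let ?up = "(i + \<sigma>, j)" and ?down = "(i, j - \<sigma>)"
    have ij: "1 \<le> i" "i < int n" "1 \<le> j" "j < int n" using True by (auto simp: v interior_idx_def)
    have indep: "G w (insert v C) = G w C" if "w = ?up \<or> w = ?down" for w C
    proof -
      have "\<sigma> * (fst v - snd v) < \<sigma> * (fst w - snd w)" using that \<sigma> by (auto simp: v)
      then show ?thesis unfolding G_def using walk_insert[OF \<sigma>] by simp
    qed
    have half: "2 * (\<Sum>C\<in>Pow J. G w C) \<le> ?N * ?E ^ k" if "w = ?up \<or> w = ?down" for w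
    proof -
      have "2 * (\<Sum>C\<in>Pow J. G w C) = (\<Sum>C\<in>Pow J. G w C + G w (insert v C))"
        by (simp add: indep[OF that] sum_distrib_left)
      also have "\<dots> = (\<Sum>C\<in>Pow (interior_idx n). G w C)" unfolding J(1) by (rule sum_Pow_insert[OF J(3,2), symmetric])
      also have "\<dots> \<le> ?N * ?E ^ k" unfolding G_def by (rule Suc.IH)
      finally show ?thesis .
    qed
    let ?F = "\<lambda>C. exp (l * (level (?W C (Suc k) v) - level v))"
    have F1: "?F (insert v C) = exp (l * \<sigma>) * G ?up C" for C
    proof -
      have "arrow (directions n (insert v C)) \<sigma> v = ?up" using ij by (simp add: v arrow_def directions_def)
      then have "?F (insert v C) = exp (l * \<sigma>) * G ?up (insert v C)"
        using True by (simp add: G_def v algebra_simps flip: exp_add)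
      then show ?thesis by (simp add: indep)
    qed
    have F0: "?F C = exp (l * - \<sigma>) * G ?down C" if "C \<subseteq> J" for C
    proof -
      have "v \<notin> C" using that J(2) by auto
      then have "arrow (directions n C) \<sigma> v = ?down" using ij by (simp add: v arrow_def directions_def)
      then show ?thesis using True by (simp add: G_def v algebra_simps flip: exp_add)
    qed
    have "(\<Sum>C\<in>Pow (interior_idx n). ?F C) = (\<Sum>C\<in>Pow J. ?F C + ?F (insert v C))"
      unfolding J(1) by (rule sum_Pow_insert[OF J(3,2)])
    also have "\<dots> = (\<Sum>C\<in>Pow J. exp (l * - \<sigma>) * G ?down C + exp (l * \<sigma>) * G ?up C)"
      using F0 F1 by (intro sum.cong) auto
    also have "\<dots> = exp (l * - \<sigma>) * (\<Sum>C\<in>Pow J. G ?down C) + exp (l * \<sigma>) * (\<Sum>C\<in>Pow J. G ?up C)"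
      by (simp add: sum.distrib sum_distrib_left)
    also have "\<dots> \<le> exp (l * - \<sigma>) * (?N * ?E ^ k / 2) + exp (l * \<sigma>) * (?N * ?E ^ k / 2)"
      using half[of ?up] half[of ?down] by (intro add_mono mult_left_mono) auto
    also have "\<dots> = ?N * ?E ^ k * ((exp l + exp (- l)) / 2)"
      using \<sigma> by (auto simp: field_simps)
    also have "\<dots> \<le> ?N * ?E ^ k * ?E"
      by (intro mult_left_mono cosh_le_exp_half_square) auto
    also have "?N * ?E ^ k * ?E = ?N * ?E ^ Suc k" by (simp only: power_Suc mult_ac)
    finally show ?thesis .
  qed
qed

text \<open>
  This is the exponential Markov inequality for the counting measure.
\<close>

lemma card_exceed_le:
  fixes f :: "'a \<Rightarrow> real"
  assumes "finite A"
  shows "real (card {C\<in>A. x \<le> f C}) \<le> exp (- x) * (\<Sum>C\<in>A. exp (f C))"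
proof -
  have "real (card {C\<in>A. x \<le> f C}) = (\<Sum>C\<in>{C\<in>A. x \<le> f C}. 1)" by simp
  also have "\<dots> \<le> (\<Sum>C\<in>{C\<in>A. x \<le> f C}. exp (- x) * exp (f C))"
    by (intro sum_mono) (simp flip: exp_add)
  also have "\<dots> \<le> (\<Sum>C\<in>A. exp (- x) * exp (f C))"
    using assms by (intro sum_mono2) auto
  finally show ?thesis by (simp add: sum_distrib_left)
qed

text \<open>
  Union bound over the two kinds of branches, the starting points, the numbers of steps and the signs of the
  deviation.
\<close>

lemma card_not_tame_le:
  fixes x l :: real
  assumes "0 < l"
  shows "real (card {C\<in>Pow (interior_idx n). \<not> tame n \<lfloor>x\<rfloor> C})
    \<le> 4 * real (card (interior_idx n)) * (4 * real n + 1) * (exp (2 * real n * l\<^sup>2 - l * x) * 2 ^ card (interior_idx n))"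
proof -
  define d where "d \<sigma> v k C = real_of_int (level (walk (arrow (directions n C) \<sigma>) (interior_idx n) k v) - level v)" for \<sigma> v k C
  define S where "S = (\<lambda>(s, \<sigma>, v, k). {C\<in>Pow (interior_idx n). l * x \<le> (s * l) * d \<sigma> v k C})"
  define K where "K = {1, - 1 :: real} \<times> {1, - 1 :: int} \<times> interior_idx n \<times> {..4 * n}"
  let ?B = "exp (2 * real n * l\<^sup>2 - l * x) * 2 ^ card (interior_idx n)"
  have "{C\<in>Pow (interior_idx n). \<not> tame n \<lfloor>x\<rfloor> C} \<subseteq> (\<Union>p\<in>K. S p)"
  proof
    fix C assume "C \<in> {C\<in>Pow (interior_idx n). \<not> tame n \<lfloor>x\<rfloor> C}"
    then obtain \<sigma> v k where C: "C \<in> Pow (interior_idx n)" and p: "\<sigma> \<in> {1, - 1}" "v \<in> interior_idx n" "k \<le> 4 * n"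
      "\<lfloor>x\<rfloor> < \<bar>level (walk (arrow (directions n C) \<sigma>) (interior_idx n) k v) - level v\<bar>"
      unfolding tame_def by (auto simp: not_le)
    then have "x < \<bar>d \<sigma> v k C\<bar>" unfolding d_def by (simp add: floor_less_iff del: of_int_diff of_int_add)
    then have "x < 1 * d \<sigma> v k C \<or> x < - 1 * d \<sigma> v k C" by auto
    then obtain s where s: "s \<in> {1, - 1}" "x < s * d \<sigma> v k C" by blast
    then have "l * x \<le> s * l * d \<sigma> v k C" using assms mult_left_mono[of x "s * d \<sigma> v k C" l] by (simp add: mult_ac)
    then have "C \<in> S (s, \<sigma>, v, k)" using C by (simp add: S_def)
    moreover have "(s, \<sigma>, v, k) \<in> K" using p s by (auto simp: K_def)
    ultimately show "C \<in> (\<Union>p\<in>K. S p)" by blast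
  qed
  moreover have fin: "finite K" "\<And>p. finite (S p)" by (auto simp: K_def S_def split: prod.splits)
  ultimately have "card {C\<in>Pow (interior_idx n). \<not> tame n \<lfloor>x\<rfloor> C} \<le> card (\<Union>p\<in>K. S p)"
    by (intro card_mono) auto
  also have "\<dots> \<le> (\<Sum>p\<in>K. card (S p))" using fin by (intro card_UN_le) auto
  finally have "real (card {C\<in>Pow (interior_idx n). \<not> tame n \<lfloor>x\<rfloor> C}) \<le> (\<Sum>p\<in>K. real (card (S p)))"
    unfolding of_nat_sum[symmetric] of_nat_le_iff .
  also have "\<dots> \<le> (\<Sum>p\<in>K. ?B)"
  proof (rule sum_mono)
    fix p assume "p \<in> K"
    then obtain s \<sigma> v k where p: "p = (s, \<sigma>, v, k)" "s \<in> {1, - 1}" "\<sigma> \<in> {1, - 1}" "k \<le> 4 * n"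
      by (auto simp: K_def)
    have "real (card (S p)) \<le> exp (- (l * x)) * (\<Sum>C\<in>Pow (interior_idx n). exp (s * l * d \<sigma> v k C))"
      unfolding p S_def prod.case by (rule card_exceed_le) simp
    also have "\<dots> \<le> exp (- (l * x)) * (2 ^ card (interior_idx n) * exp ((s * l)\<^sup>2 / 2) ^ k)"
      unfolding d_def by (intro mult_left_mono exp_moment_walk p) simp
    also have "\<dots> \<le> exp (- (l * x)) * (2 ^ card (interior_idx n) * exp ((s * l)\<^sup>2 / 2) ^ (4 * n))"
      using p(4) by (intro mult_left_mono power_increasing) auto
    also have "exp ((s * l)\<^sup>2 / 2) ^ (4 * n) = exp (2 * real n * l\<^sup>2)"
      using p(2) by (auto simp: power_mult_distrib simp flip: exp_of_nat_mult)
    also have "exp (- (l * x)) * (2 ^ card (interior_idx n) * exp (2 * real n * l\<^sup>2)) = ?B"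
      by (simp add: exp_diff exp_minus field_simps)
    finally show "real (card (S p)) \<le> ?B" .
  qed
  also have "\<dots> = real (card K) * ?B" by simp
  also have "real (card K) = 4 * real (card (interior_idx n)) * (4 * real n + 1)"
  proof -
    have "card {1, - 1 :: real} = 2" "card {1, - 1 :: int} = 2" by simp_all
    then show ?thesis by (simp only: K_def card_cartesian_product card_atMost) (simp add: algebra_simps)
  qed
  finally show ?thesis .
qed

text \<open>
  With \<open>l = \<delta> / 4\<close> the exponential factor is \<open>exp (- n \<delta>\<^sup>2 / 8)\<close>, which beats the polynomial number of events.
\<close>

lemma fraction_not_tame_tendsto_0:
  fixes \<delta> :: real
  assumes "0 < \<delta>"
  shows "(\<lambda>n. real (card {C\<in>Pow (interior_idx n). \<not> tame n \<lfloor>\<delta> * real n\<rfloor> C}) / 2 ^ card (interior_idx n)) \<longlonglongrightarrow> 0"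
proof (rule tendsto_sandwich[of "\<lambda>_. 0"])
  let ?b = "\<lambda>n. 4 * (real n)\<^sup>2 * (4 * real n + 1) * exp (- (\<delta>\<^sup>2 / 8) * real n)"
  show "?b \<longlonglongrightarrow> 0" using assms by real_asymp
  have "real (card {C\<in>Pow (interior_idx n). \<not> tame n \<lfloor>\<delta> * real n\<rfloor> C}) / 2 ^ card (interior_idx n) \<le> ?b n" for n
  proof -
    have "card (interior_idx n) \<le> n\<^sup>2"
      unfolding interior_idx_def by (cases n) (auto simp: card_cartesian_product power2_eq_square)
    then have N: "real (card (interior_idx n)) \<le> (real n)\<^sup>2" unfolding of_nat_power[symmetric] of_nat_le_iff .
    have "real (card {C\<in>Pow (interior_idx n). \<not> tame n \<lfloor>\<delta> * real n\<rfloor> C})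
      \<le> 4 * real (card (interior_idx n)) * (4 * real n + 1) *
        (exp (2 * real n * (\<delta> / 4)\<^sup>2 - \<delta> / 4 * (\<delta> * real n)) * 2 ^ card (interior_idx n))"
      using assms by (intro card_not_tame_le) auto
    also have "2 * real n * (\<delta> / 4)\<^sup>2 - \<delta> / 4 * (\<delta> * real n) = - (\<delta>\<^sup>2 / 8) * real n"
      by (simp add: power2_eq_square field_simps)
    finally have "real (card {C\<in>Pow (interior_idx n). \<not> tame n \<lfloor>\<delta> * real n\<rfloor> C}) / 2 ^ card (interior_idx n)
      \<le> 4 * real (card (interior_idx n)) * (4 * real n + 1) * exp (- (\<delta>\<^sup>2 / 8) * real n)"
      by (simp add: divide_le_eq mult.assoc)
    also have "\<dots> \<le> ?b n" using N by (intro mult_right_mono mult_left_mono) auto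
    finally show ?thesis .
  qed
  then show "\<forall>\<^sub>F n in sequentially. real (card {C\<in>Pow (interior_idx n). \<not> tame n \<lfloor>\<delta> * real n\<rfloor> C}) / 2 ^ card (interior_idx n) \<le> ?b n"
    by simp
qed simp_all

section \<open>Traces close to the growing triangle\<close>

lemma polyline_ends:
  "xs \<noteq> [] \<Longrightarrow> path (polyline xs) \<and> pathstart (polyline xs) = hd xs \<and> pathfinish (polyline xs) = last xs"
  by (induction xs rule: polyline.induct) auto

text \<open>
  The index of the segment on which a polyline is travelling grows with time. As families
  are taken modulo time changes, the order of the segments contains all that matters about the parameter.
\<close>

lemma polyline_segments:
  assumes "2 \<le> length xs" "0 \<le> s" "s \<le> t" "t \<le> 1"
  shows "\<exists>i j. i \<le> j \<and> Suc j < length xs \<and> polyline xs s \<in> closed_segment (xs ! i) (xs ! Suc i) \<and>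
    polyline xs t \<in> closed_segment (xs ! j) (xs ! Suc j)"
  using assms
proof (induction xs arbitrary: s t rule: polyline.induct)
  case (3 a b)
  then show ?case by (intro exI[of _ 0]) (auto simp: linepath_in_path)
next
  case (4 a b c ps)
  let ?xs = "a # b # c # ps"
  have first: "polyline ?xs x \<in> closed_segment (?xs ! 0) (?xs ! Suc 0)" if "0 \<le> x" "x \<le> 1 / 2" for x
    using that by (auto simp: joinpaths_def intro!: linepath_in_path)
  have rest: "polyline ?xs x = polyline (b # c # ps) (2 * x - 1)" if "1 / 2 < x" for x
    using that by (simp add: joinpaths_def)
  consider "t \<le> 1 / 2" | "s \<le> 1 / 2" "1 / 2 < t" | "1 / 2 < s" by linarith
  then show ?case
  proof cases
    case 1
    then show ?thesis using first[of s] first[of t] "4.prems" by (intro exI[of _ 0]) auto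
  next
    case 2
    then obtain j where "Suc j < length (b # c # ps)"
      "polyline (b # c # ps) (2 * t - 1) \<in> closed_segment ((b # c # ps) ! j) ((b # c # ps) ! Suc j)"
      using "4.IH"[of "2 * t - 1" "2 * t - 1"] "4.prems" by auto
    then show ?thesis using first[of s] rest[of t] 2 "4.prems" 
      by (intro exI[of _ 0] exI[of _ "Suc j"]) auto
  next
    case 3
    then obtain i j where "i \<le> j" "Suc j < length (b # c # ps)"
      "polyline (b # c # ps) (2 * s - 1) \<in> closed_segment ((b # c # ps) ! i) ((b # c # ps) ! Suc i)"
      "polyline (b # c # ps) (2 * t - 1) \<in> closed_segment ((b # c # ps) ! j) ((b # c # ps) ! Suc j)"
      using "4.IH"[of "2 * s - 1" "2 * t - 1"] "4.prems" by auto
    then show ?thesis using rest[of s] rest[of t] 3 "4.prems" 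
      by (intro exI[of _ "Suc i"] exI[of _ "Suc j"]) auto
  qed
qed auto

lemma path_image_polyline:
  "2 \<le> length xs \<Longrightarrow> path_image (polyline xs) = (\<Union>i\<in>{i. Suc i < length xs}. closed_segment (xs ! i) (xs ! Suc i))"
proof (induction xs rule: polyline.induct)
  case (3 a b)
  have "{i. Suc i < length [a, b]} = {0}" by auto
  then show ?case by simp
next
  case (4 a b c ps)
  have "{i. Suc i < length (a # b # c # ps)} = insert 0 (Suc ` {i. Suc i < length (b # c # ps)})"
    by (auto simp: image_iff) (metis Suc_less_eq not0_implies_Suc)
  moreover have "path_image (polyline (a # b # c # ps)) = closed_segment a b \<union> path_image (polyline (b # c # ps))"
    using polyline_ends[of "b # c # ps"] by (simp add: path_image_join)
  ultimately show ?case using 4 by simp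
qed auto

lemma growing_family_trace:
  assumes "path \<zeta>" "path_image \<zeta> \<subseteq> Qbar"
  shows "growing_family (trace \<zeta>)"
proof -
  have "compact (trace \<zeta> t)" if "t \<in> {0..1}" for t
    unfolding trace_def using assms(1) that
    by (intro compact_continuous_image) (auto simp: path_def intro: continuous_on_subset)
  moreover have "trace \<zeta> t \<subseteq> Qbar" if "t \<in> {0..1}" for t
    using assms(2) that unfolding trace_def path_image_def by fastforce
  moreover have "trace \<zeta> t \<noteq> {}" if "t \<in> {0..1}" for t
    using that unfolding trace_def by auto
  ultimately show ?thesis unfolding growing_family_def mono_on_def by (auto simp: trace_def)
qed

text \<open>
  Scaling towards the origin decreases \<open>x + y\<close>, at the cost of moving by at most the amount of the
  decrease.
\<close>

lemma near_triangle:
  assumes "z \<in> Qbar" "0 \<le> c"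
  shows "\<exists>w\<in>Qbar. Re w + Im w \<le> c \<and> dist z w \<le> max 0 (Re z + Im z - c)"
proof (cases "Re z + Im z \<le> c")
  case True
  then show ?thesis using assms by (intro bexI[of _ z]) auto
next
  case False
  define u where "u = Re z + Im z"
  have u: "c < u" using False by (simp add: u_def)
  define w where "w = (c / u) *\<^sub>R z"
  have z: "0 \<le> Re z" "Re z \<le> 1" "0 \<le> Im z" "Im z \<le> 1" using assms by (auto simp: Qbar_def)
  have f: "0 \<le> c / u" "c / u \<le> 1" using u assms by (auto simp: field_simps)
  have "0 \<le> (c / u) * x \<and> (c / u) * x \<le> 1" if "0 \<le> x" "x \<le> 1" for x
    using f that by (intro conjI mult_nonneg_nonneg mult_le_one)
  then have "w \<in> Qbar" using z by (simp add: w_def Qbar_def)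
  moreover have "Re w + Im w = c"
  proof -
    have "Re w + Im w = (c / u) * Re z + (c / u) * Im z" by (simp add: w_def)
    also have "\<dots> = (c / u) * u" by (simp only: u_def distrib_left)
    finally show ?thesis using u assms by simp
  qed
  moreover have "dist z w \<le> u - c"
  proof -
    have "z - w = (1 - c / u) *\<^sub>R z" by (simp add: w_def scaleR_diff_left)
    then have "dist z w = (1 - c / u) * cmod z" using f by (simp add: dist_norm)
    also have "\<dots> \<le> (1 - c / u) * u" using f z cmod_le[of z] by (intro mult_left_mono) (auto simp: u_def)
    also have "\<dots> = u - c" using u assms by (simp add: field_simps)
    finally show ?thesis .
  qed
  ultimately show ?thesis using u by (intro bexI[of _ w]) (auto simp: u_def)
qed

lemma level_diff: "Re z + Im z \<le> Re w + Im w + 2 * dist z w"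
  using abs_Re_le_cmod[of "z - w"] abs_Im_le_cmod[of "z - w"] by (simp add: dist_norm)

definition running_max :: "(real \<Rightarrow> real) \<Rightarrow> real \<Rightarrow> real" where
  "running_max f t = (SUP x\<in>{0..1}. f (t * x))"

text \<open>
  Scaling the argument to the fixed interval \<open>{0..1}\<close> reduces continuity of the maximum to uniform
  continuity of \<open>f\<close>.
\<close>

lemma running_max_props:
  fixes f :: "real \<Rightarrow> real"
  assumes cont: "continuous_on {0..1} f"
  shows "\<And>s t. t \<in> {0..1} \<Longrightarrow> s \<in> {0..t} \<Longrightarrow> f s \<le> running_max f t"
    and "\<And>t c. t \<in> {0..1} \<Longrightarrow> (\<And>s. s \<in> {0..t} \<Longrightarrow> f s \<le> c) \<Longrightarrow> running_max f t \<le> c"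
    and "continuous_on {0..1} (running_max f)"
proof -
  have in01: "t * x \<in> {0..t}" "t * x \<in> {0..1}" if "t \<in> {0..1}" "x \<in> {0..1}" for t x :: real
    using that mult_left_le[of x t] by (auto simp: mult_le_one)
  have "bdd_above (f ` {0..1})"
    using compact_continuous_image[OF cont] by (auto intro: bounded_imp_bdd_above compact_imp_bounded)
  then obtain B where "\<And>x. x \<in> {0..1} \<Longrightarrow> f x \<le> B" unfolding bdd_above_def by blast
  then have bdd: "bdd_above ((\<lambda>x. f (t * x)) ` {0..1})" if "t \<in> {0..1}" for t
    using in01[OF that] by (intro bdd_aboveI2[of _ _ B]) blast
  show up: "f s \<le> running_max f t" if "t \<in> {0..1}" "s \<in> {0..t}" for s t
  proof (cases "t = 0")
    case True
    then show ?thesis using that cSUP_upper[OF _ bdd[OF that(1)], of 0] by (auto simp: running_max_def)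
  next
    case False
    then have "s = t * (s / t)" "s / t \<in> {0..1}" using that by (auto simp: field_simps)
    then show ?thesis using cSUP_upper[OF _ bdd[OF that(1)], of "s / t"] by (simp add: running_max_def)
  qed
  show least: "running_max f t \<le> c" if "t \<in> {0..1}" "\<And>s. s \<in> {0..t} \<Longrightarrow> f s \<le> c" for t c
    unfolding running_max_def using in01(1)[OF that(1)] that(2) by (intro cSUP_least) auto
  have uc: "uniformly_continuous_on {0..1} f"
    using cont by (intro compact_uniformly_continuous) auto
  show "continuous_on {0..1} (running_max f)"
  proof (rule continuous_on_iff[THEN iffD2], intro ballI allI impI)
    fix t e :: real assume t: "t \<in> {0..1}" and "0 < e"
    then obtain d where d: "0 < d" "\<And>x y. x \<in> {0..1} \<Longrightarrow> y \<in> {0..1} \<Longrightarrow> dist y x < d \<Longrightarrow> dist (f y) (f x) < e / 2"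
      using uc unfolding uniformly_continuous_on_def by (metis half_gt_zero)
    have le: "running_max f a \<le> running_max f b + e / 2" if "a \<in> {0..1}" "b \<in> {0..1}" "dist a b < d" for a b
    proof -
      have "f (a * x) \<le> running_max f b + e / 2" if x: "x \<in> {0..1}" for x
      proof -
        have "dist (a * x) (b * x) = dist a b * x" using x by (simp add: dist_real_def abs_mult flip: left_diff_distrib)
        also have "\<dots> \<le> dist a b" using x by (simp add: mult_left_le)
        finally have "dist (f (a * x)) (f (b * x)) < e / 2"
          using d(2) in01 x \<open>a \<in> {0..1}\<close> \<open>b \<in> {0..1}\<close> \<open>dist a b < d\<close> by (meson le_less_trans)
        then have "f (a * x) < f (b * x) + e / 2" unfolding dist_real_def by linarith
        then show ?thesis using up[OF \<open>b \<in> {0..1}\<close> in01(1)[OF \<open>b \<in> {0..1}\<close> x]] by linarith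
      qed
      then show ?thesis unfolding running_max_def[of f a] by (intro cSUP_least) auto
    qed
    have "dist (running_max f y) (running_max f t) < e" if "y \<in> {0..1}" "dist y t < d" for y
      using le[OF that(1) t that(2)] le[OF t that(1)] that(2) \<open>0 < e\<close>
      unfolding dist_real_def by (simp add: abs_minus_commute)
    then show "\<exists>d>0. \<forall>y\<in>{0..1}. dist y t < d \<longrightarrow> dist (running_max f y) (running_max f t) < e"
      using d(1) by blast
  qed
qed

lemma reparamI:
  fixes \<psi> :: "real \<Rightarrow> real"
  assumes cont: "continuous_on {0..1} \<psi>" and mono: "strict_mono_on {0..1} \<psi>" and "\<psi> 0 = 0" "\<psi> 1 = 1"
  shows "reparam \<psi>"
proof -
  have m: "mono_on {0..1} \<psi>" using mono by (rule strict_mono_on_imp_mono_on)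
  have "\<psi> ` {0..1} = {0..1}"
  proof
    show "\<psi> ` {0..1} \<subseteq> {0..1}"
      using mono_onD[OF m, of 0] mono_onD[OF m, of _ 1] assms by fastforce
    show "{0..1} \<subseteq> \<psi> ` {0..1}"
      using IVT'[of \<psi> 0 _ 1] assms by (auto simp: image_iff) (metis atLeastAtMost_iff)
  qed
  then obtain \<psi>' where "homeomorphism {0..1} {0..1} \<psi> \<psi>'"
    using homeomorphism_compact[OF compact_Icc cont] strict_mono_on_imp_inj_on[OF mono] by blast
  then show ?thesis using mono unfolding reparam_def by blast
qed

text \<open>
  At the time when the running maximum of \<open>x + y\<close> is \<open>m\<close>, the trace contains only points with \<open>x + y \<le> m\<close>,
  and it already passes close to all points with \<open>x + y\<close> a little smaller than \<open>m\<close>: such points are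
  approached at some time, and almost monotonicity excludes later times.
\<close>

lemma family_dist_trace_triangle_le:
  fixes \<zeta> :: "real \<Rightarrow> complex"
  assumes "path \<zeta>" and Q: "path_image \<zeta> \<subseteq> Qbar" and start: "\<zeta> 0 = 0" and finish: "\<zeta> 1 = Complex 1 1"
    and "0 < \<epsilon>" "\<epsilon> \<le> 1"
    and almost_mono: "\<And>s t. 0 \<le> s \<Longrightarrow> s \<le> t \<Longrightarrow> t \<le> 1 \<Longrightarrow> Re (\<zeta> s) + Im (\<zeta> s) \<le> Re (\<zeta> t) + Im (\<zeta> t) + \<epsilon>"
    and dense: "\<And>z. z \<in> Qbar \<Longrightarrow> \<exists>s\<in>{0..1}. dist z (\<zeta> s) \<le> \<epsilon>"
  shows "family_dist (trace \<zeta>) triangle_family \<le> 8 * \<epsilon>"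
proof -
  define u where "u z = Re z + Im z" for z
  define m where "m = running_max (\<lambda>t. u (\<zeta> t))"
  have cont: "continuous_on {0..1} (\<lambda>t. u (\<zeta> t))"
    using assms(1) unfolding u_def path_def by (intro continuous_intros)
  note rm = running_max_props[OF cont, folded m_def]
  have inQ: "\<zeta> t \<in> Qbar" if "t \<in> {0..1}" for t using Q that by (auto simp: path_image_def)
  have u02: "0 \<le> u (\<zeta> t) \<and> u (\<zeta> t) \<le> 2" if "t \<in> {0..1}" for t
    using inQ[OF that] by (auto simp: Qbar_def u_def)
  have m_le: "m t \<le> u (\<zeta> t) + \<epsilon>" if "t \<in> {0..1}" for t
    using that almost_mono by (intro rm(2)) (auto simp: u_def)
  have m_ge: "u (\<zeta> s) \<le> m t" if "t \<in> {0..1}" "s \<in> {0..t}" for s t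
    using rm(1) that .
  have m_mono: "m s \<le> m t" if "t \<in> {0..1}" "s \<in> {0..t}" for s t
    using that by (intro rm(2) m_ge) auto
  have m02: "0 \<le> m t \<and> m t \<le> 2" if "t \<in> {0..1}" for t
    using m_ge[OF that, of t] u02[OF that] that u02 rm(2)[OF that, of 2] by force
  have m0: "m 0 = 0" using rm(2)[of 0 0] m02[of 0] start by (auto simp: u_def)
  have m1: "m 1 = 2" using m_ge[of 1 1] m02[of 1] finish by (auto simp: u_def)
  \<comment> \<open>The running maximum need not be strictly increasing, hence the small linear summand.\<close>
  define \<psi> where "\<psi> t = (1 - \<epsilon>) * m t / 2 + \<epsilon> * t" for t
  have "reparam \<psi>"
  proof (rule reparamI)
    show "continuous_on {0..1} \<psi>" unfolding \<psi>_def by (intro continuous_intros rm(3)) auto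
    show "strict_mono_on {0..1} \<psi>"
    proof (rule strict_mono_onI)
      fix r s :: real assume "r \<in> {0..1}" "s \<in> {0..1}" "r < s"
      then have "m r \<le> m s" "\<epsilon> * r < \<epsilon> * s" using m_mono[of s r] \<open>0 < \<epsilon>\<close> by auto
      moreover have "(1 - \<epsilon>) * m r \<le> (1 - \<epsilon>) * m s" using calculation \<open>\<epsilon> \<le> 1\<close> by (intro mult_left_mono) auto
      ultimately show "\<psi> r < \<psi> s" unfolding \<psi>_def by (simp add: add_le_less_mono)
    qed
  qed (simp_all add: \<psi>_def m0 m1 field_simps)
  have \<psi>: "m t - 2 * \<epsilon> \<le> 2 * \<psi> t \<and> 2 * \<psi> t \<le> m t + 2 * \<epsilon> \<and> 0 \<le> \<psi> t" if t: "t \<in> {0..1}" for t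
  proof -
    have "2 * \<psi> t = m t - \<epsilon> * m t + 2 * (\<epsilon> * t)" by (simp add: \<psi>_def field_simps)
    moreover have "0 \<le> \<epsilon> * m t" "\<epsilon> * m t \<le> \<epsilon> * 2" "0 \<le> \<epsilon> * t" "\<epsilon> * t \<le> \<epsilon> * 1"
      using m02[OF t] t \<open>0 < \<epsilon>\<close> by (auto intro: mult_left_mono simp del: mult_1_right)
    moreover have "0 \<le> \<psi> t" using reparam_in[OF \<open>reparam \<psi>\<close> t] by auto
    ultimately show ?thesis by linarith
  qed
  have gt: "growing_family (trace \<zeta>)" using assms(1,2) by (rule growing_family_trace)
  have gr: "growing_family (\<lambda>t. triangle_family (\<psi> t))"
    by (rule growing_family_reparam[OF growing_triangle_family \<open>reparam \<psi>\<close>])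
  have "hausdorff_dist (trace \<zeta> t) (triangle_family (\<psi> t)) \<le> 8 * \<epsilon>" if t: "t \<in> {0..1}" for t
  proof -
    have "infdist a (triangle_family (\<psi> t)) \<le> 8 * \<epsilon>" if a: "a \<in> trace \<zeta> t" for a
    proof -
      obtain s where s: "s \<in> {0..t}" "a = \<zeta> s" using a by (auto simp: trace_def)
      then have "a \<in> Qbar" using inQ t by auto
      then obtain w where w: "w \<in> Qbar" "u w \<le> 2 * \<psi> t" "dist a w \<le> max 0 (u a - 2 * \<psi> t)"
        using near_triangle[of a "2 * \<psi> t"] \<psi>[OF t] by (auto simp: u_def)
      have "u a \<le> 2 * \<psi> t + 2 * \<epsilon>" using m_ge[OF t s(1)] \<psi>[OF t] s(2) by simp
      then have "dist a w \<le> 8 * \<epsilon>" using w(3) \<open>0 < \<epsilon>\<close> by simp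
      moreover have "w \<in> triangle_family (\<psi> t)" using w by (simp add: triangle_family_def u_def)
      ultimately show ?thesis using infdist_le2 by blast
    qed
    moreover have "infdist b (trace \<zeta> t) \<le> 8 * \<epsilon>" if "b \<in> triangle_family (\<psi> t)" for b
    proof -
      have b: "b \<in> Qbar" "u b \<le> m t + 2 * \<epsilon>"
        using that \<psi>[OF t] by (auto simp: triangle_family_def u_def)
      \<comment> \<open>Points with \<open>x + y\<close> clearly below the running maximum cannot still lie ahead of the path; for other
        points of the triangle move down first, or, near the corner, use the starting point \<open>0\<close>.\<close>
      show ?thesis
      proof (cases "m t < 5 * \<epsilon>")
        case True
        have "dist b (\<zeta> 0) \<le> u b" using cmod_le[of b] b(1) start by (simp add: dist_norm u_def Qbar_def)
        then have "dist b (\<zeta> 0) \<le> 8 * \<epsilon>" using b(2) True \<open>0 < \<epsilon>\<close> by linarith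
        then show ?thesis using infdist_le2[of "\<zeta> 0"] t by (auto simp: trace_def)
      next
        case False
        then obtain w where w: "w \<in> Qbar" "u w \<le> m t - 5 * \<epsilon>" "dist b w \<le> max 0 (u b - (m t - 5 * \<epsilon>))"
          using near_triangle[OF b(1), of "m t - 5 * \<epsilon>"] by (auto simp: u_def)
        obtain s where s: "s \<in> {0..1}" "dist w (\<zeta> s) \<le> \<epsilon>" using dense[OF w(1)] by blast
        have "u (\<zeta> s) \<le> u w + 2 * \<epsilon>" using level_diff[of "\<zeta> s" w] s(2) by (simp add: u_def dist_commute)
        then have "u (\<zeta> s) + \<epsilon> < u (\<zeta> t)" using w(2) m_le[OF t] \<open>0 < \<epsilon>\<close> by linarith
        then have "s \<le> t" using almost_mono[of t s] s(1) t unfolding u_def by force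
        then have "\<zeta> s \<in> trace \<zeta> t" using s by (auto simp: trace_def)
        moreover have "dist b (\<zeta> s) \<le> 8 * \<epsilon>"
          using dist_triangle[of b "\<zeta> s" w] w(3) s(2) b(2) \<open>0 < \<epsilon>\<close> by (simp add: max_def split: if_splits)
        ultimately show ?thesis using infdist_le2 by blast
      qed
    qed
    ultimately show ?thesis
      using growing_familyD[OF gt t] growing_familyD[OF gr t] by (subst hausdorff_dist_le_iff) auto
  qed
  then have "sup_dist (trace \<zeta>) (\<lambda>t. triangle_family (\<psi> t)) \<le> 8 * \<epsilon>"
    using sup_dist_le_iff[OF gt gr] by blast
  then show ?thesis
    using family_dist_le[OF gt growing_triangle_family reparam_id \<open>reparam \<psi>\<close>] by simp
qed

text \<open>
  Time changes fix the final time.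
\<close>

lemma family_dist_zero_imp_final_eq:
  assumes "growing_family \<kappa>" "growing_family \<kappa>'" "family_dist \<kappa> \<kappa>' = 0"
  shows "\<kappa> 1 = \<kappa>' 1"
proof -
  have reparam_1: "\<phi> 1 = 1" if "reparam \<phi>" for \<phi>
  proof -
    have "\<phi> ` {0..1} = {0..1}" using that unfolding reparam_def homeomorphism_def by blast
    then have "1 \<in> \<phi> ` {0..1}" by simp
    then obtain x where x: "x \<in> {0..1}" "\<phi> x = 1" by force
    have "mono_on {0..1} \<phi>" using that unfolding reparam_def by (auto intro: strict_mono_on_imp_mono_on)
    then have "1 \<le> \<phi> 1" using mono_onD[of "{0..1}" \<phi> x 1] x by auto
    then show ?thesis using reparam_in[OF that, of 1] by auto
  qed
  have "(1::real) \<in> {0..1}" by simp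
  note g = growing_familyD[OF assms(1) this] growing_familyD[OF assms(2) this]
  have "hausdorff_dist (\<kappa> 1) (\<kappa>' 1) \<le> e" if e: "0 < e" for e
  proof -
    obtain \<phi> \<psi> where *: "reparam \<phi>" "reparam \<psi>" "sup_dist (\<lambda>t. \<kappa> (\<phi> t)) (\<lambda>t. \<kappa>' (\<psi> t)) < e"
      using family_dist_lessE[of \<kappa> \<kappa>' e] assms(3) e by auto
    have "hausdorff_dist (\<kappa> (\<phi> 1)) (\<kappa>' (\<psi> 1)) \<le> e"
      using sup_dist_le_iff[OF growing_family_reparam[OF assms(1) *(1)] growing_family_reparam[OF assms(2) *(2)], of e] *(3)
      by auto
    then show ?thesis by (simp only: reparam_1[OF *(1)] reparam_1[OF *(2)])
  qed
  then have "hausdorff_dist (\<kappa> 1) (\<kappa>' 1) \<le> 0" by (rule field_le_epsilon[where y = 0, unfolded add_0])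
  then have le: "\<forall>a\<in>\<kappa> 1. infdist a (\<kappa>' 1) \<le> 0" "\<forall>b\<in>\<kappa>' 1. infdist b (\<kappa> 1) \<le> 0"
    using hausdorff_dist_le_iff[of "\<kappa> 1" "\<kappa>' 1" 0] g by auto
  have mem: "a \<in> B" if "infdist a B \<le> 0" "compact B" "B \<noteq> {}" for a :: complex and B
    using that infdist_nonneg[of a B] in_closed_iff_infdist_zero[OF compact_imp_closed[OF that(2)] that(3), of a] by simp
  show ?thesis
  proof
    show "\<kappa> 1 \<subseteq> \<kappa>' 1" using mem[OF bspec[OF le(1)] g(5,4)] by blast
    show "\<kappa>' 1 \<subseteq> \<kappa> 1" using mem[OF bspec[OF le(2)] g(2,1)] by blast
  qed
qed

section \<open>Traces of Peano paths\<close>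

text \<open>
  Besides the moves there are two segments before and two segments after the lattice path.
\<close>

lemma full_list_steps:
  assumes "0 < n" "Suc k < length (full_list n C)"
  shows "(full_list n C ! k, full_list n C ! Suc k) \<in>
    {(pt n 0 0, pt n 1 1), (pt n 1 1, pt n 3 1),
     (pt n (4 * int n - 1) (4 * int n - 3), pt n (4 * int n - 1) (4 * int n - 1)),
     (pt n (4 * int n - 1) (4 * int n - 1), pt n (4 * int n) (4 * int n))} \<union>
    (\<lambda>p. (peano n p, peano n (move (directions n C) p))) ` (square n - {(2 * int n - 1, 2 * int n - 2)})"
proof -
  let ?M = "card (square n)" and ?x = "orbit n C" and ?e = "(2 * int n - 1, 2 * int n - 2)"
  have n: "1 \<le> n" using assms by simp
  note O = orbit_props(1-3)[OF n, of C] orbit_props(4)[OF n]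
  have len: "length (full_list n C) = ?M + 4" by (simp add: full_list_def path_list_def)
  have z: "Complex (1 / (4 * real n)) (1 / (4 * real n)) = pt n 1 1" "0 = pt n 0 0"
    "Complex (1 - 1 / (4 * real n)) (1 - 1 / (4 * real n)) = pt n (4 * int n - 1) (4 * int n - 1)"
    "Complex 1 1 = pt n (4 * int n) (4 * int n)"
    using assms(1) by (simp_all add: complex_eq_iff field_simps)
  have mid: "full_list n C ! Suc (Suc j) = peano n (?x j)" if "j < ?M" for j
    using that by (simp add: full_list_def path_list_def nth_append)
  have 0: "full_list n C ! 0 = pt n 0 0" "full_list n C ! Suc 0 = pt n 1 1"
    unfolding full_list_def z by simp_all
  have 1: "full_list n C ! (?M + 2) = pt n (4 * int n - 1) (4 * int n - 1)"
    "full_list n C ! (?M + 3) = pt n (4 * int n) (4 * int n)"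
    unfolding full_list_def z by (simp_all add: path_list_def nth_append)
  have start: "peano n (?x 0) = pt n 3 1" by (simp add: orbit_def sublattice_def)
  have finish: "peano n (?x (?M - 1)) = pt n (4 * int n - 1) (4 * int n - 3)"
    unfolding O(3) by (simp add: sublattice_def)
  consider "k = 0" | "k = 1" | j where "k = Suc (Suc j)" "Suc j < ?M" | "k = ?M + 1" | "k = ?M + 2"
  proof -
    have "k < ?M + 3" using assms(2) len by simp
    then have "k = 0 \<or> k = 1 \<or> (\<exists>j. k = Suc (Suc j) \<and> Suc j < ?M) \<or> k = ?M + 1 \<or> k = ?M + 2"
      by (cases k; cases "k - 1") (auto, presburger?)
    then show thesis using that by blast
  qed
  then show ?thesis
  proof cases
    case 1
    then show ?thesis using 0 by simp
  next
    case 2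
    then show ?thesis using 0 mid[of 0] O(4) start by simp
  next
    case (3 j)
    have "?x j \<noteq> ?e"
    proof
      assume "?x j = ?e"
      then have "j = ?M - 1" using O(2,3) 3(2) by (intro inj_onD[OF O(2)]) auto
      then show False using 3(2) by simp
    qed
    moreover have "?x j \<in> square n" using O(1) 3(2) by auto
    moreover have "?x (Suc j) = move (directions n C) (?x j)" by (simp add: orbit_def)
    ultimately show ?thesis using mid[of j] mid[of "Suc j"] 3 by auto
  next
    case 4
    have "full_list n C ! k = peano n (?x (?M - 1))" using mid[of "?M - 1"] 4 O(4) by simp
    moreover have "full_list n C ! Suc k = pt n (4 * int n - 1) (4 * int n - 1)" using 1 4 by simp
    ultimately show ?thesis unfolding finish by simp
  next
    case 5
    then show ?thesis using 1 by (simp add: numeral_3_eq_3 numeral_2_eq_2)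
  qed
qed

lemma full_list_step_occurs:
  assumes "0 < n" "p \<in> square n" "p \<noteq> (2 * int n - 1, 2 * int n - 2)"
  shows "\<exists>k. Suc k < length (full_list n C) \<and> full_list n C ! k = peano n p \<and>
    full_list n C ! Suc k = peano n (move (directions n C) p)"
proof -
  let ?M = "card (square n)" and ?x = "orbit n C"
  have n: "1 \<le> n" using assms by simp
  note O = orbit_props(1-3)[OF n, of C] orbit_props(4)[OF n]
  obtain j where j: "j < ?M" "?x j = p" using assms(2) O(1) by (metis imageE lessThan_iff)
  then have "j \<noteq> ?M - 1" using O(3) assms(3) by auto
  then have "Suc j < ?M" using j by simp
  moreover have "?x (Suc j) = move (directions n C) p" using j by (simp add: orbit_def)
  ultimately show ?thesis using j(2)
    by (intro exI[of _ "Suc (Suc j)"]) (simp add: full_list_def path_list_def nth_append)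
qed

definition peano_curve :: "nat \<Rightarrow> (int \<times> int) set \<Rightarrow> real \<Rightarrow> complex" where
  "peano_curve n C = polyline (full_list n C)"

lemma full_list_length: "2 \<le> length (full_list n C)"
  by (simp add: full_list_def)

lemma peano_curve_ends: "path (peano_curve n C)" "peano_curve n C 0 = 0" "peano_curve n C 1 = Complex 1 1"
  using polyline_ends[of "full_list n C"] 
  by (auto simp: peano_curve_def full_list_def pathstart_def pathfinish_def)

lemma pt_in_Qbar: "0 < n \<Longrightarrow> pt n x y \<in> Qbar \<longleftrightarrow> 0 \<le> x \<and> x \<le> 4 * int n \<and> 0 \<le> y \<and> y \<le> 4 * int n"
  by (simp add: Qbar_def divide_le_eq zero_le_divide_iff) (auto simp: le_less)

lemma peano_curve_in_Qbar:
  assumes "0 < n"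
  shows "path_image (peano_curve n C) \<subseteq> Qbar"
proof -
  have "convex Qbar" by (simp add: Qbar_eq_cbox)
  moreover have "full_list n C ! k \<in> Qbar \<and> full_list n C ! Suc k \<in> Qbar" if "Suc k < length (full_list n C)" for k
  proof -
    have "peano n p \<in> Qbar" if "p \<in> square n" for p
      using that assms by (auto simp: sublattice_def pt_in_Qbar square_def)
    then have "peano n p \<in> Qbar \<and> peano n (move (directions n C) p) \<in> Qbar"
      if "p \<in> square n - {(2 * int n - 1, 2 * int n - 2)}" for p
      using that move_in_square[of p n C] by blast
    then show ?thesis
      using full_list_steps[OF assms that]
    proof (elim UnE imageE, goal_cases)
      case 1
      then show ?case using assms by (auto simp: pt_in_Qbar)
    next
      case (2 p)
      then show ?case by (metis prod.inject)
    qed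
  qed
  ultimately show ?thesis
    unfolding peano_curve_def path_image_polyline[OF full_list_length]
    by (auto dest: closed_segment_subset[THEN subsetD, rotated 3])
qed

lemma pt_in_hull_horizontal:
  "0 < n \<Longrightarrow> pt n x y \<in> convex hull {pt n x1 y', pt n x2 y'} \<longleftrightarrow> y = y' \<and> min x1 x2 \<le> x \<and> x \<le> max x1 x2"
  by (auto simp: hull_horizontal min_def max_def)

lemma pt_in_hull_vertical:
  "0 < n \<Longrightarrow> pt n x y \<in> convex hull {pt n x' y1, pt n x' y2} \<longleftrightarrow> x = x' \<and> min y1 y2 \<le> y \<and> y \<le> max y1 y2"
  by (auto simp: hull_vertical min_def max_def)

text \<open>
  The midpoint of the first horizontal edge to the right above the vertex \<open>(i, j)\<close> lies on no other edge
  that the path could use, and the path uses this edge if and only if the arrow at \<open>(i, j)\<close> points to the right.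
\<close>

lemma midpoint_in_peano_curve_iff:
  assumes "0 < n" "(i, j) \<in> interior_idx n"
  shows "pt n (4 * i + 2) (4 * j + 1) \<in> path_image (peano_curve n C) \<longleftrightarrow> (i, j) \<in> C"
proof -
  let ?z = "pt n (4 * i + 2) (4 * j + 1)"
  have ij: "1 \<le> i" "i \<le> int n - 1" "1 \<le> j" "j \<le> int n - 1" using assms by (auto simp: interior_idx_def)
  have r: "directions n C i j \<longleftrightarrow> (i, j) \<in> C" using ij by (simp add: directions_def)
  have segment_Re: "min (Re a) (Re b) \<le> Re z \<and> Re z \<le> max (Re a) (Re b)" if "z \<in> closed_segment a b" for z a b
  proof -
    have "Re z \<in> closed_segment (Re a) (Re b)" using that closed_segment_linear_image[OF bounded_linear.linear[OF bounded_linear_Re], of a b]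
      by (metis image_eqI)
    then show ?thesis by (auto simp: closed_segment_eq_real_ivl split: if_splits)
  qed
  have Re_bounds: "min x x' \<le> 4 * i + 2 \<and> 4 * i + 2 \<le> max x x'" if "?z \<in> closed_segment (pt n x y) (pt n x' y')" for x y x' y'
    using segment_Re[OF that] assms(1) by (auto simp: min_def max_def divide_le_cancel split: if_splits)
  show ?thesis
  proof
    assume "?z \<in> path_image (peano_curve n C)"
    then obtain k where k: "Suc k < length (full_list n C)" "?z \<in> closed_segment (full_list n C ! k) (full_list n C ! Suc k)"
      unfolding peano_curve_def path_image_polyline[OF full_list_length] by auto
    have "\<exists>p. p \<in> square n \<and> ?z \<in> closed_segment (peano n p) (peano n (move (directions n C) p))"
      using full_list_steps[OF assms(1) k(1)] k(2) ij
      by (auto dest!: Re_bounds)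
    then obtain a b where z: "?z \<in> convex hull {peano n (a, b), peano n (move (directions n C) (a, b))}"
      by (auto simp: segment_convex_hull)
    let ?i = "(if even b then a + 1 else a) div 2" and ?j = "(if even a then b + 1 else b + 2) div 2"
    show "(i, j) \<in> C"
    proof (cases "directions n C ?i ?j")
      case True
      let ?a' = "if even b then a + 1 else a - 1"
      have "move (directions n C) (a, b) = (?a', b)" using True by (simp add: move_def Let_def)
      then have "?z \<in> convex hull {pt n (2 * a + 1) (2 * b + 1), pt n (2 * ?a' + 1) (2 * b + 1)}"
        using z by (simp only: sublattice_def fst_conv snd_conv)
      then have c: "4 * j + 1 = 2 * b + 1" "min (2 * a + 1) (2 * ?a' + 1) \<le> 4 * i + 2" "4 * i + 2 \<le> max (2 * a + 1) (2 * ?a' + 1)"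
        unfolding pt_in_hull_horizontal[OF assms(1)] by auto
      then have b: "b = 2 * j" by simp
      then have "2 * a + 1 \<le> 4 * i + 2" "4 * i + 2 \<le> 2 * a + 3" using c(2,3) by simp_all
      then have "a = 2 * i" by presburger
      then show ?thesis using True r b by simp
    next
      case False
      let ?b' = "if even a then b - 1 else b + 1"
      have "move (directions n C) (a, b) = (a, ?b')" using False by (simp add: move_def Let_def)
      then have "?z \<in> convex hull {pt n (2 * a + 1) (2 * b + 1), pt n (2 * a + 1) (2 * ?b' + 1)}"
        using z by (simp only: sublattice_def fst_conv snd_conv)
      then have "4 * i + 2 = 2 * a + 1"
        unfolding pt_in_hull_vertical[OF assms(1)] by auto
      then have False by presburger
      then show ?thesis ..
    qed
  next
    assume "(i, j) \<in> C"
    then have m: "move (directions n C) (2 * i, 2 * j) = (2 * i + 1, 2 * j)" using r by (simp add: move_cases)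
    have "(2 * i, 2 * j) \<in> square n" "(2 * i, 2 * j) \<noteq> (2 * int n - 1, 2 * int n - 2)"
      using ij by (auto simp: square_def, presburger?)
    then obtain k where k: "Suc k < length (full_list n C)" "full_list n C ! k = peano n (2 * i, 2 * j)"
      "full_list n C ! Suc k = peano n (2 * i + 1, 2 * j)"
      using full_list_step_occurs[OF assms(1), of "(2 * i, 2 * j)" C] unfolding m by blast
    have "?z \<in> convex hull {pt n (2 * (2 * i) + 1) (2 * (2 * j) + 1), pt n (2 * (2 * i) + 3) (2 * (2 * j) + 1)}"
      by (simp add: pt_in_hull_horizontal[OF assms(1)])
    then have "?z \<in> closed_segment (full_list n C ! k) (full_list n C ! Suc k)"
      unfolding k segment_convex_hull peano_horizontal .
    then show "?z \<in> path_image (peano_curve n C)"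
      unfolding peano_curve_def path_image_polyline[OF full_list_length] using k(1) by blast
  qed
qed

abbreviation diag :: "complex \<Rightarrow> real" where
  "diag z \<equiv> Re z + Im z"

lemma diag_peano: "0 < n \<Longrightarrow> diag (peano n p) = (real_of_int (level p) + 1) / (2 * real n)"
  by (simp add: sublattice_def field_simps)

lemma diag_Qbar: "z \<in> Qbar \<Longrightarrow> 0 \<le> diag z \<and> diag z \<le> 2"
  by (auto simp: Qbar_def)

text \<open>
  The list visits the vertices in the order of \<open>before\<close>, and the two vertices at either end have extreme
  values of \<open>x + y\<close>.
\<close>

lemma full_list_almost_sorted:
  assumes "0 < n" "tame n m C" "0 \<le> m"
  shows "sorted_wrt (\<lambda>z w. diag z \<le> diag w + (of_int m + 2) / real n) (full_list n C)"
proof -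
  let ?h = "(real_of_int m + 2) / real n"
  let ?P = "\<lambda>z w. diag z \<le> diag w + ?h"
  have n: "1 \<le> n" using assms by simp
  note O = orbit_props(1-3)[OF n, of C] orbit_props(4)[OF n]
  have h: "2 / real n \<le> ?h" using assms by (simp add: divide_right_mono)
  have h': "1 / (2 * real n) \<le> 2 / real n" using assms(1) by (simp add: field_simps)
  have Q: "z \<in> Qbar" if z: "z \<in> set (path_list n C)" for z
  proof -
    obtain k where "k < card (square n)" "z = peano n (orbit n C k)" using z by (auto simp: path_list_def)
    then have "orbit n C k \<in> square n" using O(1) by blast
    then show ?thesis using \<open>z = _\<close> assms by (auto simp: sublattice_def pt_in_Qbar square_def)
  qed
  have "sorted_wrt ?P (path_list n C)"
    unfolding path_list_def sorted_wrt_map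
  proof (subst sorted_wrt_iff_nth_less, intro allI impI)
    fix j k assume jk: "j < k" "k < length [0..<card (square n)]"
    then have k: "k < card (square n)" "j < card (square n)" by auto
    then have "orbit n C j \<in> square n" "orbit n C k \<in> square n" using O(1) by blast+
    then have "level (orbit n C j) \<le> level (orbit n C k) + 2 * m + 4"
      using before_level[OF assms(2,3)] orbit_props(5)[OF n k(1) jk(1)] by blast
    then have "(real_of_int (level (orbit n C j)) + 1) / (2 * real n) \<le> (real_of_int (level (orbit n C k) + 2 * m + 4) + 1) / (2 * real n)"
      by (intro divide_right_mono) linarith+
    also have "\<dots> = (real_of_int (level (orbit n C k)) + 1) / (2 * real n) + ?h"
      using assms(1) by (simp add: field_simps)
    finally have "diag (peano n (orbit n C j)) \<le> diag (peano n (orbit n C k)) + ?h"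
      unfolding diag_peano[OF assms(1)] .
    then show "diag (peano n (orbit n C ([0..<card (square n)] ! j))) \<le> diag (peano n (orbit n C ([0..<card (square n)] ! k))) + ?h"
      using k by (simp only: nth_upt add_0)
  qed
  moreover define c h where "c = 1 / (4 * real n)" and "h = ?h"
  moreover have c: "0 \<le> c" "2 * c \<le> h" "4 * c \<le> 1"
    using h h' assms(1) unfolding c_def h_def by (auto simp: field_simps)
  moreover have "0 \<le> diag z \<and> diag z \<le> 2" if "z \<in> set (path_list n C)" for z
    using diag_Qbar[OF Q[OF that]] .
  ultimately show ?thesis
    unfolding full_list_def c_def[symmetric] h_def[symmetric] sorted_wrt_append
    by (fastforce simp del: plus_complex.simps)
qed

lemma full_list_small_steps:
  assumes "0 < n" "Suc k < length (full_list n C)"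
  shows "diag (full_list n C ! Suc k) \<le> diag (full_list n C ! k) + 1 / (2 * real n)"
  using full_list_steps[OF assms]
proof (elim UnE imageE, goal_cases)
  case 1
  then show ?case using assms(1) by (auto simp: field_simps)
next
  case (2 p)
  have "level (move (directions n C) p) \<le> level p + 1"
    by (cases p) (auto simp: move_def Let_def)
  then have "(real_of_int (level (move (directions n C) p)) + 1) / (2 * real n)
      \<le> ((real_of_int (level p) + 1) + 1) / (2 * real n)"
    by (intro divide_right_mono) linarith+
  then have "diag (peano n (move (directions n C) p)) \<le> diag (peano n p) + 1 / (2 * real n)"
    unfolding diag_peano[OF assms(1)] add_divide_distrib .
  then show ?case using 2 by simp
qed

lemma diag_segment:
  assumes "z \<in> closed_segment a b"
  shows "min (diag a) (diag b) \<le> diag z" "diag z \<le> max (diag a) (diag b)"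
proof -
  obtain t where t: "0 \<le> t" "t \<le> 1" "z = (1 - t) *\<^sub>R a + t *\<^sub>R b" using assms by (auto simp: closed_segment_def)
  have "diag z = (1 - t) * diag a + t * diag b" unfolding t(3) by (simp add: algebra_simps)
  moreover have "(1 - t) * m + t * m = m" for m :: real by (simp add: algebra_simps)
  ultimately show "min (diag a) (diag b) \<le> diag z" "diag z \<le> max (diag a) (diag b)"
    using t mult_left_mono[of "min (diag a) (diag b)" "diag a" "1 - t"] mult_left_mono[of "min (diag a) (diag b)" "diag b" t]
      mult_left_mono[of "diag a" "max (diag a) (diag b)" "1 - t"] mult_left_mono[of "diag b" "max (diag a) (diag b)" t]
    by (smt (verit))+
qed

lemma peano_curve_almost_mono:
  assumes "0 < n" "tame n m C" "0 \<le> m" "0 \<le> s" "s \<le> t" "t \<le> 1"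
  shows "diag (peano_curve n C s) \<le> diag (peano_curve n C t) + (of_int m + 2) / real n"
proof -
  let ?h = "(real_of_int m + 2) / real n" and ?L = "full_list n C"
  have h: "1 / (2 * real n) \<le> ?h" using assms by (simp add: field_simps)
  have h0: "0 \<le> ?h" using assms by simp
  obtain i j where ij: "i \<le> j" "Suc j < length ?L" "peano_curve n C s \<in> closed_segment (?L ! i) (?L ! Suc i)"
    "peano_curve n C t \<in> closed_segment (?L ! j) (?L ! Suc j)"
    using polyline_segments[OF full_list_length assms(4-6)] unfolding peano_curve_def by blast
  have le: "diag (?L ! x) \<le> diag (?L ! y) + ?h" if "x \<le> Suc y" "x < length ?L" "y < length ?L" for x y
  proof -
    consider "x < y" | "x = y" | "x = Suc y" using \<open>x \<le> Suc y\<close> by linarith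
    then show ?thesis
    proof cases
      case 1
      then show ?thesis using sorted_wrt_nth_less[OF full_list_almost_sorted[OF assms(1-3)]] that by simp
    next
      case 2
      then show ?thesis using h0 by simp
    next
      case 3
      then show ?thesis using full_list_small_steps[OF assms(1), of y C] that h by simp
    qed
  qed
  have "max (diag (?L ! i)) (diag (?L ! Suc i)) \<le> min (diag (?L ! j)) (diag (?L ! Suc j)) + ?h"
    using ij(1,2) le[of i j] le[of i "Suc j"] le[of "Suc i" j] le[of "Suc i" "Suc j"] by (simp add: min_def)
  then show ?thesis using diag_segment[OF ij(3)] diag_segment[OF ij(4)] by linarith
qed

lemma nearby_square_index:
  assumes "0 < n" "z \<in> Qbar"
  obtains p where "p \<in> square n" "dist z (peano n p) \<le> 2 / real n"
proof -
  \<comment> \<open>Round down in units of half a mesh, then clip to the range of the indices, which leaves out one column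
    on the left and one row at the top.\<close>
  define c d where "c = \<lfloor>2 * real n * Re z\<rfloor>" and "d = \<lfloor>2 * real n * Im z\<rfloor>"
  have z: "0 \<le> Re z" "Re z \<le> 1" "0 \<le> Im z" "Im z \<le> 1" using assms(2) by (auto simp: Qbar_def)
  have cd: "real_of_int c \<le> 2 * real n * Re z" "2 * real n * Re z < real_of_int c + 1"
    "real_of_int d \<le> 2 * real n * Im z" "2 * real n * Im z < real_of_int d + 1"
    unfolding c_def d_def by linarith+
  have nz: "0 \<le> 2 * real n * Re z" "2 * real n * Re z \<le> 2 * real n" "0 \<le> 2 * real n * Im z" "2 * real n * Im z \<le> 2 * real n"
    using z by (auto simp: mult_left_le)
  have cd_bounds: "0 \<le> c" "c \<le> 2 * int n" "0 \<le> d" "d \<le> 2 * int n"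
    using nz cd by linarith+
  define a b where "a = max 1 (min (2 * int n - 1) c)" and "b = min (2 * int n - 2) d"
  have "(a, b) \<in> square n" using cd_bounds assms(1) by (auto simp: square_def a_def b_def)
  moreover have "dist z (peano n (a, b)) \<le> 2 / real n"
  proof -
    have e: "Re z - Re (peano n (a, b)) = (4 * real n * Re z - (2 * of_int a + 1)) / (4 * real n)"
      "Im z - Im (peano n (a, b)) = (4 * real n * Im z - (2 * of_int b + 1)) / (4 * real n)"
      using assms(1) by (simp_all add: sublattice_def field_simps)
    have "\<bar>4 * real n * Re z - (2 * of_int a + 1)\<bar> \<le> 4"
    proof -
      have "a = c \<or> a = 2 * int n - 1 \<and> 2 * int n - 1 \<le> c \<or> a = 1 \<and> c \<le> 1" using assms(1) by (auto simp: a_def)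
      moreover have "4 * real n * Re z = 2 * (2 * real n * Re z)" by simp
      ultimately show ?thesis using cd(1,2) nz(1,2) by (elim disjE) linarith+
    qed
    then have 1: "\<bar>Re z - Re (peano n (a, b))\<bar> \<le> 4 / (4 * real n)"
      unfolding e abs_divide abs_mult abs_numeral abs_of_nat by (rule divide_right_mono) simp
    have "\<bar>4 * real n * Im z - (2 * of_int b + 1)\<bar> \<le> 4"
    proof -
      have "b = d \<or> b = 2 * int n - 2 \<and> 2 * int n - 2 \<le> d" by (auto simp: b_def)
      moreover have "4 * real n * Im z = 2 * (2 * real n * Im z)" by simp
      ultimately show ?thesis using cd(3,4) nz(4) by (elim disjE) linarith+
    qed
    then have 2: "\<bar>Im z - Im (peano n (a, b))\<bar> \<le> 4 / (4 * real n)"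
      unfolding e abs_divide abs_mult abs_numeral abs_of_nat by (rule divide_right_mono) simp
    have "dist z (peano n (a, b)) \<le> \<bar>Re (z - peano n (a, b))\<bar> + \<bar>Im (z - peano n (a, b))\<bar>"
      unfolding dist_norm by (rule cmod_le)
    then show ?thesis using 1 2 by simp
  qed
  ultimately show thesis using that by blast
qed

lemma peano_curve_dense:
  assumes "0 < n" "z \<in> Qbar"
  shows "\<exists>s\<in>{0..1}. dist z (peano_curve n C s) \<le> 2 / real n"
proof -
  obtain p where p: "p \<in> square n" "dist z (peano n p) \<le> 2 / real n"
    using nearby_square_index[OF assms] by blast
  have n: "1 \<le> n" using assms by simp
  obtain k where k: "k < card (square n)" "p = orbit n C k" using p(1) orbit_props(1)[OF n, of C] by blast
  then have "full_list n C ! Suc (Suc k) = peano n p" "Suc (Suc (Suc k)) < length (full_list n C)"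
    by (auto simp: full_list_def path_list_def nth_append)
  then have "peano n p \<in> path_image (peano_curve n C)"
    unfolding peano_curve_def path_image_polyline[OF full_list_length]
    by (intro UN_I[of "Suc (Suc k)"]) (auto simp del: plus_complex.simps)
  then show ?thesis using p(2) by (auto simp: path_image_def)
qed

section \<open>Weak convergence\<close>

definition peano_family :: "nat \<Rightarrow> (int \<times> int) set \<Rightarrow> growing" where
  "peano_family n C = abs_growing (trace (peano_curve n C))"

lemma same_growth_refl: "growing_family \<kappa> \<Longrightarrow> same_growth \<kappa> \<kappa>"
  by (simp add: same_growth_def family_dist_refl)

lemma growing_peano_curve: "0 < n \<Longrightarrow> growing_family (trace (peano_curve n C))"
  by (intro growing_family_trace peano_curve_ends peano_curve_in_Qbar)

lemma dist_abs_growing: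
  "growing_family \<kappa> \<Longrightarrow> growing_family \<kappa>' \<Longrightarrow> dist (abs_growing \<kappa>) (abs_growing \<kappa>') = family_dist \<kappa> \<kappa>'"
  by (intro dist_growing.abs_eq same_growth_refl)

text \<open>
  The final set, which is an invariant of the family, shows the arrow of each interior vertex.
\<close>

lemma inj_peano_family:
  assumes "0 < n"
  shows "inj_on (peano_family n) (Pow (interior_idx n))"
proof (rule inj_onI)
  fix C D assume CD: "C \<in> Pow (interior_idx n)" "D \<in> Pow (interior_idx n)" "peano_family n C = peano_family n D"
  then have "family_dist (trace (peano_curve n C)) (trace (peano_curve n D)) = 0"
    using dist_abs_growing[OF growing_peano_curve[OF assms] growing_peano_curve[OF assms], of C D] by (simp add: peano_family_def)
  then have "trace (peano_curve n C) 1 = trace (peano_curve n D) 1"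
    by (intro family_dist_zero_imp_final_eq growing_peano_curve assms)
  then have "path_image (peano_curve n C) = path_image (peano_curve n D)" by (simp add: trace_def path_image_def)
  then have "v \<in> C \<longleftrightarrow> v \<in> D" if "v \<in> interior_idx n" for v
    using midpoint_in_peano_curve_iff[OF assms, of "fst v" "snd v" C] midpoint_in_peano_curve_iff[OF assms, of "fst v" "snd v" D] that
    by simp
  then show "C = D" using CD(1,2) by blast
qed

lemma fair_peano_paths_eq:
  assumes "0 < n"
  shows "fair_peano_paths n = peano_family n ` Pow (interior_idx n)"
  unfolding fair_peano_paths_def fair_lattice_trees_eq[OF assms] peano_family_def peano_curve_def
  by (auto simp: is_peano_path_iff[OF assms])

lemma dist_peano_family_le:
  assumes "0 < n" "tame n \<lfloor>\<delta> * real n\<rfloor> C" "0 < \<delta>" "\<delta> \<le> 1 / 2" "2 / \<delta> \<le> real n"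
  shows "dist (peano_family n C) lambda_family \<le> 16 * \<delta>"
proof -
  define \<epsilon> where "\<epsilon> = (of_int \<lfloor>\<delta> * real n\<rfloor> + 2) / real n"
  have m: "0 \<le> \<lfloor>\<delta> * real n\<rfloor>" using assms by simp
  have lower: "2 / real n \<le> \<epsilon>" unfolding \<epsilon>_def using m by (intro divide_right_mono) auto
  have "\<epsilon> \<le> (\<delta> * real n + 2) / real n" unfolding \<epsilon>_def by (intro divide_right_mono) auto
  also have "\<dots> = \<delta> + 2 / real n" using assms(1) by (simp add: field_simps)
  also have "2 / real n \<le> \<delta>" using assms(1,3,5) by (simp add: field_simps)
  finally have upper: "\<epsilon> \<le> 2 * \<delta>" by simp
  have "0 < 2 / real n" using assms(1) by simp
  then have pos: "0 < \<epsilon>" using lower by linarith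
  have "family_dist (trace (peano_curve n C)) triangle_family \<le> 8 * \<epsilon>"
  proof (rule family_dist_trace_triangle_le)
    show "path (peano_curve n C)" "peano_curve n C 0 = 0" "peano_curve n C 1 = Complex 1 1" by (rule peano_curve_ends)+
    show "path_image (peano_curve n C) \<subseteq> Qbar" by (rule peano_curve_in_Qbar[OF assms(1)])
    show "0 < \<epsilon>" "\<epsilon> \<le> 1" using pos upper assms(4) by auto
    show "diag (peano_curve n C s) \<le> diag (peano_curve n C t) + \<epsilon>" if "0 \<le> s" "s \<le> t" "t \<le> 1" for s t
      unfolding \<epsilon>_def using peano_curve_almost_mono[OF assms(1,2) m that] .
    show "\<exists>s\<in>{0..1}. dist z (peano_curve n C s) \<le> \<epsilon>" if "z \<in> Qbar" for z
      using peano_curve_dense[OF assms(1) that, of C] lower by force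
  qed
  moreover have "dist (peano_family n C) lambda_family = family_dist (trace (peano_curve n C)) triangle_family"
    unfolding peano_family_def lambda_family_def by (intro dist_abs_growing growing_peano_curve growing_triangle_family assms)
  ultimately show ?thesis using upper by simp
qed

lemma fraction_far_tendsto_0:
  assumes "0 < e"
  shows "(\<lambda>n. real (card {C \<in> Pow (interior_idx n). e \<le> dist (peano_family n C) lambda_family}) / 2 ^ card (interior_idx n)) \<longlonglongrightarrow> 0"
proof -
  \<comment> \<open>A deviation of \<open>\<delta>\<close> costs a distance of at most \<open>16 \<delta>\<close>.\<close>
  define \<delta> where "\<delta> = min (1 / 2) (e / 32)"
  have \<delta>: "0 < \<delta>" "\<delta> \<le> 1 / 2" "16 * \<delta> < e" using assms by (auto simp: \<delta>_def)
  have "\<forall>\<^sub>F n in sequentially. 2 / \<delta> \<le> real n" by real_asymp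
  then have "\<forall>\<^sub>F n in sequentially. norm (real (card {C \<in> Pow (interior_idx n). e \<le> dist (peano_family n C) lambda_family}) / 2 ^ card (interior_idx n))
      \<le> real (card {C \<in> Pow (interior_idx n). \<not> tame n \<lfloor>\<delta> * real n\<rfloor> C}) / 2 ^ card (interior_idx n)"
    using eventually_gt_at_top[of 0]
  proof eventually_elim
    case (elim n)
    have "\<not> tame n \<lfloor>\<delta> * real n\<rfloor> C" if "e \<le> dist (peano_family n C) lambda_family" for C
      using dist_peano_family_le[OF elim(2) _ \<delta>(1,2) elim(1), of C] that \<delta>(3) by linarith
    then have "{C \<in> Pow (interior_idx n). e \<le> dist (peano_family n C) lambda_family} \<subseteq> {C \<in> Pow (interior_idx n). \<not> tame n \<lfloor>\<delta> * real n\<rfloor> C}"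
      by blast
    then have "card {C \<in> Pow (interior_idx n). e \<le> dist (peano_family n C) lambda_family} \<le> card {C \<in> Pow (interior_idx n). \<not> tame n \<lfloor>\<delta> * real n\<rfloor> C}"
      by (intro card_mono) auto
    then show ?case by (simp add: divide_right_mono)
  qed
  then show ?thesis by (rule Lim_null_comparison[OF _ fraction_not_tame_tendsto_0[OF \<delta>(1)]])
qed

lemma fair_peano_paths_subset: "1 \<le> n \<Longrightarrow> fair_peano_paths n \<subseteq> X_space"
  unfolding X_space_def using closure_subset by fastforce

text \<open>
  The approximating families exist because for large \<open>n\<close> most of them are close.
\<close>

lemma lambda_in_X_space: "lambda_family \<in> X_space"
  unfolding X_space_def closure_approachable
proof (intro allI impI)
  fix e :: real assume "0 < e"
  have "\<forall>\<^sub>F n in sequentially. real (card {C \<in> Pow (interior_idx n). e \<le> dist (peano_family n C) lambda_family}) / 2 ^ card (interior_idx n) < 1"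
    using order_tendstoD(2)[OF fraction_far_tendsto_0[OF \<open>0 < e\<close>], of 1] by simp
  then have "\<forall>\<^sub>F n in sequentially. real (card {C \<in> Pow (interior_idx n). e \<le> dist (peano_family n C) lambda_family}) / 2 ^ card (interior_idx n) < 1 \<and> 1 \<le> n"
    using eventually_ge_at_top[of 1] by (rule eventually_conj)
  from eventually_happens'[OF sequentially_bot this]
  obtain n where n: "real (card {C \<in> Pow (interior_idx n). e \<le> dist (peano_family n C) lambda_family}) / 2 ^ card (interior_idx n) < 1" "1 \<le> n"
    by (elim exE conjE)
  have "\<exists>C\<in>Pow (interior_idx n). dist (peano_family n C) lambda_family < e"
  proof (rule ccontr)
    assume "\<not> (\<exists>C\<in>Pow (interior_idx n). dist (peano_family n C) lambda_family < e)"
    then have "\<forall>C\<in>Pow (interior_idx n). e \<le> dist (peano_family n C) lambda_family" unfolding bex_simps not_less Bex_def by (meson linorder_not_less)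
    then have "{C \<in> Pow (interior_idx n). e \<le> dist (peano_family n C) lambda_family} = Pow (interior_idx n)" by blast
    then show False using n(1) by (simp add: card_Pow)
  qed
  then obtain C where "C \<in> Pow (interior_idx n)" "dist (peano_family n C) lambda_family < e" by (elim bexE)
  moreover from this have "peano_family n C \<in> fair_peano_paths n" using n(2) fair_peano_paths_eq[of n] by simp
  ultimately show "\<exists>y\<in>\<Union>n\<in>{1..}. fair_peano_paths n. dist y lambda_family < e"
    using n(2) by (intro bexI[of _ "peano_family n C"] UN_I[of n]) auto
qed

lemma space_borel_X: "space borel_X = X_space"
  by (simp add: borel_X_def space_restrict_space)

lemma fair_peano_paths_finite: "1 \<le> n \<Longrightarrow> finite (fair_peano_paths n) \<and> fair_peano_paths n \<noteq> {}"
  by (auto simp: fair_peano_paths_eq)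

lemma measurable_uniform:
  "1 \<le> n \<Longrightarrow> (\<lambda>x. x) \<in> measurable (uniform_count_measure (fair_peano_paths n)) borel_X"
  using fair_peano_paths_subset[of n]
  by (intro measurableI) (auto simp: space_uniform_count_measure sets_uniform_count_measure space_borel_X)

lemma prob_space_peano_measure:
  assumes "1 \<le> n"
  shows "prob_space (peano_measure n)"
  unfolding peano_measure_def using fair_peano_paths_finite[OF assms]
  by (intro prob_space.prob_space_distr prob_space_uniform_count_measure measurable_uniform assms) auto

lemma integral_peano_measure:
  fixes f :: "growing \<Rightarrow> real"
  assumes "1 \<le> n" "f \<in> borel_measurable borel_X"
  shows "integral\<^sup>L (peano_measure n) f = (\<Sum>C\<in>Pow (interior_idx n). f (peano_family n C)) / 2 ^ card (interior_idx n)"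
proof -
  have inj: "inj_on (peano_family n) (Pow (interior_idx n))" using inj_peano_family assms by simp
  have "integral\<^sup>L (peano_measure n) f = (\<Sum>x\<in>fair_peano_paths n. f x) / card (fair_peano_paths n)"
    unfolding peano_measure_def integral_distr[OF measurable_uniform[OF assms(1)] assms(2)]
    using fair_peano_paths_finite[OF assms(1)] by (simp add: integral_uniform_count_measure)
  also have "\<dots> = (\<Sum>C\<in>Pow (interior_idx n). f (peano_family n C)) / 2 ^ card (interior_idx n)"
    using assms(1) fair_peano_paths_eq[of n] inj by (simp add: sum.reindex card_image card_Pow)
  finally show ?thesis .
qed

lemma weak_convergence: "weakly_converges_on X_space peano_measure (return borel_X lambda_family)"
  unfolding weakly_converges_on_def
proof (intro allI impI, elim conjE)
  fix f :: "growing \<Rightarrow> real"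
  assume cont: "continuous_on X_space f" and "bounded (f ` X_space)"
  then obtain K where K: "\<And>x. x \<in> X_space \<Longrightarrow> \<bar>f x\<bar> \<le> K" unfolding bounded_iff by auto
  have meas: "f \<in> borel_measurable borel_X"
    unfolding borel_X_def by (rule borel_measurable_continuous_on_restrict[OF cont])
  have lim: "integral\<^sup>L (return borel_X lambda_family) f = f lambda_family"
    using lambda_in_X_space meas by (intro integral_return) (auto simp: space_borel_X)
  have K0: "0 \<le> K" using K[OF lambda_in_X_space] by linarith
  show "(\<lambda>n. integral\<^sup>L (peano_measure n) f) \<longlonglongrightarrow> integral\<^sup>L (return borel_X lambda_family) f"
    unfolding lim
  proof (rule tendstoI)
    fix e :: real assume "0 < e"
    then obtain d where d: "0 < d" "\<And>x. x \<in> X_space \<Longrightarrow> dist x lambda_family < d \<Longrightarrow> dist (f x) (f lambda_family) < e / 2"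
      using cont lambda_in_X_space unfolding continuous_on_iff by (metis half_gt_zero)
    let ?far = "\<lambda>n. {C \<in> Pow (interior_idx n). d \<le> dist (peano_family n C) lambda_family}"
    have "(\<lambda>n. 2 * K * (real (card (?far n)) / 2 ^ card (interior_idx n))) \<longlonglongrightarrow> 2 * K * 0"
      by (intro tendsto_mult tendsto_const fraction_far_tendsto_0 d(1))
    then have "\<forall>\<^sub>F n in sequentially. 2 * K * (real (card (?far n)) / 2 ^ card (interior_idx n)) < e / 2"
      using \<open>0 < e\<close> by (intro order_tendstoD(2)) auto
    then show "\<forall>\<^sub>F n in sequentially. dist (integral\<^sup>L (peano_measure n) f) (f lambda_family) < e"
      using eventually_ge_at_top[of 1]
    proof eventually_elim
      case (elim n)
      let ?N = "2 ^ card (interior_idx n) :: real"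
      let ?g = "\<lambda>C. f (peano_family n C) - f lambda_family"
      have X: "peano_family n C \<in> X_space" if "C \<in> Pow (interior_idx n)" for C
        using fair_peano_paths_subset[OF elim(2)] fair_peano_paths_eq[of n] elim(2) that by auto
      have bound: "\<bar>?g C\<bar> \<le> e / 2 + (if C \<in> ?far n then 2 * K else 0)" if C: "C \<in> Pow (interior_idx n)" for C
      proof (cases "d \<le> dist (peano_family n C) lambda_family")
        case True
        have "\<bar>?g C\<bar> \<le> 2 * K" using K[OF X[OF C]] K[OF lambda_in_X_space] by linarith
        then show ?thesis using True C \<open>0 < e\<close> by simp
      next
        case False
        then show ?thesis using d(2)[OF X[OF C]] by (simp add: dist_real_def)
      qed
      have "integral\<^sup>L (peano_measure n) f - f lambda_family = (\<Sum>C\<in>Pow (interior_idx n). ?g C) / ?N"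
        unfolding integral_peano_measure[OF elim(2) meas] by (simp add: sum_subtractf card_Pow diff_divide_distrib)
      also have "\<bar>\<dots>\<bar> \<le> (\<Sum>C\<in>Pow (interior_idx n). \<bar>?g C\<bar>) / ?N"
        by (simp add: divide_right_mono sum_abs)
      also have "\<dots> \<le> (\<Sum>C\<in>Pow (interior_idx n). e / 2 + (if C \<in> ?far n then 2 * K else 0)) / ?N"
        by (intro divide_right_mono sum_mono bound) auto
      also have "(\<Sum>C\<in>Pow (interior_idx n). e / 2 + (if C \<in> ?far n then 2 * K else 0)) = ?N * (e / 2) + real (card (?far n)) * (2 * K)"
        by (simp add: sum.distrib card_Pow sum.inter_filter[symmetric])
      also have "\<dots> / ?N = e / 2 + 2 * K * (real (card (?far n)) / ?N)" by (simp add: field_simps)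
      also have "\<dots> < e" using elim(1) by simp
      finally show ?case by (simp add: dist_real_def)
    qed
  qed
qed

theorem theorem1p1:
  shows "(\<forall>n\<ge>1. finite (fair_peano_paths n) \<and> fair_peano_paths n \<subseteq> X_space \<and> prob_space (peano_measure n)) \<and>
         lambda_family \<in> X_space \<and>
         weakly_converges_on X_space peano_measure (return borel_X lambda_family)"
  using fair_peano_paths_finite fair_peano_paths_subset prob_space_peano_measure lambda_in_X_space weak_convergence
  by blast

end
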